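(* Let $(M^7,g,\omega^3)$ be a $7$-dimensional Riemannian manifold with a $G_2$-structure $\omega^3$, and let $\Gamma$ be the associated $1$-form with values in $\mathfrak m=\mathfrak g_2^\perp$ (see context). The following conditions are equivalent: 1) The $\Lambda^2_{14}$-component of $\Gamma$ is zero. 2) There exists an affine connection $\nabla$ with totally skew-symmetric torsion preserving the $G_2$-structure, $\nabla\omega^3=0$. In this case the connection $\nabla$ is unique.
   Context: On $\mathbb R^7$ let $\omega^3=e_{127}+e_{135}-e_{146}-e_{236}-e_{245}+e_{347}+e_{567}$, $e_{ijk}=e_i\wedge e_j\wedge e_k$; $G_2\subset SO(7)$ is its stabilizer. A $G_2$-structure on an oriented Riemannian $7$-manifold $(M^7,g)$ is a $3$-form $\omega^3$ having this form in suitable local oriented orthonormal frames; these frames form a $G_2$-subbundle $\mathcal R$ of the oriented orthonormal frame bundle. Let $\mathfrak{so}(7)=\mathfrak g_2\oplus\mathfrak m$ be the orthogonal decomposition, and let $\Gamma$ be the $\mathfrak m$-part of the restriction to $\mathcal R$ of the Levi-Civita connection form; $\Gamma$ is a $1$-form on $M^7$ with values in $\mathcal R\times_{G_2}\mathfrak m$, i.e. a section of the bundle associated with $\mathbb R^7\otimes\mathfrak m$. As $G_2$-representation, $\mathfrak m\cong\mathbb R^7$ and $\mathbb R^7\otimes\mathfrak m=\Lambda^0_1\oplus\Lambda^1_7\oplus\Lambda^2_{14}\oplus\Lambda^3_{27}$, with irreducible summands of dimensions $1,7,14,27$, where $\Lambda^2_{14}\cong\mathfrak g_2$; the $\Lambda^2_{14}$-component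 of $\Gamma$ is its projection to that summand. An affine connection $\nabla$ has totally skew-symmetric torsion if $T(X,Y,Z)=g(T(X,Y),Z)$, with $T(X,Y)=\nabla_XY-\nabla_YX-[X,Y]$, is a $3$-form. *)

theory Defs
  imports "HOL-Analysis.Analysis"
begin

section \<open>Linear algebra of \<open>G\<^sub>2\<close>\<close>

text \<open>
  The index type \<open>7\<close> is the integers modulo 7, so the numeral \<open>7 :: 7\<close> denotes the element \<open>0\<close>
  and the seven indices are indeed \<open>1, ..., 7\<close>.  Wedge products carry no factor \<open>1/6\<close>: the form
  \<open>e_ijk\<close> takes the value 1 on the basis vectors number \<open>i\<close>, \<open>j\<close>, \<open>k\<close>.
\<close>

definition e3 :: "7 \<Rightarrow> 7 \<Rightarrow> 7 \<Rightarrow> real^7 \<Rightarrow> real^7 \<Rightarrow> real^7 \<Rightarrow> real" where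
  "e3 i j k x y z = det (vector [vector [x $ i, x $ j, x $ k],
                                 vector [y $ i, y $ j, y $ k],
                                 vector [z $ i, z $ j, z $ k]] :: real^3^3)"

definition omega0 :: "real^7 \<Rightarrow> real^7 \<Rightarrow> real^7 \<Rightarrow> real" where
  "omega0 x y z = e3 1 2 7 x y z + e3 1 3 5 x y z - e3 1 4 6 x y z - e3 2 3 6 x y z
                  - e3 2 4 5 x y z + e3 3 4 7 x y z + e3 5 6 7 x y z"

definition G2 :: "(real^7^7) set" where
  "G2 = {A. orthogonal_matrix A \<and> det A = 1 \<and>
            (\<forall>x y z. omega0 (A *v x) (A *v y) (A *v z) = omega0 x y z)}"

definition so7 :: "(real^7^7) set" where
  "so7 = {X. transpose X = - X}"

definition g2 :: "(real^7^7) set" where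
  "g2 = {X \<in> so7. \<forall>x y z.
           omega0 (X *v x) y z + omega0 x (X *v y) z + omega0 x y (X *v z) = 0}"

text \<open>
  The inner product of \<open>real^7^7\<close> is \<open>tr (X\<^sup>T Y)\<close>, which on \<open>so7\<close> is a negative
  multiple of the Killing form.
\<close>

definition m7 :: "(real^7^7) set" where
  "m7 = {X \<in> so7. \<forall>Y \<in> g2. orthogonal X Y}"

definition ortho_proj :: "'v::euclidean_space set \<Rightarrow> 'v \<Rightarrow> 'v" where
  "ortho_proj S x = (THE y. y \<in> S \<and> (\<forall>z \<in> S. orthogonal (x - y) z))"

text \<open>
  An element \<open>\<Sum>k. e_k \<otimes> X_k\<close> of the tensor product of \<open>\<real>\<^sup>7\<close> with \<open>m7\<close> is encoded as the array
  \<open>\<gamma>\<close> with \<open>\<gamma> $ k = X_k\<close>; equivalently, \<open>\<gamma> $ k\<close> is the value at the \<open>k\<close>-th basis vector of the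
  corresponding linear map into \<open>m7\<close>.
\<close>

definition R7_tensor_m7 :: "(real^7^7^7) set" where
  "R7_tensor_m7 = {\<gamma>. \<forall>k. \<gamma> $ k \<in> m7}"

definition Ad_action :: "real^7^7 \<Rightarrow> real^7^7 \<Rightarrow> real^7^7" where
  "Ad_action A X = A ** X ** matrix_inv A"

definition tensor_action :: "real^7^7 \<Rightarrow> real^7^7^7 \<Rightarrow> real^7^7^7" where
  "tensor_action A \<gamma> = (\<chi> k. \<Sum>l\<in>UNIV. (A $ k $ l) *\<^sub>R Ad_action A (\<gamma> $ l))"

text \<open>
  The decomposition of the tensor product is multiplicity free, so exactly one of its subspaces is
  isomorphic, as a representation of \<open>G2\<close>, to the (irreducible, 14-dimensional) adjoint
  representation; the projection along the other summands is the orthogonal one.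
\<close>

definition iso_to_g2 :: "(real^7^7^7) set \<Rightarrow> bool" where
  "iso_to_g2 W \<longleftrightarrow> (\<exists>F. linear F \<and> inj_on F g2 \<and> F ` g2 = W \<and>
     (\<forall>A \<in> G2. \<forall>X \<in> g2. F (Ad_action A X) = tensor_action A (F X)))"

definition Lambda14 :: "(real^7^7^7) set" where
  "Lambda14 = (THE W. subspace W \<and> W \<subseteq> R7_tensor_m7 \<and> iso_to_g2 W)"

definition Lambda14_component :: "real^7^7^7 \<Rightarrow> real^7^7^7" where
  "Lambda14_component \<gamma> = ortho_proj Lambda14 \<gamma>"


section \<open>Oriented smooth 7-manifolds\<close>

text \<open>Both notions below are meant for an open set \<open>S\<close>.\<close>

primrec Ck_on :: "nat \<Rightarrow> ('a::real_normed_vector \<Rightarrow> 'b::real_normed_vector) \<Rightarrow> 'a set \<Rightarrow> bool" where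
  "Ck_on 0 f S = continuous_on S f"
| "Ck_on (Suc k) f S = ((\<forall>x\<in>S. f differentiable (at x)) \<and>
     (\<forall>v. Ck_on k (\<lambda>x. frechet_derivative f (at x) v) S))"

definition smooth_on :: "('a::real_normed_vector \<Rightarrow> 'b::real_normed_vector) \<Rightarrow> 'a set \<Rightarrow> bool" where
  "smooth_on f S \<longleftrightarrow> (\<forall>k. Ck_on k f S)"

type_synonym 'm chart = "'m set \<times> ('m \<Rightarrow> real^7)"

text \<open>
  The underlying point set of the manifold is the whole type \<open>'m\<close>; it is Hausdorff and second
  countable by its type class.  The orientation is the one given by the oriented atlas.
\<close>

definition is_chart :: "('m::topological_space) chart \<Rightarrow> bool" where
  "is_chart = (\<lambda>(U, \<phi>). open U \<and> open (\<phi> ` U) \<and> homeomorphism U (\<phi> ` U) \<phi> (inv_into U \<phi>))"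

definition oriented_smooth_atlas ::
    "('m::{t2_space, second_countable_topology}) chart set \<Rightarrow> bool" where
  "oriented_smooth_atlas A \<longleftrightarrow>
     (\<forall>c\<in>A. is_chart c) \<and> (\<Union>(U, \<phi>)\<in>A. U) = UNIV \<and>
     (\<forall>(U, \<phi>)\<in>A. \<forall>(V, \<psi>)\<in>A.
        smooth_on (\<psi> \<circ> inv_into U \<phi>) (\<phi> ` (U \<inter> V)) \<and>
        (\<forall>x \<in> \<phi> ` (U \<inter> V).
           det (matrix (frechet_derivative (\<psi> \<circ> inv_into U \<phi>) (at x))) > 0))"

definition smooth_fun :: "('m::topological_space) chart set \<Rightarrow> 'm set \<Rightarrow> ('m \<Rightarrow> real) \<Rightarrow> bool" where
  "smooth_fun A V f \<longleftrightarrow>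
     open V \<and> (\<forall>(U, \<phi>)\<in>A. smooth_on (f \<circ> inv_into U \<phi>) (\<phi> ` (U \<inter> V)))"

definition smooth_near :: "('m::topological_space) chart set \<Rightarrow> 'm \<Rightarrow> ('m \<Rightarrow> real) \<Rightarrow> bool" where
  "smooth_near A p f \<longleftrightarrow> (\<exists>V. p \<in> V \<and> smooth_fun A V f)"


section \<open>Tangent vectors, vector fields and frames\<close>

text \<open>
  A tangent vector at \<open>p\<close> is a derivation of the algebra of germs at \<open>p\<close> of smooth functions.  It is
  represented by a functional on all functions, depending only on the germ at \<open>p\<close> and set to 0 on
  functions that are not smooth near \<open>p\<close>; this makes equality of tangent vectors equality of
  functionals.  Function types carry no vector space structure here, so linear combinations are
  written out; \<open>\<lambda>f. 0\<close> is the zero vector.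
\<close>

type_synonym 'm tvec = "('m \<Rightarrow> real) \<Rightarrow> real"

definition tangent_space :: "('m::topological_space) chart set \<Rightarrow> 'm \<Rightarrow> 'm tvec set" where
  "tangent_space A p = {v.
     (\<forall>f g a b. smooth_near A p f \<and> smooth_near A p g \<longrightarrow>
        v (\<lambda>q. a * f q + b * g q) = a * v f + b * v g) \<and>
     (\<forall>f g. smooth_near A p f \<and> smooth_near A p g \<longrightarrow>
        v (\<lambda>q. f q * g q) = f p * v g + g p * v f) \<and>
     (\<forall>f g. smooth_near A p f \<and> (\<forall>\<^sub>F q in nhds p. f q = g q) \<longrightarrow> v f = v g) \<and>
     (\<forall>f. \<not> smooth_near A p f \<longrightarrow> v f = 0)}"

definition tangent_linear ::
    "('m::topological_space) chart set \<Rightarrow> 'm \<Rightarrow> ('m tvec \<Rightarrow> real) \<Rightarrow> bool" where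
  "tangent_linear A p L \<longleftrightarrow> (\<forall>v \<in> tangent_space A p. \<forall>w \<in> tangent_space A p. \<forall>a b.
     L (\<lambda>f. a * v f + b * w f) = a * L v + b * L w)"

definition vector_field ::
    "('m::topological_space) chart set \<Rightarrow> 'm set \<Rightarrow> ('m \<Rightarrow> 'm tvec) \<Rightarrow> bool" where
  "vector_field A U X \<longleftrightarrow> open U \<and> (\<forall>p\<in>U. X p \<in> tangent_space A p) \<and>
     (\<forall>V f. V \<subseteq> U \<and> smooth_fun A V f \<longrightarrow> smooth_fun A V (\<lambda>p. X p f))"

definition vector_field_near ::
    "('m::topological_space) chart set \<Rightarrow> 'm \<Rightarrow> ('m \<Rightarrow> 'm tvec) \<Rightarrow> bool" where
  "vector_field_near A p X \<longleftrightarrow> (\<exists>U. p \<in> U \<and> vector_field A U X)"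

definition lie_bracket ::
    "('m::topological_space) chart set \<Rightarrow> ('m \<Rightarrow> 'm tvec) \<Rightarrow> ('m \<Rightarrow> 'm tvec) \<Rightarrow> 'm \<Rightarrow> 'm tvec" where
  "lie_bracket A X Y p =
     (\<lambda>f. if smooth_near A p f then X p (\<lambda>q. Y q f) - Y p (\<lambda>q. X q f) else 0)"

definition tangent_basis :: "('m::topological_space) chart set \<Rightarrow> 'm \<Rightarrow> (7 \<Rightarrow> 'm tvec) \<Rightarrow> bool" where
  "tangent_basis A p u \<longleftrightarrow> (\<forall>i. u i \<in> tangent_space A p) \<and>
     (\<forall>v \<in> tangent_space A p. \<exists>!c::real^7. v = (\<lambda>f. \<Sum>i\<in>UNIV. c $ i * u i f))"

text \<open>The matrix below has the coordinates of \<open>u j\<close> in the chart \<open>(U, \<phi>)\<close> as its \<open>j\<close>-th column.\<close>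

definition oriented_frame :: "('m::topological_space) chart set \<Rightarrow> 'm \<Rightarrow> (7 \<Rightarrow> 'm tvec) \<Rightarrow> bool" where
  "oriented_frame A p u \<longleftrightarrow> tangent_basis A p u \<and>
     (\<forall>(U, \<phi>)\<in>A. p \<in> U \<longrightarrow> det ((\<chi> i j. u j (\<lambda>q. \<phi> q $ i)) :: real^7^7) > 0)"


section \<open>Metrics, 3-forms and \<open>G\<^sub>2\<close>-structures\<close>

definition riemannian_metric ::
    "('m::topological_space) chart set \<Rightarrow> ('m \<Rightarrow> 'm tvec \<Rightarrow> 'm tvec \<Rightarrow> real) \<Rightarrow> bool" where
  "riemannian_metric A g \<longleftrightarrow>
     (\<forall>p. \<forall>v \<in> tangent_space A p.
        tangent_linear A p (g p v) \<and>
        (\<forall>w \<in> tangent_space A p. g p v w = g p w v) \<and>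
        (v \<noteq> (\<lambda>f. 0) \<longrightarrow> g p v v > 0)) \<and>
     (\<forall>U X Y. vector_field A U X \<and> vector_field A U Y \<longrightarrow>
        smooth_fun A U (\<lambda>p. g p (X p) (Y p)))"

definition three_form ::
    "('m::topological_space) chart set \<Rightarrow> ('m \<Rightarrow> 'm tvec \<Rightarrow> 'm tvec \<Rightarrow> 'm tvec \<Rightarrow> real) \<Rightarrow> bool" where
  "three_form A \<tau> \<longleftrightarrow>
     (\<forall>p. \<forall>u \<in> tangent_space A p. \<forall>v \<in> tangent_space A p.
        tangent_linear A p (\<tau> p u v) \<and>
        (\<forall>w \<in> tangent_space A p.
           \<tau> p u v w = - \<tau> p v u w \<and> \<tau> p u v w = - \<tau> p u w v)) \<and>
     (\<forall>U X Y Z. vector_field A U X \<and> vector_field A U Y \<and> vector_field A U Z \<longrightarrow>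
        smooth_fun A U (\<lambda>p. \<tau> p (X p) (Y p) (Z p)))"

text \<open>
  The fibre at \<open>p\<close> of the bundle \<open>\<R>\<close> of oriented orthonormal frames in which the 3-form has the
  standard shape; then the local sections of that bundle.
\<close>

definition adapted_frame ::
    "('m::topological_space) chart set \<Rightarrow> ('m \<Rightarrow> 'm tvec \<Rightarrow> 'm tvec \<Rightarrow> real) \<Rightarrow>
     ('m \<Rightarrow> 'm tvec \<Rightarrow> 'm tvec \<Rightarrow> 'm tvec \<Rightarrow> real) \<Rightarrow> 'm \<Rightarrow> (7 \<Rightarrow> 'm tvec) \<Rightarrow> bool" where
  "adapted_frame A g \<omega> p u \<longleftrightarrow> oriented_frame A p u \<and>
     (\<forall>i j. g p (u i) (u j) = (if i = j then 1 else 0)) \<and>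
     (\<forall>i j k. \<omega> p (u i) (u j) (u k) = omega0 (axis i 1) (axis j 1) (axis k 1))"

definition adapted_section ::
    "('m::topological_space) chart set \<Rightarrow> ('m \<Rightarrow> 'm tvec \<Rightarrow> 'm tvec \<Rightarrow> real) \<Rightarrow>
     ('m \<Rightarrow> 'm tvec \<Rightarrow> 'm tvec \<Rightarrow> 'm tvec \<Rightarrow> real) \<Rightarrow> 'm set \<Rightarrow> ('m \<Rightarrow> 7 \<Rightarrow> 'm tvec) \<Rightarrow> bool" where
  "adapted_section A g \<omega> U e \<longleftrightarrow>
     (\<forall>i. vector_field A U (\<lambda>p. e p i)) \<and> (\<forall>p\<in>U. adapted_frame A g \<omega> p (e p))"

definition G2_structure ::
    "('m::topological_space) chart set \<Rightarrow> ('m \<Rightarrow> 'm tvec \<Rightarrow> 'm tvec \<Rightarrow> real) \<Rightarrow>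
     ('m \<Rightarrow> 'm tvec \<Rightarrow> 'm tvec \<Rightarrow> 'm tvec \<Rightarrow> real) \<Rightarrow> bool" where
  "G2_structure A g \<omega> \<longleftrightarrow> three_form A \<omega> \<and> (\<forall>p. \<exists>U e. p \<in> U \<and> adapted_section A g \<omega> U e)"


section \<open>Affine connections\<close>

text \<open>
  \<open>D p v Y\<close> is the covariant derivative at \<open>p\<close> of the locally defined vector field \<open>Y\<close> in the
  direction of the tangent vector \<open>v\<close>.  It depends only on the germ of \<open>Y\<close> at \<open>p\<close>, and is set to 0
  outside its proper domain, so that equality of connections is equality of functions.
\<close>

type_synonym 'm connection = "'m \<Rightarrow> 'm tvec \<Rightarrow> ('m \<Rightarrow> 'm tvec) \<Rightarrow> 'm tvec"

definition affine_connection ::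
    "('m::topological_space) chart set \<Rightarrow> 'm connection \<Rightarrow> bool" where
  "affine_connection A D \<longleftrightarrow>
     (\<forall>p Y. vector_field_near A p Y \<longrightarrow>
        (\<forall>v \<in> tangent_space A p. D p v Y \<in> tangent_space A p) \<and>
        (\<forall>v \<in> tangent_space A p. \<forall>w \<in> tangent_space A p. \<forall>a b.
           D p (\<lambda>f. a * v f + b * w f) Y = (\<lambda>f. a * D p v Y f + b * D p w Y f))) \<and>
     (\<forall>p Y Z. \<forall>v \<in> tangent_space A p. vector_field_near A p Y \<and> vector_field_near A p Z \<longrightarrow>
        D p v (\<lambda>q f. Y q f + Z q f) = (\<lambda>f. D p v Y f + D p v Z f)) \<and>
     (\<forall>p h Y. \<forall>v \<in> tangent_space A p. smooth_near A p h \<and> vector_field_near A p Y \<longrightarrow>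
        D p v (\<lambda>q f. h q * Y q f) = (\<lambda>f. v h * Y p f + h p * D p v Y f)) \<and>
     (\<forall>p Y Z. \<forall>v \<in> tangent_space A p.
        vector_field_near A p Y \<and> (\<forall>\<^sub>F q in nhds p. Y q = Z q) \<longrightarrow> D p v Y = D p v Z) \<and>
     (\<forall>U X Y. vector_field A U X \<and> vector_field A U Y \<longrightarrow>
        vector_field A U (\<lambda>p. D p (X p) Y)) \<and>
     (\<forall>p v Y. v \<notin> tangent_space A p \<or> \<not> vector_field_near A p Y \<longrightarrow> D p v Y = (\<lambda>f. 0))"

definition torsion ::
    "('m::topological_space) chart set \<Rightarrow> 'm connection \<Rightarrow>
     ('m \<Rightarrow> 'm tvec) \<Rightarrow> ('m \<Rightarrow> 'm tvec) \<Rightarrow> 'm \<Rightarrow> 'm tvec" where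
  "torsion A D X Y p = (\<lambda>f. D p (X p) Y f - D p (Y p) X f - lie_bracket A X Y p f)"

definition metric_connection ::
    "('m::topological_space) chart set \<Rightarrow> ('m \<Rightarrow> 'm tvec \<Rightarrow> 'm tvec \<Rightarrow> real) \<Rightarrow>
     'm connection \<Rightarrow> bool" where
  "metric_connection A g D \<longleftrightarrow>
     (\<forall>p X Y. \<forall>v \<in> tangent_space A p. vector_field_near A p X \<and> vector_field_near A p Y \<longrightarrow>
        v (\<lambda>q. g q (X q) (Y q)) = g p (D p v X) (Y p) + g p (X p) (D p v Y))"

definition levi_civita ::
    "('m::topological_space) chart set \<Rightarrow> ('m \<Rightarrow> 'm tvec \<Rightarrow> 'm tvec \<Rightarrow> real) \<Rightarrow> 'm connection" where
  "levi_civita A g = (THE D. affine_connection A D \<and> metric_connection A g D \<and>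
     (\<forall>p X Y. vector_field_near A p X \<and> vector_field_near A p Y \<longrightarrow>
        torsion A D X Y p = (\<lambda>f. 0)))"

definition skew_symmetric_torsion ::
    "('m::topological_space) chart set \<Rightarrow> ('m \<Rightarrow> 'm tvec \<Rightarrow> 'm tvec \<Rightarrow> real) \<Rightarrow>
     'm connection \<Rightarrow> bool" where
  "skew_symmetric_torsion A g D \<longleftrightarrow> (\<exists>\<tau>. three_form A \<tau> \<and>
     (\<forall>p X Y Z. vector_field_near A p X \<and> vector_field_near A p Y \<and> vector_field_near A p Z \<longrightarrow>
        g p (torsion A D X Y p) (Z p) = \<tau> p (X p) (Y p) (Z p)))"

definition parallel_three_form ::
    "('m::topological_space) chart set \<Rightarrow> ('m \<Rightarrow> 'm tvec \<Rightarrow> 'm tvec \<Rightarrow> 'm tvec \<Rightarrow> real) \<Rightarrow>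
     'm connection \<Rightarrow> bool" where
  "parallel_three_form A \<omega> D \<longleftrightarrow>
     (\<forall>p X Y Z. \<forall>v \<in> tangent_space A p.
        vector_field_near A p X \<and> vector_field_near A p Y \<and> vector_field_near A p Z \<longrightarrow>
        v (\<lambda>q. \<omega> q (X q) (Y q) (Z q)) =
          \<omega> p (D p v X) (Y p) (Z p) + \<omega> p (X p) (D p v Y) (Z p) + \<omega> p (X p) (Y p) (D p v Z))"


section \<open>The \<open>m7\<close>-part of the Levi-Civita connection\<close>

text \<open>
  The pull-back of the connection form along a local frame \<open>e\<close> is the matrix of 1-forms
  \<open>\<omega>_ij (v) = g (D_v e_j, e_i)\<close>.
\<close>

definition connection_form ::
    "('m::topological_space) chart set \<Rightarrow> ('m \<Rightarrow> 'm tvec \<Rightarrow> 'm tvec \<Rightarrow> real) \<Rightarrow>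
     ('m \<Rightarrow> 7 \<Rightarrow> 'm tvec) \<Rightarrow> 'm \<Rightarrow> 'm tvec \<Rightarrow> real^7^7" where
  "connection_form A g e p v = (\<chi> i j. g p (levi_civita A g p v (\<lambda>q. e q j)) (e p i))"

text \<open>
  For a local section \<open>e\<close> of \<open>\<R>\<close>, \<open>Gamma_rep A g e p\<close> is the vector representing \<open>\<Gamma>\<close> at \<open>p\<close>, as an
  element of the associated bundle, in the adapted frame \<open>e p\<close>.
\<close>

definition Gamma_rep ::
    "('m::topological_space) chart set \<Rightarrow> ('m \<Rightarrow> 'm tvec \<Rightarrow> 'm tvec \<Rightarrow> real) \<Rightarrow>
     ('m \<Rightarrow> 7 \<Rightarrow> 'm tvec) \<Rightarrow> 'm \<Rightarrow> real^7^7^7" where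
  "Gamma_rep A g e p = (\<chi> k. ortho_proj m7 (connection_form A g e p (e p k)))"

definition Gamma_Lambda14_zero ::
    "('m::topological_space) chart set \<Rightarrow> ('m \<Rightarrow> 'm tvec \<Rightarrow> 'm tvec \<Rightarrow> real) \<Rightarrow>
     ('m \<Rightarrow> 'm tvec \<Rightarrow> 'm tvec \<Rightarrow> 'm tvec \<Rightarrow> real) \<Rightarrow> bool" where
  "Gamma_Lambda14_zero A g \<omega> \<longleftrightarrow>
     (\<forall>U e p. adapted_section A g \<omega> U e \<and> p \<in> U \<longrightarrow> Lambda14_component (Gamma_rep A g e p) = 0)"

end

theory Submission
  imports Defs
begin

text \<open>
  Identifying \<open>m7\<close> with \<open>real^7\<close> through the vector cross product turns the tensor product of
  \<open>\<real>\<^sup>7\<close> with \<open>m7\<close> into 7 by 7 matrices.  By Schur's lemma the adjoint summand consists of the matrices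
  in \<open>g2\<close>, and its orthogonal complement is the image of the 3-forms under
  \<open>S \<mapsto> (\<Sum>k. e_k \<otimes> (m7-part of S (e_k, _, _)))\<close>, which is injective.

  A connection preserving the 3-form is metric, because matrices annihilating the standard 3-form
  are skew-symmetric.  A metric connection with skew torsion \<open>\<tau>\<close> is determined by a Koszul formula,
  and its connection matrices are those of the Levi-Civita connection minus half of \<open>\<tau>\<close>.  It preserves
  the 3-form iff these matrices lie in \<open>g2\<close>, that is, iff the \<open>m7\<close>-part of \<open>\<tau>\<close> is
  twice \<open>\<Gamma>\<close>.  This is solvable for \<open>\<tau>\<close> iff \<open>\<Gamma>\<close> is orthogonal to the adjoint summand, and the solution
  is unique.
\<close>

section \<open>Coordinates in dimension seven\<close>

text \<open>Behind both the complement and the injectivity lies one fact: the orbit of the standard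
  3-form under GL(7) is open. The action of all 7 by 7 matrices on that form, \<open>act\<close>,
  has a kernel of dimension 14, so it maps onto the 3-forms, as 49 - 14 = 35. Up to transposition
  and a scalar, the map from 3-forms to matrices is the adjoint of this action; hence it is
  injective and its image is the orthogonal complement of the kernel. The obstacle in using Schur's
  lemma is that \<open>Lambda14\<close> is specified only by an abstract isomorphism, so every
  equivariant map from g2 into all 7 by 7 matrices has to be controlled. A few signed permutation
  matrices in G2 suffice for this. On the manifold, the equation for the torsion has constant
  coefficients in an adapted frame. A fixed linear map solves it, and applied in one smooth frame
  this map yields smooth components.\<close>

lemma exhaust_7:
  fixes x :: 7
  shows "x = 1 \<or> x = 2 \<or> x = 3 \<or> x = 4 \<or> x = 5 \<or> x = 6 \<or> x = 7"
proof (induct x)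
  case (of_int z)
  then have "z = 0 \<or> z = 1 \<or> z = 2 \<or> z = 3 \<or> z = 4 \<or> z = 5 \<or> z = 6" by fastforce
  then show ?case by auto
qed

lemma forall_7: "(\<forall>i::7. P i) \<longleftrightarrow> P 1 \<and> P 2 \<and> P 3 \<and> P 4 \<and> P 5 \<and> P 6 \<and> P 7"
  by (metis exhaust_7)

lemma sum_7: "sum f (UNIV::7 set) = f 1 + f 2 + f 3 + f 4 + f 5 + f 6 + f 7"
proof -
  have "UNIV = {1, 2, 3, 4, 5, 6, 7::7}" using exhaust_7 by auto
  then have "sum f UNIV = sum f {1, 2, 3, 4, 5, 6, 7}" by simp
  also have "\<dots> = f 1 + (f 2 + (f 3 + (f 4 + (f 5 + (f 6 + f 7)))))" by simp
  finally show ?thesis by (simp only: add.assoc)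
qed

lemma vector_7:
  "(vector [a1, a2, a3, a4, a5, a6, a7] :: 'a::zero^7) $ 1 = a1"
  "(vector [a1, a2, a3, a4, a5, a6, a7] :: 'a::zero^7) $ 2 = a2"
  "(vector [a1, a2, a3, a4, a5, a6, a7] :: 'a::zero^7) $ 3 = a3"
  "(vector [a1, a2, a3, a4, a5, a6, a7] :: 'a::zero^7) $ 4 = a4"
  "(vector [a1, a2, a3, a4, a5, a6, a7] :: 'a::zero^7) $ 5 = a5"
  "(vector [a1, a2, a3, a4, a5, a6, a7] :: 'a::zero^7) $ 6 = a6"
  "(vector [a1, a2, a3, a4, a5, a6, a7] :: 'a::zero^7) $ 7 = a7"
  unfolding vector_def by (simp_all)

section \<open>The splitting of the orthogonal Lie algebra\<close>

text \<open>If the cross product of x and y is defined by requiring its inner product with z to be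
  \<open>omega0 x y z\<close>, this is the matrix sending z to the cross product of z and v.\<close>

definition cross_matrix :: "real^7 \<Rightarrow> real^7^7" where
  "cross_matrix v = (\<chi> i j. omega0 v (axis i 1) (axis j 1))"

lemma cross_matrix_eq: "cross_matrix v = vector
  [vector [0, v $ 7, v $ 5, - v $ 6, - v $ 3, v $ 4, - v $ 2],
   vector [- v $ 7, 0, - v $ 6, - v $ 5, v $ 4, v $ 3, v $ 1],
   vector [- v $ 5, v $ 6, 0, v $ 7, v $ 1, - v $ 2, - v $ 4],
   vector [v $ 6, v $ 5, - v $ 7, 0, - v $ 2, - v $ 1, v $ 3],
   vector [v $ 3, - v $ 4, - v $ 1, v $ 2, 0, v $ 7, - v $ 6],
   vector [- v $ 4, - v $ 3, v $ 2, v $ 1, - v $ 7, 0, v $ 5],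
   vector [v $ 2, - v $ 1, v $ 4, - v $ 3, v $ 6, - v $ 5, 0]]"
  by (simp add: vec_eq_iff forall_7 vector_7 cross_matrix_def omega0_def e3_def det_3 axis_def)

lemma omega0_cross_matrix: "omega0 x y z = y \<bullet> (cross_matrix x *v z)"
  by (simp add: cross_matrix_eq inner_vec_def matrix_vector_mult_def sum_7 vector_7
      omega0_def e3_def det_3 algebra_simps)

lemma cross_matrix_entry: "cross_matrix x $ i $ j = omega0 x (axis i 1) (axis j 1)"
  by (simp add: cross_matrix_def)

lemma linear_cross_matrix: "linear cross_matrix"
  by (rule linearI) (simp_all add: vec_eq_iff forall_7 cross_matrix_eq vector_7)

lemma transpose_cross_matrix: "transpose (cross_matrix v) = - cross_matrix v"
  by (simp add: vec_eq_iff forall_7 cross_matrix_eq vector_7 transpose_def)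

lemma omega0_cyclic: "omega0 y z x = omega0 x y z"
  by (simp add: omega0_def e3_def det_3 algebra_simps)

text \<open>The adjoint of \<open>cross_matrix\<close>, as \<open>inner_cross_matrix\<close>
  confirms. On skew-symmetric matrices its kernel turns out to be g2.\<close>

definition contraction :: "real^7^7 \<Rightarrow> real^7" where
  "contraction M = (\<chi> k. M \<bullet> cross_matrix (axis k 1))"

lemma contraction_eq: "contraction M = vector
  [(M $ 2 $ 7 - M $ 7 $ 2) + (M $ 3 $ 5 - M $ 5 $ 3) - (M $ 4 $ 6 - M $ 6 $ 4),
   - (M $ 1 $ 7 - M $ 7 $ 1) - (M $ 3 $ 6 - M $ 6 $ 3) - (M $ 4 $ 5 - M $ 5 $ 4),
   - (M $ 1 $ 5 - M $ 5 $ 1) + (M $ 2 $ 6 - M $ 6 $ 2) + (M $ 4 $ 7 - M $ 7 $ 4),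
   (M $ 1 $ 6 - M $ 6 $ 1) + (M $ 2 $ 5 - M $ 5 $ 2) - (M $ 3 $ 7 - M $ 7 $ 3),
   (M $ 1 $ 3 - M $ 3 $ 1) - (M $ 2 $ 4 - M $ 4 $ 2) + (M $ 6 $ 7 - M $ 7 $ 6),
   - (M $ 1 $ 4 - M $ 4 $ 1) - (M $ 2 $ 3 - M $ 3 $ 2) - (M $ 5 $ 7 - M $ 7 $ 5),
   (M $ 1 $ 2 - M $ 2 $ 1) + (M $ 3 $ 4 - M $ 4 $ 3) + (M $ 5 $ 6 - M $ 6 $ 5)]"
  by (simp add: vec_eq_iff forall_7 contraction_def inner_vec_def sum_7 cross_matrix_eq
      vector_7 axis_def)

lemma linear_contraction: "linear contraction"
  unfolding contraction_def
  by (rule linearI) (simp_all add: vec_eq_iff inner_left_distrib)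

lemma inner_cross_matrix: "M \<bullet> cross_matrix v = contraction M \<bullet> v"
  by (simp add: inner_vec_def sum_7 cross_matrix_eq contraction_eq vector_7 algebra_simps)

text \<open>The triples of \<open>omega0\<close> are the lines of a Fano plane. Each index lies on
  three of them, and each of these contributes two entries of absolute value 1 to the matrix of a
  basis vector, whence the 6.\<close>

lemma contraction_cross_matrix: "contraction (cross_matrix v) = 6 *\<^sub>R v"
  by (simp add: vec_eq_iff forall_7 contraction_eq cross_matrix_eq vector_7)

lemma cross_matrix_inj: "cross_matrix u = cross_matrix v \<Longrightarrow> u = v"
  by (metis contraction_cross_matrix scaleR_left_imp_eq zero_neq_numeral)

text \<open>The derivative of \<open>omega0\<close> in the direction B, evaluated on basis vectors.
  Cyclic shifts bring the column of B into the first slot, so that every term is an entry of a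
  \<open>cross_matrix\<close>; see \<open>act_omega0\<close>.\<close>

definition act :: "real^7^7 \<Rightarrow> 7 \<Rightarrow> 7 \<Rightarrow> 7 \<Rightarrow> real" where
  "act B i j k = cross_matrix (column i B) $ j $ k + cross_matrix (column j B) $ k $ i
     + cross_matrix (column k B) $ i $ j"

lemma matrix_vector_axis: "B *v axis i 1 = column i (B :: real^7^7)"
  by (simp add: matrix_vector_mult_basis)

lemma act_omega0:
  "act B i j k = omega0 (B *v axis i 1) (axis j 1) (axis k 1)
     + omega0 (axis i 1) (B *v axis j 1) (axis k 1) + omega0 (axis i 1) (axis j 1) (B *v axis k 1)"
  unfolding act_def matrix_vector_axis cross_matrix_entry by (metis omega0_cyclic)

lemma linear_zero_on_axis:
  fixes f :: "real^7 \<Rightarrow> real"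
  assumes "linear f" "\<And>i. f (axis i 1) = 0"
  shows "f x = 0"
proof -
  have "f x = f (\<Sum>i\<in>UNIV. x $ i *\<^sub>R axis i 1)"
    by (simp add: basis_expansion[of x, unfolded scalar_mult_eq_scaleR])
  then show ?thesis
    by (simp add: linear_sum[OF assms(1)] linear_cmul[OF assms(1)] assms(2))
qed

lemma linear_omega0:
  "linear (\<lambda>x. omega0 x y z)" "linear (\<lambda>y. omega0 x y z)" "linear (\<lambda>z. omega0 x y z)"
  by (rule linearI; simp add: omega0_def e3_def det_3 algebra_simps)+

lemma act_eq_0_iff:
  "(\<forall>x y z. omega0 (B *v x) y z + omega0 x (B *v y) z + omega0 x y (B *v z) = 0)
     \<longleftrightarrow> (\<forall>i j k. act B i j k = 0)" (is "?L \<longleftrightarrow> ?R")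
proof
  assume ?R
  define F where "F x y z = omega0 (B *v x) y z + omega0 x (B *v y) z + omega0 x y (B *v z)"
    for x y z
  have lin: "linear (\<lambda>x. F x y z)" "linear (\<lambda>y. F x y z)" "linear (\<lambda>z. F x y z)" for x y z
    unfolding F_def
    by (intro linear_compose_add linear_omega0
        linear_compose[OF matrix_vector_mul_linear linear_omega0(1), unfolded o_def]
        linear_compose[OF matrix_vector_mul_linear linear_omega0(2), unfolded o_def]
        linear_compose[OF matrix_vector_mul_linear linear_omega0(3), unfolded o_def])+
  have "F (axis i 1) (axis j 1) (axis k 1) = 0" for i j k
    using \<open>?R\<close> by (simp add: F_def act_omega0)
  then have "F x y z = 0" for x y z
    using linear_zero_on_axis[OF lin(1)] linear_zero_on_axis[OF lin(2)]
      linear_zero_on_axis[OF lin(3)] by metis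
  then show ?L by (simp add: F_def)
qed (simp add: act_omega0)

text \<open>A 3-form has 35 components, those with increasing indices. Their vanishing gives 35
  equations in the 49 entries of B, equivalent to the 28 equations of skewness together with the 7
  equations of zero contraction.\<close>

lemma act_eq_0_imp:
  assumes "\<forall>i j k. act B i j k = 0"
  shows "transpose B = - B" "contraction B = 0"
proof -
  have act: "act B i j k = 0" for i j k using assms by blast
  note act = act[of 1 2 3] act[of 1 2 4] act[of 1 2 5] act[of 1 2 6] act[of 1 2 7] act[of 1 3 4]
    act[of 1 3 5] act[of 1 3 6] act[of 1 3 7] act[of 1 4 5] act[of 1 4 6] act[of 1 4 7]
    act[of 1 5 6] act[of 1 5 7] act[of 1 6 7] act[of 2 3 4] act[of 2 3 5] act[of 2 3 6]
    act[of 2 3 7] act[of 2 4 5] act[of 2 4 6] act[of 2 4 7] act[of 2 5 6] act[of 2 5 7]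
    act[of 2 6 7] act[of 3 4 5] act[of 3 4 6] act[of 3 4 7] act[of 3 5 6] act[of 3 5 7]
    act[of 3 6 7] act[of 4 5 6] act[of 4 5 7] act[of 4 6 7] act[of 5 6 7]
  note act = act[unfolded act_def cross_matrix_eq column_def, simplified vector_7 vec_lambda_beta]
  show "transpose B = - B"
    unfolding vec_eq_iff forall_7 transpose_def vec_lambda_beta vector_uminus_component
    by (intro conjI; use act in linarith)
  show "contraction B = 0"
    unfolding vec_eq_iff forall_7 contraction_eq vector_7 zero_index
    by (intro conjI; use act in linarith)
qed

lemma so7_iff: "X \<in> so7 \<longleftrightarrow> (\<forall>i j. X $ i $ j = - X $ j $ i)"
  by (auto simp: so7_def transpose_def vec_eq_iff)

lemma act_eq_0_if:
  assumes "X \<in> so7" "contraction X = 0"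
  shows "act X i j k = 0"
proof -
  have s: "X $ 1 $ 1 = 0" "X $ 2 $ 2 = 0" "X $ 3 $ 3 = 0" "X $ 4 $ 4 = 0" "X $ 5 $ 5 = 0"
      "X $ 6 $ 6 = 0" "X $ 7 $ 7 = 0"
    "X $ 2 $ 1 = - X $ 1 $ 2" "X $ 3 $ 1 = - X $ 1 $ 3" "X $ 4 $ 1 = - X $ 1 $ 4"
    "X $ 5 $ 1 = - X $ 1 $ 5" "X $ 6 $ 1 = - X $ 1 $ 6" "X $ 7 $ 1 = - X $ 1 $ 7"
    "X $ 3 $ 2 = - X $ 2 $ 3" "X $ 4 $ 2 = - X $ 2 $ 4" "X $ 5 $ 2 = - X $ 2 $ 5"
    "X $ 6 $ 2 = - X $ 2 $ 6" "X $ 7 $ 2 = - X $ 2 $ 7" "X $ 4 $ 3 = - X $ 3 $ 4"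
    "X $ 5 $ 3 = - X $ 3 $ 5" "X $ 6 $ 3 = - X $ 3 $ 6" "X $ 7 $ 3 = - X $ 3 $ 7"
    "X $ 5 $ 4 = - X $ 4 $ 5" "X $ 6 $ 4 = - X $ 4 $ 6" "X $ 7 $ 4 = - X $ 4 $ 7"
    "X $ 6 $ 5 = - X $ 5 $ 6" "X $ 7 $ 5 = - X $ 5 $ 7" "X $ 7 $ 6 = - X $ 6 $ 7"
    using assms(1) unfolding so7_iff by (metis equal_neg_zero)+
  note c = assms(2)[unfolded contraction_eq vec_eq_iff forall_7 vector_7 s zero_index]
  \<comment> \<open>Skewness leaves 21 entries. Each of the seven contraction equations eliminates
    one of them, and the remaining 14 are free coordinates on g2.\<close>
  have e: "X $ 5 $ 6 = - X $ 1 $ 2 - X $ 3 $ 4" "X $ 5 $ 7 = - X $ 1 $ 4 - X $ 2 $ 3"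
    "X $ 6 $ 7 = X $ 2 $ 4 - X $ 1 $ 3" "X $ 4 $ 7 = X $ 1 $ 5 - X $ 2 $ 6"
    "X $ 3 $ 7 = X $ 1 $ 6 + X $ 2 $ 5" "X $ 4 $ 5 = - X $ 1 $ 7 - X $ 3 $ 6"
    "X $ 4 $ 6 = X $ 2 $ 7 + X $ 3 $ 5"
    using c by linarith+
  have "\<forall>i j k. act X i j k = 0"
    unfolding forall_7 act_def cross_matrix_eq vector_7 column_def vec_lambda_beta s e by simp
  then show ?thesis by blast
qed

lemma g2_iff_contraction: "X \<in> g2 \<longleftrightarrow> X \<in> so7 \<and> contraction X = 0"
proof -
  have "X \<in> g2 \<longleftrightarrow> X \<in> so7 \<and> (\<forall>i j k. act X i j k = 0)"
    by (simp only: g2_def mem_Collect_eq act_eq_0_iff)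
  then show ?thesis
    by (metis act_eq_0_imp(2) act_eq_0_if)
qed

lemma g2_iff_act: "X \<in> g2 \<longleftrightarrow> (\<forall>i j k. act X i j k = 0)"
proof
  assume "\<forall>i j k. act X i j k = 0"
  then show "X \<in> g2"
    using act_eq_0_imp[of X] by (simp add: g2_iff_contraction so7_def)
qed (simp add: g2_iff_contraction act_eq_0_if)

section \<open>Orthogonal projections and the complement of g2\<close>

lemma ortho_proj_eq:
  assumes S: "subspace S" and y: "y \<in> S" "\<And>z. z \<in> S \<Longrightarrow> orthogonal (x - y) z"
  shows "ortho_proj S x = y"
  unfolding ortho_proj_def
proof (rule the_equality)
  fix y' assume y': "y' \<in> S \<and> (\<forall>z\<in>S. orthogonal (x - y') z)"
  have "y - y' \<in> S" using S y y' by (simp add: subspace_diff)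
  then have "(x - y) \<bullet> (y - y') = 0" "(x - y') \<bullet> (y - y') = 0"
    using y y' by (auto simp: orthogonal_def)
  then have "(y - y') \<bullet> (y - y') = 0" by (simp add: inner_diff_left)
  then show "y' = y" by simp
qed (use y in auto)

lemma ortho_proj_eq_0_iff:
  assumes S: "subspace S"
  shows "ortho_proj S x = 0 \<longleftrightarrow> (\<forall>z\<in>S. orthogonal x z)"
proof
  assume *: "ortho_proj S x = 0"
  obtain y z where yz: "y \<in> span S" "\<And>w. w \<in> span S \<Longrightarrow> orthogonal z w" "x = y + z"
    using orthogonal_subspace_decomp_exists by metis
  then have "ortho_proj S x = y"
    using S by (intro ortho_proj_eq) (auto simp: span_eq_iff[THEN iffD2])
  then show "\<forall>z\<in>S. orthogonal x z"
    using * yz by (simp add: span_base)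
next
  assume "\<forall>z\<in>S. orthogonal x z"
  then show "ortho_proj S x = 0"
    using S by (intro ortho_proj_eq) (auto simp: subspace_0)
qed

lemma cross_matrix_in_so7: "cross_matrix v \<in> so7"
  by (simp add: so7_def transpose_cross_matrix)

lemma subspace_so7: "subspace so7"
proof -
  have "transpose (X + Y) = transpose X + transpose Y" "transpose (c *\<^sub>R X) = c *\<^sub>R transpose X"
    for X Y :: "real^7^7" and c
    by (simp_all add: transpose_def vec_eq_iff)
  then show ?thesis
    by (simp add: subspace_def so7_def) (simp add: transpose_def vec_eq_iff)
qed

lemma subspace_g2: "subspace g2"
proof -
  have "g2 = so7 \<inter> {X. contraction X = 0}" by (auto simp: g2_iff_contraction)
  moreover have "subspace (so7 \<inter> {X. contraction X = 0})"
    by (intro subspace_inter subspace_so7 linear_subspace_kernel linear_contraction)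
  ultimately show ?thesis by (rule ssubst)
qed

lemma cross_matrix_in_m7: "cross_matrix v \<in> m7"
  by (auto simp: m7_def cross_matrix_in_so7 orthogonal_def g2_iff_contraction
      inner_cross_matrix inner_commute[of "cross_matrix v"])

text \<open>Removing the component along \<open>range cross_matrix\<close>, with the factor 1/6 that
  \<open>contraction_cross_matrix\<close> dictates, leaves a skew matrix of zero contraction, that
  is, an element of g2. It is also orthogonal to g2, hence zero.\<close>

lemma m7_eq: "m7 = range cross_matrix"
proof
  show "m7 \<subseteq> range cross_matrix"
  proof
    fix X assume X: "X \<in> m7"
    define Y where "Y = X - cross_matrix ((1/6) *\<^sub>R contraction X)"
    have "Y \<in> so7"
      using X by (auto simp: Y_def m7_def cross_matrix_in_so7 intro: subspace_diff[OF subspace_so7])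
    moreover have "contraction Y = 0"
      by (simp add: Y_def linear_diff[OF linear_contraction] contraction_cross_matrix)
    ultimately have "Y \<in> g2" by (simp add: g2_iff_contraction)
    then have "X \<bullet> Y = 0" "cross_matrix ((1/6) *\<^sub>R contraction X) \<bullet> Y = 0"
      using X cross_matrix_in_m7 by (auto simp: m7_def orthogonal_def)
    then have "Y \<bullet> Y = 0" by (simp add: Y_def inner_diff_left)
    then show "X \<in> range cross_matrix" by (simp add: Y_def)
  qed
qed (auto simp: cross_matrix_in_m7)

lemma ortho_proj_m7: "ortho_proj m7 X = cross_matrix ((1/6) *\<^sub>R contraction X)"
proof (rule ortho_proj_eq)
  show "subspace m7"
    unfolding m7_eq by (simp add: linear_cross_matrix linear_subspace_image)
qed (auto simp: m7_eq orthogonal_def inner_diff_left inner_cross_matrix contraction_cross_matrix)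

section \<open>The tensor product as the space of 7 by 7 matrices\<close>

definition cross_tensor :: "real^7^7 \<Rightarrow> real^7^7^7" where
  "cross_tensor B = (\<chi> k. cross_matrix (B $ k))"

lemma linear_cross_tensor: "linear cross_tensor"
  by (rule linearI) (simp_all add: vec_eq_iff cross_tensor_def linear_add[OF linear_cross_matrix]
      linear_cmul[OF linear_cross_matrix])

lemma inj_cross_tensor: "inj cross_tensor"
proof (rule injI)
  fix B C assume "cross_tensor B = cross_tensor C"
  then have "cross_tensor B $ k = cross_tensor C $ k" for k by simp
  then have "B $ k = C $ k" for k by (intro cross_matrix_inj) (simp add: cross_tensor_def)
  then show "B = C" by (simp add: vec_eq_iff)
qed

lemma R7_tensor_m7_eq: "R7_tensor_m7 = range cross_tensor"
proof
  show "R7_tensor_m7 \<subseteq> range cross_tensor"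
  proof
    fix \<gamma> assume "\<gamma> \<in> R7_tensor_m7"
    then obtain b where "\<And>k. \<gamma> $ k = cross_matrix (b k)"
      by (auto simp: R7_tensor_m7_def m7_eq image_iff) metis
    then have "\<gamma> = cross_tensor (\<chi> k. b k)"
      by (simp add: cross_tensor_def vec_eq_iff)
    then show "\<gamma> \<in> range cross_tensor" by simp
  qed
qed (auto simp: R7_tensor_m7_def cross_tensor_def cross_matrix_in_m7)

section \<open>Alternating arrays\<close>

definition alt7 :: "(real^7^7^7) set" where
  "alt7 = {T. \<forall>i j k. T $ i $ j $ k = - T $ j $ i $ k \<and> T $ i $ j $ k = - T $ i $ k $ j}"

text \<open>The adjoint of \<open>cross_tensor\<close>. By \<open>ortho_proj_m7\<close>, row k is
  six times the vector that represents the m7-part of \<open>T $ k\<close>.\<close>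

definition tensor_contraction :: "real^7^7^7 \<Rightarrow> real^7^7" where
  "tensor_contraction T = (\<chi> k. contraction (T $ k))"

lemma linear_tensor_contraction: "linear tensor_contraction"
  by (rule linearI) (simp_all add: vec_eq_iff tensor_contraction_def
      linear_add[OF linear_contraction] linear_cmul[OF linear_contraction])

lemma alt7_iff:
  "T \<in> alt7 \<longleftrightarrow> (\<forall>i j k. T $ i $ j $ k + T $ j $ i $ k = 0 \<and> T $ i $ j $ k + T $ i $ k $ j = 0)"
  by (simp only: alt7_def mem_Collect_eq eq_neg_iff_add_eq_0)

lemma subspace_alt7: "subspace alt7"
proof (rule subspaceI)
  show "0 \<in> alt7" by (simp add: alt7_iff)
next
  fix S T assume *: "S \<in> alt7" "T \<in> alt7"
  show "S + T \<in> alt7"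
    unfolding alt7_iff vector_add_component
  proof (intro allI conjI)
    fix i j k
    show "S $ i $ j $ k + T $ i $ j $ k + (S $ j $ i $ k + T $ j $ i $ k) = 0"
      "S $ i $ j $ k + T $ i $ j $ k + (S $ i $ k $ j + T $ i $ k $ j) = 0"
      using *[unfolded alt7_iff, rule_format, of i j k] by linarith+
  qed
next
  fix c and T assume *: "T \<in> alt7"
  then show "c *\<^sub>R T \<in> alt7"
    by (simp add: alt7_iff flip: distrib_left)
qed

lemma inner_cross_tensor: "cross_tensor B \<bullet> T = B \<bullet> tensor_contraction T"
  unfolding inner_vec_def[of "cross_tensor B" T] inner_vec_def[of B "tensor_contraction T"]
  by (simp add: cross_tensor_def tensor_contraction_def inner_commute[of "cross_matrix _"]
      inner_cross_matrix inner_commute[of "B $ _"])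

lemma g2_transpose: "X \<in> g2 \<Longrightarrow> transpose X \<in> g2"
  using subspace_neg[OF subspace_g2, of X] by (simp add: g2_iff_contraction so7_def)

lemma act_transpose:
  "act (transpose B) i j k = cross_matrix (B $ i) $ j $ k + cross_matrix (B $ j) $ k $ i
     + cross_matrix (B $ k) $ i $ j"
  by (simp add: act_def column_def transpose_def)

text \<open>An alternating array is invariant under cyclic shifts of its indices, so pairing it with
  \<open>cross_tensor B\<close> sees only the cyclic average of that tensor. Three times this
  average is \<open>act (transpose B)\<close>, which vanishes for B in g2.\<close>

lemma g2_orthogonal_tensor_contraction:
  assumes B: "B \<in> g2" and T: "T \<in> alt7"
  shows "B \<bullet> tensor_contraction T = 0"
proof -
  let ?a = "\<lambda>i j k. cross_matrix (B $ i) $ j $ k"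
  define S where "S = (\<Sum>i\<in>UNIV. \<Sum>j\<in>UNIV. \<Sum>k\<in>UNIV. ?a i j k * T $ i $ j $ k)"
  have cyc: "T $ j $ k $ i = T $ i $ j $ k" for i j k
    using T[unfolded alt7_iff, rule_format, of j k i] T[unfolded alt7_iff, rule_format, of i j k]
    by linarith
  have 1: "(\<Sum>i\<in>UNIV. \<Sum>j\<in>UNIV. \<Sum>k\<in>UNIV. f j k i) = (\<Sum>i\<in>UNIV. \<Sum>j\<in>UNIV. \<Sum>k\<in>UNIV. f i j k)"
    for f :: "7 \<Rightarrow> 7 \<Rightarrow> 7 \<Rightarrow> real"
    by (subst sum.swap, rule sum.cong[OF refl], subst sum.swap, rule refl)
  have S1: "S = (\<Sum>i\<in>UNIV. \<Sum>j\<in>UNIV. \<Sum>k\<in>UNIV. ?a i j k * T $ j $ k $ i)"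
    unfolding S_def by (intro sum.cong refl) (metis cyc)
  have S2: "S = (\<Sum>i\<in>UNIV. \<Sum>j\<in>UNIV. \<Sum>k\<in>UNIV. ?a j k i * T $ j $ k $ i)"
    unfolding S_def by (rule 1[symmetric])
  have "S = (\<Sum>i\<in>UNIV. \<Sum>j\<in>UNIV. \<Sum>k\<in>UNIV. ?a j k i * T $ i $ j $ k)"
    unfolding S2 by (intro sum.cong refl) (metis cyc)
  moreover have "S = (\<Sum>i\<in>UNIV. \<Sum>j\<in>UNIV. \<Sum>k\<in>UNIV. ?a k i j * T $ i $ j $ k)"
    unfolding S1 by (rule 1)
  ultimately have "3 * S = (\<Sum>i\<in>UNIV. \<Sum>j\<in>UNIV. \<Sum>k\<in>UNIV.
      act (transpose B) i j k * T $ i $ j $ k)"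
    by (simp add: act_transpose S_def sum.distrib distrib_right)
  then have "S = 0"
    using g2_transpose[OF B] by (simp add: g2_iff_act)
  moreover have "cross_tensor B \<bullet> T = S"
    by (simp add: inner_vec_def cross_tensor_def S_def)
  ultimately show ?thesis by (simp add: inner_cross_tensor)
qed

lemma g2_if_orthogonal_tensor_contraction:
  assumes "\<And>T. T \<in> alt7 \<Longrightarrow> B \<bullet> tensor_contraction T = 0"
  shows "B \<in> g2"
proof -
  have "act (transpose B) a b c = 0" for a b c
  proof -
    define E where "E i j k = (axis i (axis j (axis k 1)) :: real^7^7^7)" for i j k
    \<comment> \<open>The elementary 3-form on the indices a, b, c. Pairing
      \<open>cross_tensor B\<close> with it gives six signed entries that collapse in pairs to twice
      \<open>act (transpose B) a b c\<close>.\<close>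
    define T where "T = E a b c + E b c a + E c a b - E b a c - E a c b - E c b a"
    have "T \<in> alt7"
      unfolding alt7_iff T_def E_def axis_def by (auto simp: if_distrib[of "\<lambda>x. x $ _"] cong: if_cong)
    then have "cross_tensor B \<bullet> T = 0"
      using assms by (simp add: inner_cross_tensor)
    moreover have "cross_tensor B \<bullet> E i j k = cross_matrix (B $ i) $ j $ k" for i j k
      by (simp add: E_def inner_axis cross_tensor_def)
    moreover have "cross_matrix v $ j $ i = - cross_matrix v $ i $ j" for v i j
      using cross_matrix_in_so7 unfolding so7_iff by blast
    ultimately show ?thesis
      unfolding T_def inner_diff_right inner_add_right act_transpose
      by (smt (verit))
  qed
  then have "transpose B \<in> g2" by (simp add: g2_iff_act)
  then show ?thesis using g2_transpose by fastforce
qed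

text \<open>By the two preceding lemmas g2 is the orthogonal complement of the image. In finite
  dimension the image is in turn the complement of g2: the part of C orthogonal to the image lies in
  g2, hence is orthogonal to C as well.\<close>

lemma tensor_contraction_image_iff:
  "(\<exists>T\<in>alt7. tensor_contraction T = C) \<longleftrightarrow> (\<forall>B\<in>g2. orthogonal C B)"
proof
  assume "\<forall>B\<in>g2. orthogonal C B"
  let ?S = "tensor_contraction ` alt7"
  have S: "subspace ?S"
    by (simp add: linear_subspace_image linear_tensor_contraction subspace_alt7)
  obtain y z where yz: "y \<in> span ?S" "\<And>w. w \<in> span ?S \<Longrightarrow> orthogonal z w" "C = y + z"
    using orthogonal_subspace_decomp_exists by metis
  have "z \<in> g2"
    using yz(2) by (intro g2_if_orthogonal_tensor_contraction) (auto simp: orthogonal_def span_base)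
  then have "C \<bullet> z = 0" "y \<bullet> z = 0"
    using \<open>\<forall>B\<in>g2. orthogonal C B\<close> yz(1,2) by (auto simp: orthogonal_def inner_commute)
  then have "z \<bullet> z = 0" using yz(3) by (simp add: inner_add_left)
  then have "C \<in> ?S" using yz S by (metis span_eq_iff add_0_right inner_eq_zero_iff)
  then show "\<exists>T\<in>alt7. tensor_contraction T = C" by auto
qed (auto simp: orthogonal_def inner_commute g2_orthogonal_tensor_contraction)

text \<open>This is dual to the surjectivity of the action of 7 by 7 matrices on
  \<open>omega0\<close>. It is verified by solving 49 linear equations in the 35 components of a
  3-form.\<close>

lemma tensor_contraction_eq_0:
  assumes T: "T \<in> alt7" "tensor_contraction T = 0"
  shows "T = 0"
proof -
  \<comment> \<open>A ranking of the indices turns skewness into a terminating rewriting rule, which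
    reduces every entry to one with increasing indices.\<close>
  define rk :: "7 \<Rightarrow> nat" where "rk i = (if i = 1 then 1 else if i = 2 then 2 else if i = 3 then 3
    else if i = 4 then 4 else if i = 5 then 5 else if i = 6 then 6 else 7)" for i
  have rk: "rk 1 = 1" "rk 2 = 2" "rk 3 = 3" "rk 4 = 4" "rk 5 = 5" "rk 6 = 6" "rk 7 = 7"
    by (simp_all add: rk_def)
  have a: "T $ i $ j $ k = - T $ j $ i $ k" "T $ i $ j $ k = - T $ i $ k $ j" for i j k
    using T(1) unfolding alt7_def by blast+
  have z: "T $ i $ i $ k = 0" "T $ k $ i $ i = 0" for i k
    using a[of i i k] a[of k i i] by auto
  have s: "rk j < rk i \<Longrightarrow> T $ i $ j $ k = - T $ j $ i $ k"
    "rk k < rk j \<Longrightarrow> T $ i $ j $ k = - T $ i $ k $ j" for i j k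
    using a by blast+
  have c: "\<forall>k. contraction (T $ k) = 0"
  proof
    fix k
    have "tensor_contraction T $ k = 0" using T(2) by simp
    then show "contraction (T $ k) = 0" by (simp add: tensor_contraction_def)
  qed
  note c = c[unfolded contraction_eq vec_eq_iff forall_7 vector_7 zero_index, simplified s rk z, simplified]
  show ?thesis
    unfolding vec_eq_iff forall_7 zero_index
    apply (simp add: s rk z)
    apply (intro conjI; use c in linarith)
    done
qed

text \<open>The torsion will be recovered from the connection coefficients by this one constant
  linear map. That is why linearity and values in \<open>alt7\<close> are asked for on the whole
  space and not only on the image.\<close>

lemma tensor_contraction_left_inverse:
  obtains L where "linear L" "\<And>C. L C \<in> alt7" "\<And>T. T \<in> alt7 \<Longrightarrow> L (tensor_contraction T) = T"
proof -
  have "inj_on tensor_contraction alt7"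
    using linear_injective_on_subspace_0[OF linear_tensor_contraction subspace_alt7]
      tensor_contraction_eq_0 by blast
  then show thesis
    using linear_exists_left_inverse_on[OF linear_tensor_contraction subspace_alt7] that by blast
qed

section \<open>The adjoint summand\<close>

lemma G2D:
  assumes "A \<in> G2"
  shows "matrix_inv A = transpose A" "A ** transpose A = mat 1" "transpose A ** A = mat 1"
    "omega0 (A *v x) (A *v y) (A *v z) = omega0 x y z"
    "omega0 (A *v x) y z = omega0 x (transpose A *v y) (transpose A *v z)"
proof -
  show 1: "A ** transpose A = mat 1" "transpose A ** A = mat 1"
    using assms by (auto simp: G2_def orthogonal_matrix_def)
  show "matrix_inv A = transpose A"
  proof -
    have "\<exists>B. A ** B = mat 1 \<and> B ** A = mat 1" using 1 by blast
    then have "A ** matrix_inv A = mat 1"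
      unfolding matrix_inv_def by (rule someI2_ex) simp
    then have "transpose A ** (A ** matrix_inv A) = transpose A" by simp
    then show ?thesis by (simp add: matrix_mul_assoc 1)
  qed
  show *: "omega0 (A *v x) (A *v y) (A *v z) = omega0 x y z" for x y z
    using assms by (auto simp: G2_def)
  show "omega0 (A *v x) y z = omega0 x (transpose A *v y) (transpose A *v z)"
    using *[of x "transpose A *v y" "transpose A *v z"]
    by (simp add: matrix_vector_mul_assoc 1 del: transpose_matrix_vector)
qed

lemma Ad_action_G2: "A \<in> G2 \<Longrightarrow> Ad_action A X = A ** X ** transpose A"
  by (simp add: Ad_action_def G2D)

lemma Ad_action_in_g2:
  assumes A: "A \<in> G2" and X: "X \<in> g2"
  shows "Ad_action A X \<in> g2"
proof -
  let ?Y = "A ** X ** transpose A"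
  have "transpose ?Y = - ?Y"
  proof -
    have "transpose ?Y = A ** (- X) ** transpose A"
      using X by (simp add: matrix_transpose_mul matrix_mul_assoc g2_def so7_def)
    also have "\<dots> = - ?Y"
      by (simp add: vec_eq_iff matrix_matrix_mult_def sum_negf)
    finally show ?thesis .
  qed
  moreover have "omega0 (?Y *v x) y z + omega0 x (?Y *v y) z + omega0 x y (?Y *v z) = 0" for x y z
  proof -
    let ?t = "\<lambda>x. transpose A *v x"
    have 1: "?Y *v x = A *v (X *v ?t x)" for x
      by (simp only: matrix_vector_mul_assoc matrix_mul_assoc)
    have "omega0 (?Y *v x) y z = omega0 (X *v ?t x) (?t y) (?t z)"
      unfolding 1 by (rule G2D(5)[OF A])
    moreover have "omega0 x (?Y *v y) z = omega0 (?t x) (X *v ?t y) (?t z)"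
      unfolding 1 using G2D(5)[OF A, of "X *v ?t y" z x] omega0_cyclic by metis
    moreover have "omega0 x y (?Y *v z) = omega0 (?t x) (?t y) (X *v ?t z)"
      unfolding 1 using G2D(5)[OF A, of "X *v ?t z" x y] omega0_cyclic by metis
    ultimately show ?thesis using X by (simp add: g2_def)
  qed
  ultimately show ?thesis by (simp add: Ad_action_G2[OF A] g2_def so7_def)
qed

lemma matrix_mul_transpose_row: "(Y ** transpose A) $ k = A *v (Y $ k)"
  for A Y :: "real^7^7"
  by (simp add: vec_eq_iff matrix_matrix_mult_def matrix_vector_mult_def transpose_def mult.commute)

lemma matrix_mul_row: "(A ** X) $ k = (\<Sum>l\<in>UNIV. A $ k $ l *\<^sub>R X $ l)"
  for A X :: "real^7^7"
  by (simp add: vec_eq_iff matrix_matrix_mult_def sum_component)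

lemma cross_matrix_G2:
  assumes A: "A \<in> G2"
  shows "cross_matrix (A *v v) = A ** cross_matrix v ** transpose A"
proof -
  have "cross_matrix (A *v v) $ i $ j = (A ** cross_matrix v ** transpose A) $ i $ j" for i j
  proof -
    have t: "transpose A *v axis k 1 = A $ k" for k
      by (simp add: vec_eq_iff matrix_vector_mult_basis column_def transpose_def)
    have "cross_matrix (A *v v) $ i $ j = A $ i \<bullet> (cross_matrix v *v (A $ j))"
      unfolding cross_matrix_entry G2D(5)[OF A] omega0_cross_matrix[of v] t ..
    also have "\<dots> = (A ** cross_matrix v ** transpose A) $ i $ j"
      unfolding matrix_mul_assoc[symmetric]
      by (simp add: matrix_matrix_mult_def[of A] matrix_matrix_mult_def[of "cross_matrix v"]
         inner_vec_def matrix_vector_mult_def transpose_def)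
    finally show ?thesis .
  qed
  then show ?thesis by (simp add: vec_eq_iff)
qed

text \<open>The group mixes the rows by A and rotates each row by A. As A is orthogonal, the two
  effects together are conjugation, so that \<open>cross_tensor\<close> carries g2 to a copy of the
  adjoint representation.\<close>

lemma cross_tensor_G2:
  assumes A: "A \<in> G2"
  shows "tensor_action A (cross_tensor X) = cross_tensor (Ad_action A X)"
proof -
  have "tensor_action A (cross_tensor X) $ k = cross_tensor (Ad_action A X) $ k" for k
  proof -
    have "tensor_action A (cross_tensor X) $ k
        = (\<Sum>l\<in>UNIV. A $ k $ l *\<^sub>R cross_matrix (A *v X $ l))"
      by (simp add: tensor_action_def Ad_action_G2[OF A] cross_tensor_def cross_matrix_G2[OF A])
    also have "\<dots> = cross_matrix (A *v (\<Sum>l\<in>UNIV. A $ k $ l *\<^sub>R X $ l))"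
      by (simp add: linear_sum[OF linear_cross_matrix] linear_cmul[OF linear_cross_matrix]
          linear_sum[OF matrix_vector_mul_linear] linear_cmul[OF matrix_vector_mul_linear])
    also have "\<dots> = cross_tensor (Ad_action A X) $ k"
      by (simp only: cross_tensor_def Ad_action_G2[OF A] matrix_mul_transpose_row vec_lambda_beta)
        (simp only: matrix_mul_row)
    finally show ?thesis .
  qed
  then show ?thesis by (simp add: vec_eq_iff)
qed

section \<open>Signed permutation matrices in G2\<close>

definition signed_perm :: "7^7 \<Rightarrow> real^7 \<Rightarrow> real^7^7" where
  "signed_perm q s = (\<chi> i j. if j = q $ i then s $ i else 0)"

lemma signed_perm_mult_vec: "signed_perm q s *v x = (\<chi> i. s $ i * x $ (q $ i))"
  by (simp add: signed_perm_def matrix_vector_mult_def vec_eq_iff if_distrib[of "\<lambda>x. x * _"]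
      cong: if_cong)

lemma signed_perm_mult:
  "signed_perm q s ** signed_perm r t
     = signed_perm (\<chi> i. r $ (q $ i)) (\<chi> i. s $ i * t $ (q $ i))"
  by (simp add: signed_perm_def matrix_matrix_mult_def vec_eq_iff if_distrib[of "\<lambda>x. x * _"]
      cong: if_cong)

lemma orthogonal_matrix_signed_perm:
  assumes "inj (($) q)" "\<And>i. s $ i * s $ i = 1"
  shows "orthogonal_matrix (signed_perm q s)"
proof -
  have "signed_perm q s ** transpose (signed_perm q s) = mat 1"
    using assms by (simp add: signed_perm_def matrix_matrix_mult_def vec_eq_iff transpose_def
        mat_def if_distrib[of "\<lambda>x. x * _"] inj_eq cong: if_cong)
  then show ?thesis
    by (metis orthogonal_matrix orthogonal_matrix_transpose transpose_transpose)
qed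

text \<open>Taking squares makes the determinant 1 without computing it.\<close>

lemma signed_perm_square_in_G2:
  assumes q: "inj (($) q)" "\<And>i. s $ i * s $ i = 1"
    and om: "\<And>x y z. omega0 (signed_perm q s *v x) (signed_perm q s *v y) (signed_perm q s *v z)
      = omega0 x y z"
    and "\<And>i. r $ i = q $ (q $ i)" "\<And>i. t $ i = s $ i * s $ (q $ i)"
  shows "signed_perm r t \<in> G2"
proof -
  let ?A = "signed_perm q s"
  have "signed_perm r t $ i $ j = (?A ** ?A) $ i $ j" for i j
    unfolding signed_perm_mult by (simp add: signed_perm_def assms(4,5))
  then have "signed_perm r t = ?A ** ?A"
    by (simp add: vec_eq_iff)
  moreover have "orthogonal_matrix ?A"
    using q by (rule orthogonal_matrix_signed_perm)
  moreover from this have "det ?A = 1 \<or> det ?A = - 1"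
    by (rule det_orthogonal_matrix)
  ultimately show ?thesis
    by (auto simp: G2_def orthogonal_matrix_mul det_mul om matrix_vector_mul_assoc[symmetric])
qed

lemma inj_nth_7:
  fixes q :: "'a^7"
  assumes "\<forall>i j. q $ i = q $ j \<longrightarrow> i = j"
  shows "inj (($) q)"
  using assms by (auto intro: injI)

lemma all_7I: "P 1 \<Longrightarrow> P 2 \<Longrightarrow> P 3 \<Longrightarrow> P 4 \<Longrightarrow> P 5 \<Longrightarrow> P 6 \<Longrightarrow> P 7 \<Longrightarrow> P (i::7)"
  using forall_7 by blast

text \<open>The first three preserve \<open>skew_unit 1 2 - skew_unit 3 4\<close> up to sign and
  will single it out. The fourth permutes the indices in a cycle of length 7 and the fifth has order
  3; these two generate the rest of g2 from that element.\<close>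

lemma signed_perms_in_G2:
  "signed_perm (vector [1, 2, 3, 4, 5, 6, 7]) (vector [1, -1, 1, -1, 1, -1, -1]) \<in> G2"
  "signed_perm (vector [1, 2, 4, 3, 6, 5, 7]) (vector [1, 1, -1, 1, 1, -1, 1]) \<in> G2"
  "signed_perm (vector [3, 4, 1, 2, 5, 6, 7]) (vector [-1, -1, 1, 1, 1, 1, 1]) \<in> G2"
  "signed_perm (vector [4, 1, 7, 5, 3, 2, 6]) (vector [1, 1, 1, 1, 1, 1, 1]) \<in> G2"
  "signed_perm (vector [5, 6, 1, 2, 3, 4, 7]) (vector [1, 1, 1, 1, 1, 1, 1]) \<in> G2"
proof -
  note simps = forall_7 vector_7 signed_perm_mult_vec omega0_def e3_def det_3
  \<comment> \<open>Each witness is a square root of the matrix in question. For the matrix of order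
    7 it is the fourth power, and for the one of order 3 the second power.\<close>
  show "signed_perm (vector [1, 2, 3, 4, 5, 6, 7]) (vector [1, -1, 1, -1, 1, -1, -1]) \<in> G2"
    by (rule signed_perm_square_in_G2[of "vector [1, 4, 3, 2, 5, 7, 6]" "vector [1, -1, 1, 1, 1, -1, 1]"];
      (rule inj_nth_7 | rule_tac i=i in all_7I)?; simp add: simps algebra_simps)
  show "signed_perm (vector [1, 2, 4, 3, 6, 5, 7]) (vector [1, 1, -1, 1, 1, -1, 1]) \<in> G2"
    by (rule signed_perm_square_in_G2[of "vector [2, 1, 6, 5, 3, 4, 7]" "vector [1, 1, 1, 1, 1, -1, -1]"];
      (rule inj_nth_7 | rule_tac i=i in all_7I)?; simp add: simps algebra_simps)
  show "signed_perm (vector [3, 4, 1, 2, 5, 6, 7]) (vector [-1, -1, 1, 1, 1, 1, 1]) \<in> G2"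
    by (rule signed_perm_square_in_G2[of "vector [4, 1, 2, 3, 5, 7, 6]" "vector [-1, 1, 1, 1, -1, -1, -1]"];
      (rule inj_nth_7 | rule_tac i=i in all_7I)?; simp add: simps algebra_simps)
  show "signed_perm (vector [4, 1, 7, 5, 3, 2, 6]) (vector [1, 1, 1, 1, 1, 1, 1]) \<in> G2"
    by (rule signed_perm_square_in_G2[of "vector [7, 3, 1, 6, 2, 5, 4]" "vector [1, 1, 1, 1, 1, 1, 1]"];
      (rule inj_nth_7 | rule_tac i=i in all_7I)?; simp add: simps algebra_simps)
  show "signed_perm (vector [5, 6, 1, 2, 3, 4, 7]) (vector [1, 1, 1, 1, 1, 1, 1]) \<in> G2"
    by (rule signed_perm_square_in_G2[of "vector [3, 4, 5, 6, 1, 2, 7]" "vector [1, 1, 1, 1, 1, 1, 1]"];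
      (rule inj_nth_7 | rule_tac i=i in all_7I)?; simp add: simps algebra_simps)
qed

lemma Ad_action_signed_perm:
  assumes "signed_perm q s \<in> G2"
  shows "Ad_action (signed_perm q s) X $ i $ j = s $ i * s $ j * X $ (q $ i) $ (q $ j)"
  by (simp only: Ad_action_G2[OF assms] matrix_mul_transpose_row signed_perm_mult_vec vec_lambda_beta)
    (simp add: matrix_mul_row signed_perm_def if_distrib[of "\<lambda>x. x * _"] cong: if_cong)

section \<open>A spanning set of g2 and the equivariant maps on g2\<close>

definition skew_unit :: "7 \<Rightarrow> 7 \<Rightarrow> real^7^7" where
  "skew_unit i j = axis i (axis j 1) - axis j (axis i 1)"

lemma skew_unit_nth:
  "skew_unit i j $ a $ b = (if a = i \<and> b = j then 1 else 0) - (if a = j \<and> b = i then 1 else 0)"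
proof -
  have "axis i (axis j 1) $ a $ b = (if a = i \<and> b = j then 1 else 0 :: real)" for i j :: 7
    by (cases "a = i"; cases "b = j") (simp_all add: axis_def)
  then show ?thesis by (simp only: skew_unit_def vector_minus_component)
qed

text \<open>For each index there are three pairs completing it to a triple of \<open>omega0\<close>.
  Oriented consistently, the entries of X at these pairs sum to zero by the corresponding
  contraction equation, so they span a plane of differences of \<open>skew_unit\<close>s. The seven
  planes make up the 14 dimensions. The first summand belongs to the index 7, and the others are
  listed along the cycle of length 7.\<close>

lemma g2_decomposition:
  fixes X :: "real^7^7"
  assumes "X \<in> g2"
  defines "Y \<equiv> \<lambda>a b c d e f. X $ a $ b *\<^sub>R (skew_unit a b - skew_unit c d)
    - X $ e $ f *\<^sub>R (skew_unit c d - skew_unit e f)"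
  shows "X = Y 1 2 3 4 5 6 + Y 2 6 5 1 4 7 + Y 6 7 4 2 1 3 + Y 7 3 1 6 2 5
    + Y 3 5 2 7 6 4 + Y 5 4 6 3 7 1 + Y 4 1 7 5 3 2"
proof -
  have sk: "X $ i $ j = - X $ j $ i" for i j
    using assms(1) unfolding g2_iff_contraction so7_iff by blast
  note s = sk[of 1 1] sk[of 2 2] sk[of 3 3] sk[of 4 4] sk[of 5 5] sk[of 6 6] sk[of 7 7]
    sk[of 2 1] sk[of 3 1] sk[of 4 1] sk[of 5 1] sk[of 6 1] sk[of 7 1]
    sk[of 3 2] sk[of 4 2] sk[of 5 2] sk[of 6 2] sk[of 7 2] sk[of 4 3] sk[of 5 3] sk[of 6 3]
    sk[of 7 3] sk[of 5 4] sk[of 6 4] sk[of 7 4] sk[of 6 5] sk[of 7 5] sk[of 7 6]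
  have "contraction X = 0" using assms(1) unfolding g2_iff_contraction by (rule conjunct2)
  note c = this[unfolded contraction_eq vec_eq_iff forall_7 vector_7 zero_index]
  show ?thesis
    unfolding vec_eq_iff forall_7 Y_def
    by (simp add: skew_unit_nth) (intro conjI; use s c in linarith)
qed

text \<open>
  Three elements of \<open>G2\<close> fix \<open>skew_unit 1 2 - skew_unit 3 4\<close> up to sign, and up to a factor it is
  the only matrix transforming with these signs; so \<open>H\<close> scales it.  Its \<open>G2\<close>-orbit spans \<open>g2\<close>.
\<close>

lemma equivariant_into_g2:
  assumes H: "linear H"
    and eq: "\<And>A X. A \<in> G2 \<Longrightarrow> X \<in> g2 \<Longrightarrow> H (Ad_action A X) = Ad_action A (H X)"
    and X: "X \<in> g2"
  shows "H X \<in> g2"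
proof -
  define S where "S = {X \<in> g2. H X \<in> g2}"
  have S: "subspace S"
    using subspace_g2 unfolding S_def subspace_def
    by (simp add: linear_0[OF H] linear_add[OF H] linear_cmul[OF H])
  have S_Ad: "Ad_action A Y \<in> S" if "A \<in> G2" "Y \<in> S" for A Y
    using that by (simp add: S_def Ad_action_in_g2 eq)
  define P where "P a b c d \<longleftrightarrow> skew_unit a b - skew_unit c d \<in> S" for a b c d
  have base: "P 1 2 3 4"
  proof -
    let ?X = "skew_unit 1 2 - skew_unit 3 4"
    have X: "?X \<in> g2"
      by (simp add: g2_iff_contraction so7_def transpose_def contraction_eq vec_eq_iff forall_7
          vector_7 skew_unit_nth)
    have *: "\<epsilon> * H ?X $ i $ j = s $ i * s $ j * H ?X $ (q $ i) $ (q $ j)"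
      if "signed_perm q s \<in> G2" "Ad_action (signed_perm q s) ?X = \<epsilon> *\<^sub>R ?X" for q s \<epsilon> i j
    proof -
      have "\<epsilon> *\<^sub>R H ?X = Ad_action (signed_perm q s) (H ?X)"
        using eq[OF that(1) X] by (simp add: that(2) linear_cmul[OF H])
      then have "(\<epsilon> *\<^sub>R H ?X) $ i $ j = s $ i * s $ j * H ?X $ (q $ i) $ (q $ j)"
        by (simp only: Ad_action_signed_perm[OF that(1)])
      then show ?thesis by simp
    qed
    note Ad_simps = Ad_action_signed_perm vec_eq_iff forall_7 vector_7 skew_unit_nth
    have 1: "\<forall>i j. - 1 * H ?X $ i $ j = vector [1, -1, 1, -1, 1, -1, -1] $ i * vector [1, -1, 1, -1, 1, -1, -1] $ j
        * H ?X $ (vector [1, 2, 3, 4, 5, 6, 7] $ i) $ (vector [1, 2, 3, 4, 5, 6, 7] $ j)"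
      by (intro allI *[OF signed_perms_in_G2(1)]) (simp add: Ad_simps signed_perms_in_G2(1))
    have 2: "\<forall>i j. 1 * H ?X $ i $ j = vector [1, 1, -1, 1, 1, -1, 1] $ i * vector [1, 1, -1, 1, 1, -1, 1] $ j
        * H ?X $ (vector [1, 2, 4, 3, 6, 5, 7] $ i) $ (vector [1, 2, 4, 3, 6, 5, 7] $ j)"
      by (intro allI *[OF signed_perms_in_G2(2)]) (simp add: Ad_simps signed_perms_in_G2(2))
    have 3: "\<forall>i j. - 1 * H ?X $ i $ j = vector [-1, -1, 1, 1, 1, 1, 1] $ i * vector [-1, -1, 1, 1, 1, 1, 1] $ j
        * H ?X $ (vector [3, 4, 1, 2, 5, 6, 7] $ i) $ (vector [3, 4, 1, 2, 5, 6, 7] $ j)"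
      by (intro allI *[OF signed_perms_in_G2(3)]) (simp add: Ad_simps signed_perms_in_G2(3))
    \<comment> \<open>So far \<open>H ?X\<close> may be any matrix, not even skew. The first
      relation kills all entries except those between {1, 3, 5} and {2, 4, 6, 7}. The other two kill
      most of the survivors and tie the entries at (1,2), (2,1), (3,4), (4,3) to a single
      parameter.\<close>
    note n1 = 1[unfolded forall_7 vector_7, simplified]
    note n2 = 2[unfolded forall_7 vector_7, simplified n1 simp_thms]
    note n3 = 3[unfolded forall_7 vector_7, simplified n1 simp_thms]
    have "H ?X = H ?X $ 1 $ 2 *\<^sub>R ?X"
      unfolding vec_eq_iff forall_7
      by (simp add: skew_unit_nth n1) (intro conjI; use n2 n3 in linarith)
    then have "H ?X \<in> g2"
      using X subspace_scale[OF subspace_g2] by metis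
    then show ?thesis using X by (simp add: P_def S_def)
  qed
  have perm: "P a b c d"
    if q: "signed_perm q (vector [1, 1, 1, 1, 1, 1, 1]) \<in> G2" "\<forall>i j. q $ i = q $ j \<longrightarrow> i = j"
      and "P (q $ a) (q $ b) (q $ c) (q $ d)" for q a b c d
  proof -
    have "\<forall>i. (vector [1, 1, 1, 1, 1, 1, 1] :: real^7) $ i = 1"
      by (simp add: forall_7 vector_7)
    then have o: "(vector [1, 1, 1, 1, 1, 1, 1] :: real^7) $ i = 1" for i by blast
    have u: "skew_unit (q $ i) (q $ j) $ (q $ k) $ (q $ l) = skew_unit i j $ k $ l" for i j k l
    proof -
      have "q $ m = q $ n \<longleftrightarrow> m = n" for m n using q(2) by blast
      then show ?thesis by (simp only: skew_unit_nth)
    qed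
    have "skew_unit a b - skew_unit c d = Ad_action (signed_perm q (vector [1, 1, 1, 1, 1, 1, 1]))
        (skew_unit (q $ a) (q $ b) - skew_unit (q $ c) (q $ d))"
      by (simp add: vec_eq_iff Ad_action_signed_perm[OF q(1)] o u)
    then show ?thesis using S_Ad[OF q(1)] that(3) by (simp add: P_def)
  qed
  have inj: "\<forall>i j. (vector [5, 6, 1, 2, 3, 4, 7] :: 7^7) $ i
        = (vector [5, 6, 1, 2, 3, 4, 7] :: 7^7) $ j \<longrightarrow> i = j"
    "\<forall>i j. (vector [4, 1, 7, 5, 3, 2, 6] :: 7^7) $ i
        = (vector [4, 1, 7, 5, 3, 2, 6] :: 7^7) $ j \<longrightarrow> i = j"
    by (simp_all add: forall_7 vector_7)
  note p = perm[OF signed_perms_in_G2(5) inj(1)] and r = perm[OF signed_perms_in_G2(4) inj(2)]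
  \<comment> \<open>The element of order 3 yields the second generator of the plane of index 7. The
    element of order 7 then carries both generators through the other six planes; the rules run
    backwards, from the images of the indices to the indices.\<close>
  have a: "P 3 4 5 6" by (rule p) (simp add: vector_7 base)
  have b1: "P 2 6 5 1" by (rule r) (simp add: vector_7 base)
  have b2: "P 6 7 4 2" by (rule r) (simp add: vector_7 b1)
  have b3: "P 7 3 1 6" by (rule r) (simp add: vector_7 b2)
  have b4: "P 3 5 2 7" by (rule r) (simp add: vector_7 b3)
  have b5: "P 5 4 6 3" by (rule r) (simp add: vector_7 b4)
  have b6: "P 4 1 7 5" by (rule r) (simp add: vector_7 b5)
  have a1: "P 5 1 4 7" by (rule r) (simp add: vector_7 a)
  have a2: "P 4 2 1 3" by (rule r) (simp add: vector_7 a1)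
  have a3: "P 1 6 2 5" by (rule r) (simp add: vector_7 a2)
  have a4: "P 2 7 6 4" by (rule r) (simp add: vector_7 a3)
  have a5: "P 6 3 7 1" by (rule r) (simp add: vector_7 a4)
  have a6: "P 7 5 3 2" by (rule r) (simp add: vector_7 a5)
  have Y: "x *\<^sub>R (skew_unit a b - skew_unit c d) - y *\<^sub>R (skew_unit c d - skew_unit e f) \<in> S"
    if "P a b c d" "P c d e f" for a b c d e f x y
    using that unfolding P_def by (metis subspace_diff[OF S] subspace_scale[OF S])
  have "X \<in> S"
    by (subst g2_decomposition[OF X])
      (intro subspace_add[OF S] Y base a b1 b2 b3 b4 b5 b6 a1 a2 a3 a4 a5 a6)
  then show ?thesis by (simp add: S_def)
qed

lemma tensor_contraction_cross_tensor: "tensor_contraction (cross_tensor B) = 6 *\<^sub>R B"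
  by (simp add: vec_eq_iff tensor_contraction_def cross_tensor_def contraction_cross_matrix)

text \<open>The definite description demands uniqueness. An equivariant F is read through
  \<open>cross_tensor\<close> as an equivariant map H into matrices. It is enough that H maps g2
  into g2: this gives one inclusion, and the equality of dimensions gives the other.\<close>

lemma Lambda14_eq: "Lambda14 = cross_tensor ` g2"
  unfolding Lambda14_def
proof (rule the_equality)
  have "iso_to_g2 (cross_tensor ` g2)"
    unfolding iso_to_g2_def
    using linear_cross_tensor inj_cross_tensor cross_tensor_G2
    by (intro exI[of _ cross_tensor]) (auto intro: inj_on_subset)
  then show "subspace (cross_tensor ` g2) \<and> cross_tensor ` g2 \<subseteq> R7_tensor_m7 \<and>
      iso_to_g2 (cross_tensor ` g2)"
    by (auto simp: R7_tensor_m7_eq linear_subspace_image linear_cross_tensor subspace_g2)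
next
  fix W assume W: "subspace W \<and> W \<subseteq> R7_tensor_m7 \<and> iso_to_g2 W"
  then obtain F where F: "linear F" "inj_on F g2" "F ` g2 = W"
      "\<And>A X. A \<in> G2 \<Longrightarrow> X \<in> g2 \<Longrightarrow> F (Ad_action A X) = tensor_action A (F X)"
    unfolding iso_to_g2_def by blast
  \<comment> \<open>The inverse of \<open>cross_tensor\<close> on its range, applied after F; the
    factor is explained by \<open>tensor_contraction_cross_tensor\<close>.\<close>
  define H where "H X = (1/6) *\<^sub>R tensor_contraction (F X)" for X
  have H: "linear H"
    unfolding H_def
    by (intro linear_compose_scale_right linear_compose[OF F(1) linear_tensor_contraction, unfolded o_def])
  have FH: "F X = cross_tensor (H X)" if "X \<in> g2" for X
  proof -
    have "F X \<in> range cross_tensor"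
      using W F(3) that R7_tensor_m7_eq by blast
    then show ?thesis
      by (auto simp: H_def tensor_contraction_cross_tensor)
  qed
  have "H X \<in> g2" if "X \<in> g2" for X
  proof (rule equivariant_into_g2[OF H _ that])
    fix A X assume *: "A \<in> G2" "X \<in> g2"
    have "cross_tensor (H (Ad_action A X)) = cross_tensor (Ad_action A (H X))"
      using F(4)[OF *] * by (simp add: FH Ad_action_in_g2 cross_tensor_G2)
    then show "H (Ad_action A X) = Ad_action A (H X)"
      by (rule injD[OF inj_cross_tensor])
  qed
  then have "W \<subseteq> cross_tensor ` g2" using F(3) FH by auto
  moreover have "dim W = dim g2"
    using dim_image_eq[OF F(1), of g2] F(2,3) subspace_g2 by (simp add: span_eq_iff[THEN iffD2])
  moreover have "dim (cross_tensor ` g2) = dim g2"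
    by (intro dim_image_eq linear_cross_tensor inj_on_subset[OF inj_cross_tensor]) simp
  ultimately show "W = cross_tensor ` g2"
    using W by (intro subspace_dim_equal)
      (auto simp: linear_subspace_image linear_cross_tensor subspace_g2)
qed

lemma Lambda14_component_eq_0_iff:
  "Lambda14_component (cross_tensor C) = 0 \<longleftrightarrow> (\<exists>T\<in>alt7. tensor_contraction T = C)"
proof -
  have "subspace Lambda14"
    by (simp add: Lambda14_eq linear_subspace_image linear_cross_tensor subspace_g2)
  then show ?thesis
    by (simp add: Lambda14_component_def ortho_proj_eq_0_iff Lambda14_eq orthogonal_def
        inner_cross_tensor tensor_contraction_cross_tensor tensor_contraction_image_iff)
qed

section \<open>Smooth functions\<close>

lemma Ck_on_subset: "Ck_on k f S \<Longrightarrow> T \<subseteq> S \<Longrightarrow> Ck_on k f T"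
  by (induction k arbitrary: f) (auto intro: continuous_on_subset)

lemma Ck_on_local:
  assumes "\<And>x. x \<in> S \<Longrightarrow> \<exists>T. open T \<and> x \<in> T \<and> Ck_on k f T"
  shows "Ck_on k f S"
  using assms
proof (induction k arbitrary: f)
  case 0
  have "isCont f x" if "x \<in> S" for x
    using 0[OF that] by (auto simp: continuous_on_eq_continuous_at)
  then show ?case by (simp add: continuous_at_imp_continuous_on)
next
  case (Suc k)
  then have "\<forall>x\<in>S. f differentiable at x" by fastforce
  moreover have "Ck_on k (\<lambda>x. frechet_derivative f (at x) v) S" for v
    by (rule Suc.IH) (use Suc.prems in fastforce)
  ultimately show ?case by simp
qed

lemma Ck_on_cong:
  assumes "open S" "\<And>x. x \<in> S \<Longrightarrow> f x = g x" "Ck_on k f S"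
  shows "Ck_on k g S"
  using assms(2,3)
proof (induction k arbitrary: f g)
  case 0
  then show ?case using continuous_on_cong by (metis Ck_on.simps(1))
next
  case (Suc k)
  have *: "g differentiable at x \<and> frechet_derivative g (at x) = frechet_derivative f (at x)"
    if "x \<in> S" for x
  proof -
    have "(f has_derivative frechet_derivative f (at x)) (at x)"
      using Suc.prems(2) that by (simp add: frechet_derivative_works)
    then have "(g has_derivative frechet_derivative f (at x)) (at x)"
      using has_derivative_transform_within_open[OF _ assms(1) that] Suc.prems(1) by blast
    then show ?thesis
      by (metis differentiable_def frechet_derivative_at)
  qed
  moreover have "Ck_on k (\<lambda>x. frechet_derivative g (at x) v) S" for v
    by (rule Suc.IH[of "\<lambda>x. frechet_derivative f (at x) v"]) (use Suc.prems * in auto)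
  ultimately show ?case by simp
qed

lemma Ck_on_Suc_imp: "Ck_on (Suc k) f S \<Longrightarrow> Ck_on k f S"
proof (induction k arbitrary: f)
  case 0
  then show ?case
    by (auto intro!: continuous_at_imp_continuous_on differentiable_imp_continuous_within)
next
  case (Suc k)
  then show ?case by (metis Ck_on.simps(2))
qed

lemma Ck_on_const: "Ck_on k (\<lambda>x. c) S"
proof (induction k arbitrary: c)
  case (Suc k)
  have "frechet_derivative (\<lambda>x::'a. c) (at x) = (\<lambda>v. 0)" for x
    by (rule frechet_derivative_at[symmetric]) (rule has_derivative_const)
  with Suc show ?case by simp
qed simp

lemma Ck_on_add:
  assumes "open S" "Ck_on k f S" "Ck_on k g S"
  shows "Ck_on k (\<lambda>x. f x + g x) S"
  using assms(2,3)
proof (induction k arbitrary: f g)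
  case 0
  then show ?case by (simp add: continuous_on_add)
next
  case (Suc k)
  have d: "f differentiable at x" "g differentiable at x" if "x \<in> S" for x
    using Suc.prems that by auto
  have "frechet_derivative (\<lambda>x. f x + g x) (at x)
      = (\<lambda>v. frechet_derivative f (at x) v + frechet_derivative g (at x) v)" if "x \<in> S" for x
    by (rule frechet_derivative_at[symmetric], rule has_derivative_add)
      (use d[OF that] frechet_derivative_works in blast)+
  moreover have "Ck_on k (\<lambda>x. frechet_derivative f (at x) v + frechet_derivative g (at x) v) S" for v
    by (rule Suc.IH) (use Suc.prems in simp_all)
  ultimately have "Ck_on k (\<lambda>x. frechet_derivative (\<lambda>x. f x + g x) (at x) v) S" for v
    using Ck_on_cong[OF assms(1), of "\<lambda>x. frechet_derivative f (at x) v + frechet_derivative g (at x) v"] by auto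
  with d show ?case by (simp add: differentiable_add)
qed

lemma Ck_on_mult:
  fixes f g :: "'a::real_normed_vector \<Rightarrow> real"
  assumes "open S" "Ck_on k f S" "Ck_on k g S"
  shows "Ck_on k (\<lambda>x. f x * g x) S"
  using assms(2,3)
proof (induction k arbitrary: f g)
  case 0
  then show ?case by (simp add: continuous_on_mult)
next
  case (Suc k)
  let ?d = "\<lambda>v x. f x * frechet_derivative g (at x) v + frechet_derivative f (at x) v * g x"
  have d: "f differentiable at x" "g differentiable at x" if "x \<in> S" for x
    using Suc.prems that by auto
  have "frechet_derivative (\<lambda>x. f x * g x) (at x) = (\<lambda>v. ?d v x)" if "x \<in> S" for x
    by (rule frechet_derivative_at[symmetric], rule has_derivative_mult)
      (use d[OF that] frechet_derivative_works in blast)+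
  moreover have "Ck_on k (?d v) S" for v
    using Suc.IH Suc.prems Ck_on_Suc_imp[OF Suc.prems(1)] Ck_on_Suc_imp[OF Suc.prems(2)]
    by (intro Ck_on_add[OF assms(1)]) auto
  ultimately have "Ck_on k (\<lambda>x. frechet_derivative (\<lambda>x. f x * g x) (at x) v) S" for v
    using Ck_on_cong[OF assms(1), of "?d v"] by auto
  with d show ?case by (simp add: differentiable_mult)
qed

section \<open>Smooth functions and germs on the manifold\<close>

locale charted =
  fixes A :: "('m::topological_space) chart set"
  assumes is_chart: "c \<in> A \<Longrightarrow> is_chart c"
begin

lemma chart_open_image:
  assumes "(U, \<phi>) \<in> A" "open V"
  shows "open (\<phi> ` (U \<inter> V))"
proof -
  have h: "open U" "open (\<phi> ` U)" "homeomorphism U (\<phi> ` U) \<phi> (inv_into U \<phi>)"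
    using is_chart[OF assms(1)] by (auto simp: is_chart_def)
  have "openin (top_of_set U) (U \<inter> V)" using assms(2) by (simp add: openin_open_Int)
  then have "openin (top_of_set (\<phi> ` U)) (\<phi> ` (U \<inter> V))"
    using homeomorphism_imp_open_map[OF h(3)] by blast
  then show ?thesis using h(2) openin_open_trans by blast
qed

lemma chart_inv:
  assumes "(U, \<phi>) \<in> A" "q \<in> U"
  shows "inv_into U \<phi> (\<phi> q) = q"
  using is_chart[OF assms(1)] assms(2) by (auto simp: is_chart_def homeomorphism_def)

lemma smooth_fun_open: "smooth_fun A V f \<Longrightarrow> open V"
  by (simp add: smooth_fun_def)

lemma smooth_fun_subset:
  "smooth_fun A V f \<Longrightarrow> open W \<Longrightarrow> W \<subseteq> V \<Longrightarrow> smooth_fun A W f"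
  unfolding smooth_fun_def smooth_on_def
  by (fast intro: Ck_on_subset)

lemma smooth_fun_cong:
  assumes "smooth_fun A V f" "\<And>q. q \<in> V \<Longrightarrow> f q = h q"
  shows "smooth_fun A V h"
  unfolding smooth_fun_def smooth_on_def
proof (safe)
  show "open V" using assms(1) by (rule smooth_fun_open)
  fix U \<phi> k assume U: "(U, \<phi>) \<in> A"
  show "Ck_on k (h \<circ> inv_into U \<phi>) (\<phi> ` (U \<inter> V))"
  proof (rule Ck_on_cong[OF chart_open_image[OF U]])
    show "open V" using assms(1) by (rule smooth_fun_open)
    show "(f \<circ> inv_into U \<phi>) x = (h \<circ> inv_into U \<phi>) x" if "x \<in> \<phi> ` (U \<inter> V)" for x
      using that assms(2) by (auto simp: chart_inv[OF U])
    show "Ck_on k (f \<circ> inv_into U \<phi>) (\<phi> ` (U \<inter> V))"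
      using assms(1) U by (auto simp: smooth_fun_def smooth_on_def)
  qed
qed

lemma smooth_fun_local:
  assumes "open V" "\<And>p. p \<in> V \<Longrightarrow> \<exists>W. p \<in> W \<and> smooth_fun A W f"
  shows "smooth_fun A V f"
  unfolding smooth_fun_def smooth_on_def
proof (safe)
  show "open V" by fact
  fix U \<phi> k assume U: "(U, \<phi>) \<in> A"
  show "Ck_on k (f \<circ> inv_into U \<phi>) (\<phi> ` (U \<inter> V))"
  proof (rule Ck_on_local)
    fix x assume "x \<in> \<phi> ` (U \<inter> V)"
    then obtain p where p: "p \<in> U" "p \<in> V" "x = \<phi> p" by blast
    then obtain W where "p \<in> W" "smooth_fun A W f" using assms(2) by blast
    then show "\<exists>T. open T \<and> x \<in> T \<and> Ck_on k (f \<circ> inv_into U \<phi>) T"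
      using p U chart_open_image[OF U]
      by (intro exI[of _ "\<phi> ` (U \<inter> W)"]) (auto simp: smooth_fun_def smooth_on_def)
  qed
qed

lemma smooth_fun_const: "open V \<Longrightarrow> smooth_fun A V (\<lambda>q. c)"
  by (auto simp: smooth_fun_def smooth_on_def o_def Ck_on_const)

lemma smooth_fun_add:
  "smooth_fun A V f \<Longrightarrow> smooth_fun A V h \<Longrightarrow> smooth_fun A V (\<lambda>q. f q + h q)"
  unfolding smooth_fun_def smooth_on_def o_def
  using Ck_on_add chart_open_image by fast

lemma smooth_fun_mult:
  "smooth_fun A V f \<Longrightarrow> smooth_fun A V h \<Longrightarrow> smooth_fun A V (\<lambda>q. f q * h q)"
  unfolding smooth_fun_def smooth_on_def o_def
  using Ck_on_mult chart_open_image by fast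

lemma smooth_fun_minus:
  "smooth_fun A V f \<Longrightarrow> smooth_fun A V h \<Longrightarrow> smooth_fun A V (\<lambda>q. f q - h q)"
  using smooth_fun_add[OF _ smooth_fun_mult[OF smooth_fun_const[of V "- 1"]]] smooth_fun_open
  by fastforce

lemma smooth_fun_sum:
  "open V \<Longrightarrow> (\<And>i. i \<in> I \<Longrightarrow> smooth_fun A V (f i)) \<Longrightarrow> smooth_fun A V (\<lambda>q. \<Sum>i\<in>I. f i q)"
  by (induction I rule: infinite_finite_induct) (auto intro: smooth_fun_const smooth_fun_add)

lemma smooth_near_add:
  "smooth_near A p f \<Longrightarrow> smooth_near A p h \<Longrightarrow> smooth_near A p (\<lambda>q. f q + h q)"
  unfolding smooth_near_def
  by (metis IntI Int_lower1 Int_lower2 open_Int smooth_fun_add smooth_fun_open smooth_fun_subset)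

lemma smooth_near_mult:
  "smooth_near A p f \<Longrightarrow> smooth_near A p h \<Longrightarrow> smooth_near A p (\<lambda>q. f q * h q)"
  unfolding smooth_near_def
  by (metis IntI Int_lower1 Int_lower2 open_Int smooth_fun_mult smooth_fun_open smooth_fun_subset)

lemma smooth_near_const: "smooth_near A p (\<lambda>q. c)"
  unfolding smooth_near_def using smooth_fun_const[of UNIV] by blast

lemma smooth_near_cong:
  assumes "smooth_near A p f" "\<forall>\<^sub>F q in nhds p. f q = h q"
  shows "smooth_near A p h"
proof -
  obtain V where V: "p \<in> V" "smooth_fun A V f" using assms(1) by (auto simp: smooth_near_def)
  obtain W where W: "open W" "p \<in> W" "\<forall>q\<in>W. f q = h q"
    using assms(2) by (auto simp: eventually_nhds)
  have "smooth_fun A (V \<inter> W) h"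
    using W V smooth_fun_open[OF V(2)]
    by (intro smooth_fun_cong[OF smooth_fun_subset[OF V(2)]]) auto
  then show ?thesis using V W by (auto simp: smooth_near_def)
qed

section \<open>Tangent vectors and vector fields\<close>

lemma smooth_near_eventually:
  "smooth_near A p f \<Longrightarrow> \<forall>\<^sub>F q in nhds p. smooth_near A q f"
  unfolding smooth_near_def eventually_nhds by (metis smooth_fun_open)

context
  fixes p v
  assumes v: "v \<in> tangent_space A p"
begin

lemma tangent_lincomb:
  "smooth_near A p f \<Longrightarrow> smooth_near A p h \<Longrightarrow> v (\<lambda>q. a * f q + b * h q) = a * v f + b * v h"
  using v by (auto simp: tangent_space_def)

lemma tangent_mult:
  "smooth_near A p f \<Longrightarrow> smooth_near A p h \<Longrightarrow> v (\<lambda>q. f q * h q) = f p * v h + h p * v f"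
  using v by (auto simp: tangent_space_def)

lemma tangent_cong:
  "smooth_near A p f \<Longrightarrow> \<forall>\<^sub>F q in nhds p. f q = h q \<Longrightarrow> v f = v h"
  using v by (auto simp: tangent_space_def)

lemma tangent_not_smooth: "\<not> smooth_near A p f \<Longrightarrow> v f = 0"
  using v by (auto simp: tangent_space_def)

lemma tangent_add:
  "smooth_near A p f \<Longrightarrow> smooth_near A p h \<Longrightarrow> v (\<lambda>q. f q + h q) = v f + v h"
  using tangent_lincomb[of f h 1 1] by simp

lemma tangent_const: "v (\<lambda>q. c) = 0"
proof -
  have "v (\<lambda>q. 1 * 1) = 1 * v (\<lambda>q. 1) + 1 * v (\<lambda>q. 1)"
    using tangent_mult[OF smooth_near_const smooth_near_const, of 1 1] .
  then have "v (\<lambda>q. 1) = 0" by simp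
  moreover have "v (\<lambda>q. c * 1 + 0 * 1) = c * v (\<lambda>q. 1) + 0 * v (\<lambda>q. 1)"
    by (rule tangent_lincomb[OF smooth_near_const smooth_near_const])
  ultimately show ?thesis by simp
qed

end

lemma tangent_space_lincomb:
  assumes "v \<in> tangent_space A p" "w \<in> tangent_space A p"
  shows "(\<lambda>f. a * v f + b * w f) \<in> tangent_space A p"
  unfolding tangent_space_def
proof (safe)
  fix f h c d assume fh: "smooth_near A p f" "smooth_near A p h"
  show "a * v (\<lambda>q. c * f q + d * h q) + b * w (\<lambda>q. c * f q + d * h q)
      = c * (a * v f + b * w f) + d * (a * v h + b * w h)"
    by (simp add: tangent_lincomb[OF assms(1) fh] tangent_lincomb[OF assms(2) fh] algebra_simps)
  show "a * v (\<lambda>q. f q * h q) + b * w (\<lambda>q. f q * h q)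
      = f p * (a * v h + b * w h) + h p * (a * v f + b * w f)"
    by (simp add: tangent_mult[OF assms(1) fh] tangent_mult[OF assms(2) fh] algebra_simps)
next
  fix f h assume "smooth_near A p f" "\<forall>\<^sub>F q in nhds p. f q = h q"
  then show "a * v f + b * w f = a * v h + b * w h"
    using tangent_cong assms by metis
next
  fix f assume "\<not> smooth_near A p f"
  then show "a * v f + b * w f = 0"
    by (simp add: tangent_not_smooth[OF assms(1)] tangent_not_smooth[OF assms(2)])
qed

lemma tangent_space_zero: "(\<lambda>f. 0) \<in> tangent_space A p"
  by (simp add: tangent_space_def)

lemma tangent_space_add:
  "v \<in> tangent_space A p \<Longrightarrow> w \<in> tangent_space A p \<Longrightarrow> (\<lambda>f. v f + w f) \<in> tangent_space A p"
  using tangent_space_lincomb[of v p w 1 1] by simp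

lemma tangent_space_minus:
  "v \<in> tangent_space A p \<Longrightarrow> w \<in> tangent_space A p \<Longrightarrow> (\<lambda>f. v f - w f) \<in> tangent_space A p"
  using tangent_space_lincomb[of v p w 1 "- 1"] by simp

lemma tangent_space_scale: "v \<in> tangent_space A p \<Longrightarrow> (\<lambda>f. c * v f) \<in> tangent_space A p"
  using tangent_space_lincomb[of v p v c 0] by simp

lemma tangent_space_sum:
  "(\<And>i. i \<in> I \<Longrightarrow> u i \<in> tangent_space A p) \<Longrightarrow> (\<lambda>f. \<Sum>i\<in>I. c i * u i f) \<in> tangent_space A p"
proof (induction I rule: infinite_finite_induct)
  case (insert i I)
  then show ?case
    using tangent_space_add[OF tangent_space_scale[of "u i" p "c i"], of "\<lambda>f. \<Sum>i\<in>I. c i * u i f"]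
    by simp
qed (auto intro: tangent_space_zero)

section \<open>Local vector fields\<close>

lemma vector_field_smooth:
  "vector_field A U X \<Longrightarrow> smooth_fun A V f \<Longrightarrow> V \<subseteq> U \<Longrightarrow> smooth_fun A V (\<lambda>q. X q f)"
  by (auto simp: vector_field_def)

lemma vector_field_tangent: "vector_field A U X \<Longrightarrow> p \<in> U \<Longrightarrow> X p \<in> tangent_space A p"
  by (auto simp: vector_field_def)

lemma vector_field_open: "vector_field A U X \<Longrightarrow> open U"
  by (auto simp: vector_field_def)

lemma vector_field_subset:
  "vector_field A U X \<Longrightarrow> open W \<Longrightarrow> W \<subseteq> U \<Longrightarrow> vector_field A W X"
  by (auto simp: vector_field_def)

lemma vector_field_nearI: "vector_field A U X \<Longrightarrow> p \<in> U \<Longrightarrow> vector_field_near A p X"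
  by (auto simp: vector_field_near_def)

lemma near_tangent: "vector_field_near A p X \<Longrightarrow> X p \<in> tangent_space A p"
  by (auto simp: vector_field_near_def vector_field_tangent)

lemma near_eventually:
  "vector_field_near A p X \<Longrightarrow> \<forall>\<^sub>F q in nhds p. vector_field_near A q X"
  unfolding vector_field_near_def eventually_nhds by (metis vector_field_open)

lemma near_common:
  assumes "vector_field_near A p X" "vector_field_near A p Y"
  obtains U where "p \<in> U" "vector_field A U X" "vector_field A U Y"
proof -
  obtain U V where "p \<in> U" "vector_field A U X" "p \<in> V" "vector_field A V Y"
    using assms by (auto simp: vector_field_near_def)
  then show thesis
    using that[of "U \<inter> V"] vector_field_subset[of U X "U \<inter> V"] vector_field_subset[of V Y "U \<inter> V"]
    by (simp add: vector_field_open open_Int)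
qed

lemma near_smooth:
  assumes "vector_field_near A p X" "smooth_near A p f"
  shows "smooth_near A p (\<lambda>q. X q f)"
proof -
  obtain U V where *: "p \<in> U" "vector_field A U X" "p \<in> V" "smooth_fun A V f"
    using assms by (auto simp: vector_field_near_def smooth_near_def)
  have o: "open (U \<inter> V)" using * vector_field_open smooth_fun_open by blast
  have "smooth_fun A (U \<inter> V) (\<lambda>q. X q f)"
    using vector_field_smooth[OF *(2) smooth_fun_subset[OF *(4) o]] by simp
  then show ?thesis using * by (auto simp: smooth_near_def)
qed

lemma vector_field_add:
  "vector_field A U X \<Longrightarrow> vector_field A U Y \<Longrightarrow> vector_field A U (\<lambda>q f. X q f + Y q f)"
  by (auto simp: vector_field_def intro: tangent_space_add smooth_fun_add)

lemma vector_field_mult: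
  assumes "smooth_fun A U h" "vector_field A U X"
  shows "vector_field A U (\<lambda>q f. h q * X q f)"
  using assms smooth_fun_subset[OF assms(1)]
  by (auto simp: vector_field_def intro!: tangent_space_scale smooth_fun_mult)
    (metis smooth_fun_open)

lemma vector_field_sum:
  assumes "open U" "\<And>i. i \<in> I \<Longrightarrow> smooth_fun A U (h i)" "\<And>i. i \<in> I \<Longrightarrow> vector_field A U (X i)"
  shows "vector_field A U (\<lambda>q f. \<Sum>i\<in>I. h i q * X i q f)"
  using assms(2,3)
proof (induction I rule: infinite_finite_induct)
  case (insert i I)
  then show ?case by (simp add: vector_field_add vector_field_mult)
qed (auto simp: vector_field_def assms(1) tangent_space_zero intro: smooth_fun_const smooth_fun_open)

lemma vector_field_cong:
  assumes "vector_field A U X" "\<And>p. p \<in> U \<Longrightarrow> X p = Y p"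
  shows "vector_field A U Y"
  unfolding vector_field_def
proof (intro conjI ballI allI impI)
  show "open U" using assms(1) by (rule vector_field_open)
  show "Y p \<in> tangent_space A p" if "p \<in> U" for p
    using vector_field_tangent[OF assms(1) that] assms(2)[OF that] by simp
  fix V f assume *: "V \<subseteq> U \<and> smooth_fun A V f"
  show "smooth_fun A V (\<lambda>p. Y p f)"
    by (rule smooth_fun_cong[OF vector_field_smooth[OF assms(1)]]) (use * assms(2) in auto)
qed

lemma vector_field_local:
  assumes "open U" "\<And>p. p \<in> U \<Longrightarrow> \<exists>W. p \<in> W \<and> vector_field A W X"
  shows "vector_field A U X"
  unfolding vector_field_def
proof (intro conjI ballI allI impI)
  show "open U" by fact
  show "X p \<in> tangent_space A p" if "p \<in> U" for p
    using assms(2)[OF that] vector_field_tangent by blast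
  fix V f assume *: "V \<subseteq> U \<and> smooth_fun A V f"
  show "smooth_fun A V (\<lambda>p. X p f)"
  proof (rule smooth_fun_local)
    show "open V" using * smooth_fun_open by blast
    fix p assume "p \<in> V"
    then obtain W where W: "p \<in> W" "vector_field A W X" using assms(2) * by blast
    have "open (V \<inter> W)" using * W smooth_fun_open vector_field_open by blast
    then have "smooth_fun A (V \<inter> W) (\<lambda>p. X p f)"
      using vector_field_smooth[OF W(2), of "V \<inter> W" f] smooth_fun_subset[of V f "V \<inter> W"] * by simp
    then show "\<exists>W. p \<in> W \<and> smooth_fun A W (\<lambda>p. X p f)" using \<open>p \<in> V\<close> W by blast
  qed
qed

lemma near_add:
  assumes "vector_field_near A p X" "vector_field_near A p Y"
  shows "vector_field_near A p (\<lambda>q f. X q f + Y q f)"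
  using near_common[OF assms] by (metis vector_field_add vector_field_nearI)

lemma near_mult:
  assumes "smooth_near A p h" "vector_field_near A p X"
  shows "vector_field_near A p (\<lambda>q f. h q * X q f)"
proof -
  obtain U V where *: "p \<in> U" "vector_field A U X" "p \<in> V" "smooth_fun A V h"
    using assms by (auto simp: vector_field_near_def smooth_near_def)
  then have "open (U \<inter> V)" using vector_field_open smooth_fun_open by blast
  then have "vector_field A (U \<inter> V) (\<lambda>q f. h q * X q f)"
    using * by (intro vector_field_mult) (auto intro: smooth_fun_subset vector_field_subset)
  then show ?thesis using * by (auto simp: vector_field_near_def)
qed

lemma near_cong:
  assumes "vector_field_near A p X" "\<forall>\<^sub>F q in nhds p. X q = Y q"
  shows "vector_field_near A p Y"
proof -
  obtain V where V: "p \<in> V" "vector_field A V X" using assms(1) by (auto simp: vector_field_near_def)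
  obtain W where W: "open W" "p \<in> W" "\<forall>q\<in>W. X q = Y q"
    using assms(2) by (auto simp: eventually_nhds)
  have "vector_field A (V \<inter> W) Y"
    using W V vector_field_open[OF V(2)]
    by (intro vector_field_cong[OF vector_field_subset[OF V(2)]]) auto
  then show ?thesis using V W by (auto simp: vector_field_near_def)
qed

section \<open>The Lie bracket\<close>

lemma lie_bracket_tangent:
  assumes X: "vector_field_near A p X" and Y: "vector_field_near A p Y"
  shows "lie_bracket A X Y p \<in> tangent_space A p"
  unfolding tangent_space_def mem_Collect_eq
proof (intro conjI allI impI; (elim conjE)?)
  note t = near_tangent[OF X] near_tangent[OF Y]
  have ev: "\<forall>\<^sub>F q in nhds p. X q \<in> tangent_space A q \<and> Y q \<in> tangent_space A q"
    using near_eventually[OF X] near_eventually[OF Y]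
    by eventually_elim (simp add: near_tangent)
  fix f h :: "'m \<Rightarrow> real" assume f: "smooth_near A p f" and h: "smooth_near A p h"
  note fh = near_smooth[OF X f] near_smooth[OF X h] near_smooth[OF Y f] near_smooth[OF Y h] f h
  have sev: "\<forall>\<^sub>F q in nhds p. smooth_near A q f \<and> smooth_near A q h"
    using smooth_near_eventually[OF f] smooth_near_eventually[OF h] by eventually_elim simp
  show "lie_bracket A X Y p (\<lambda>q. f q * h q)
      = f p * lie_bracket A X Y p h + h p * lie_bracket A X Y p f"
  proof -
    \<comment> \<open>The two mixed products of first derivatives form an expression symmetric in Z
      and W, so they cancel in the bracket. The product rule for \<open>W q\<close> is available
      only for q near p, where f and h are smooth; \<open>tangent_cong\<close> lets
      \<open>Z p\<close> act on this local identity.\<close>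
    have 1: "Z p (\<lambda>q. W q (\<lambda>q. f q * h q)) = f p * Z p (\<lambda>q. W q h) + W p h * Z p f
        + h p * Z p (\<lambda>q. W q f) + W p f * Z p h"
      if Z: "vector_field_near A p Z" and W: "vector_field_near A p W" for Z W
    proof -
      note fh = near_smooth[OF W f] near_smooth[OF W h] f h near_tangent[OF Z]
      have "\<forall>\<^sub>F q in nhds p. f q * W q h + h q * W q f = W q (\<lambda>q. f q * h q)"
        using near_eventually[OF W] sev
        by eventually_elim (simp add: tangent_mult[OF near_tangent])
      then have "Z p (\<lambda>q. f q * W q h + h q * W q f) = Z p (\<lambda>q. W q (\<lambda>q. f q * h q))"
        by (intro tangent_cong[of "Z p" p]) (auto intro!: fh smooth_near_add smooth_near_mult)
      then show ?thesis
        by (simp add: tangent_add[of "Z p" p] tangent_mult[of "Z p" p] fh smooth_near_mult)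
    qed
    show ?thesis
      by (simp add: lie_bracket_def 1[OF X Y] 1[OF Y X] f h smooth_near_mult algebra_simps)
  qed
  fix a b
  show "lie_bracket A X Y p (\<lambda>q. a * f q + b * h q)
      = a * lie_bracket A X Y p f + b * lie_bracket A X Y p h"
  proof -
    have 1: "Z p (\<lambda>q. W q (\<lambda>q. a * f q + b * h q)) = a * Z p (\<lambda>q. W q f) + b * Z p (\<lambda>q. W q h)"
      if Z: "vector_field_near A p Z" and W: "vector_field_near A p W" for Z W
    proof -
      note fh = near_smooth[OF W f] near_smooth[OF W h] f h near_tangent[OF Z]
      have "\<forall>\<^sub>F q in nhds p. a * W q f + b * W q h = W q (\<lambda>q. a * f q + b * h q)"
        using near_eventually[OF W] sev
        by eventually_elim (simp add: tangent_lincomb[OF near_tangent])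
      then have "Z p (\<lambda>q. a * W q f + b * W q h) = Z p (\<lambda>q. W q (\<lambda>q. a * f q + b * h q))"
        by (intro tangent_cong[of "Z p" p])
          (auto intro!: fh smooth_near_add smooth_near_mult smooth_near_const)
      then show ?thesis
        by (simp add: tangent_lincomb[of "Z p" p] fh)
    qed
    show ?thesis
      by (simp add: lie_bracket_def 1[OF X Y] 1[OF Y X] f h smooth_near_mult smooth_near_add
          smooth_near_const algebra_simps)
  qed
next
  fix f h :: "'m \<Rightarrow> real" assume f: "smooth_near A p f" and fh: "\<forall>\<^sub>F q in nhds p. f q = h q"
  \<comment> \<open>Agreement of f and h near p is also agreement near every q close to p, so W
    takes the same values on both throughout a neighbourhood of p.\<close>
  have 1: "Z p (\<lambda>q. W q f) = Z p (\<lambda>q. W q h)"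
    if Z: "vector_field_near A p Z" and W: "vector_field_near A p W" for Z W
  proof (rule tangent_cong[OF near_tangent[OF Z] near_smooth[OF W f]])
    have "\<forall>\<^sub>F q in nhds p. \<forall>\<^sub>F r in nhds q. f r = h r" using fh by (simp add: eventually_eventually)
    then show "\<forall>\<^sub>F q in nhds p. W q f = W q h"
      using near_eventually[OF W] smooth_near_eventually[OF f]
      by eventually_elim (auto intro: tangent_cong[OF near_tangent])
  qed
  show "lie_bracket A X Y p f = lie_bracket A X Y p h"
    using f smooth_near_cong[OF f fh] by (simp add: lie_bracket_def 1[OF X Y] 1[OF Y X])
qed (simp add: lie_bracket_def)

lemma vector_field_lie_bracket:
  assumes X: "vector_field A U X" and Y: "vector_field A U Y"
  shows "vector_field A U (lie_bracket A X Y)"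
  unfolding vector_field_def
proof (intro conjI ballI allI impI)
  show "open U" using X by (rule vector_field_open)
  show "lie_bracket A X Y p \<in> tangent_space A p" if "p \<in> U" for p
    using that X Y by (intro lie_bracket_tangent) (auto intro: vector_field_nearI)
  fix V f assume V: "V \<subseteq> U \<and> smooth_fun A V f"
  have "smooth_fun A V (\<lambda>p. X p (\<lambda>q. Y q f) - Y p (\<lambda>q. X q f))"
    using V X Y by (intro smooth_fun_minus vector_field_smooth[OF X] vector_field_smooth[OF Y]) auto
  then show "smooth_fun A V (\<lambda>p. lie_bracket A X Y p f)"
    by (rule smooth_fun_cong) (use V in \<open>auto simp: lie_bracket_def smooth_near_def\<close>)
qed

lemma lie_bracket_skew: "lie_bracket A Y X p = (\<lambda>f. - lie_bracket A X Y p f)"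
  by (auto simp: lie_bracket_def fun_eq_iff)

lemma lie_bracket_add:
  assumes "vector_field_near A p X" "vector_field_near A p Y" "vector_field_near A p Z"
  shows "lie_bracket A Z (\<lambda>q f. X q f + Y q f) p
    = (\<lambda>f. lie_bracket A Z X p f + lie_bracket A Z Y p f)"
  by (rule ext) (simp add: lie_bracket_def tangent_add[OF near_tangent[OF assms(3)]] near_smooth assms)

lemma lie_bracket_mult:
  assumes "vector_field_near A p X" "vector_field_near A p Z" "smooth_near A p h"
  shows "lie_bracket A Z (\<lambda>q f. h q * X q f) p = (\<lambda>f. h p * lie_bracket A Z X p f + Z p h * X p f)"
proof
  fix f
  \<comment> \<open>For f not smooth near p the bracket is zero by convention, and the identity
    survives because \<open>X p f\<close> is zero there too.\<close>
  show "lie_bracket A Z (\<lambda>q f. h q * X q f) p f = h p * lie_bracket A Z X p f + Z p h * X p f"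
    using tangent_not_smooth[OF near_tangent[OF assms(1)], of f]
    by (simp add: lie_bracket_def tangent_mult[OF near_tangent[OF assms(2)]] near_smooth assms algebra_simps)
qed

lemma lie_bracket_cong:
  assumes "vector_field_near A p X" "vector_field_near A p Z" "\<forall>\<^sub>F q in nhds p. X q = Y q"
  shows "lie_bracket A Z X p = lie_bracket A Z Y p"
proof
  fix f
  have "Z p (\<lambda>q. X q f) = Z p (\<lambda>q. Y q f)" if "smooth_near A p f"
    by (rule tangent_cong[OF near_tangent[OF assms(2)] near_smooth[OF assms(1) that]])
      (use assms(3) in \<open>eventually_elim, simp\<close>)
  moreover have "X p = Y p" using assms(3) eventually_nhds_x_imp_x by fast
  ultimately show "lie_bracket A Z X p f = lie_bracket A Z Y p f" by (simp add: lie_bracket_def)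
qed

end

section \<open>Tensoriality\<close>

context charted
begin

lemma near_zero: "vector_field_near A p (\<lambda>q f. 0)"
  unfolding vector_field_near_def vector_field_def
  by (intro exI[of _ UNIV]) (auto intro: tangent_space_zero smooth_fun_const smooth_fun_open)

lemma near_sum:
  "(\<And>i. i \<in> I \<Longrightarrow> smooth_near A p (h i)) \<Longrightarrow> (\<And>i. i \<in> I \<Longrightarrow> vector_field_near A p (X i))
    \<Longrightarrow> vector_field_near A p (\<lambda>q f. \<Sum>i\<in>I. h i q * X i q f)"
proof (induction I rule: infinite_finite_induct)
  case (insert i I)
  then show ?case
    using near_add[OF near_mult[of p "h i" "X i"], of "\<lambda>q f. \<Sum>i\<in>I. h i q * X i q f"] by simp
qed (auto intro: near_zero)

lemma tangent_linearD:
  "tangent_linear A p L \<Longrightarrow> v \<in> tangent_space A p \<Longrightarrow> w \<in> tangent_space A p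
    \<Longrightarrow> L (\<lambda>f. a * v f + b * w f) = a * L v + b * L w"
  by (simp add: tangent_linear_def)

lemma tangent_linear_sum:
  assumes "tangent_linear A p L" "finite I" "\<And>i. i \<in> I \<Longrightarrow> u i \<in> tangent_space A p"
  shows "L (\<lambda>f. \<Sum>i\<in>I. c i * u i f) = (\<Sum>i\<in>I. c i * L (u i))"
  using assms(2,3)
proof (induction I)
  case empty
  show ?case
    using tangent_linearD[OF assms(1) tangent_space_zero tangent_space_zero, of 0 0] by simp
next
  case (insert i I)
  then show ?case
    using tangent_linearD[OF assms(1), of "u i" "\<lambda>f. \<Sum>i\<in>I. c i * u i f" "c i" 1]
      tangent_space_sum[of I u p c] by simp
qed

lemma tangent_linear_add:
  "tangent_linear A p L \<Longrightarrow> v \<in> tangent_space A p \<Longrightarrow> w \<in> tangent_space A p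
    \<Longrightarrow> L (\<lambda>f. v f + w f) = L v + L w"
  using tangent_linearD[of p L v w 1 1] by simp

lemma tangent_linear_mult:
  "tangent_linear A p L \<Longrightarrow> v \<in> tangent_space A p \<Longrightarrow> L (\<lambda>f. c * v f) = c * L v"
  using tangent_linearD[of p L v v c 0] by simp

text \<open>Linearity over the germs of smooth functions at p. With a local frame it forces
  dependence on the value \<open>X p\<close> alone, see \<open>tensorial_pointwise\<close>. Fields
  are only defined near p, so dependence on the germ is part of the notion.\<close>

definition tensorial :: "'m \<Rightarrow> (('m \<Rightarrow> 'm tvec) \<Rightarrow> real) \<Rightarrow> bool" where
  "tensorial p Q \<longleftrightarrow>
     (\<forall>X Y. vector_field_near A p X \<and> vector_field_near A p Y \<longrightarrow>
        Q (\<lambda>q f. X q f + Y q f) = Q X + Q Y) \<and>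
     (\<forall>h X. smooth_near A p h \<and> vector_field_near A p X \<longrightarrow> Q (\<lambda>q f. h q * X q f) = h p * Q X) \<and>
     (\<forall>X Y. vector_field_near A p X \<and> (\<forall>\<^sub>F q in nhds p. X q = Y q) \<longrightarrow> Q X = Q Y)"

lemma tensorial_sum:
  assumes Q: "tensorial p Q" and "finite I" "\<And>i. i \<in> I \<Longrightarrow> smooth_near A p (h i)"
    "\<And>i. i \<in> I \<Longrightarrow> vector_field_near A p (X i)"
  shows "Q (\<lambda>q f. \<Sum>i\<in>I. h i q * X i q f) = (\<Sum>i\<in>I. h i p * Q (X i))"
  using assms(2-)
proof (induction I)
  case empty
  have "Q (\<lambda>q f. 0 * 0) = 0 * Q (\<lambda>q f. 0)"
    using Q near_zero[of p] smooth_near_const[of p 0] unfolding tensorial_def by blast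
  then show ?case by simp
next
  case (insert i I)
  have "Q (\<lambda>q f. h i q * X i q f + (\<Sum>i\<in>I. h i q * X i q f))
      = Q (\<lambda>q f. h i q * X i q f) + Q (\<lambda>q f. \<Sum>i\<in>I. h i q * X i q f)"
    using Q near_mult[of p "h i" "X i"] near_sum[of I p h X] insert.prems
    unfolding tensorial_def by blast
  also have "Q (\<lambda>q f. h i q * X i q f) = h i p * Q (X i)"
    using Q insert.prems unfolding tensorial_def by blast
  finally show ?case using insert by simp
qed

lemma tensorial_cong:
  "tensorial p Q \<Longrightarrow> vector_field_near A p X \<Longrightarrow> \<forall>\<^sub>F q in nhds p. X q = Y q \<Longrightarrow> Q X = Q Y"
  unfolding tensorial_def by blast

lemma tensorial_add:
  "tensorial p Q \<Longrightarrow> tensorial p R \<Longrightarrow> tensorial p (\<lambda>X. Q X + R X)"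
  unfolding tensorial_def by (simp add: distrib_left) metis

lemma tensorial_minus:
  "tensorial p Q \<Longrightarrow> tensorial p R \<Longrightarrow> tensorial p (\<lambda>X. Q X - R X)"
  unfolding tensorial_def by (simp add: right_diff_distrib) metis

lemma tensorial_linear:
  assumes "tangent_linear A p L"
  shows "tensorial p (\<lambda>X. L (X p))"
  unfolding tensorial_def
proof (intro conjI allI impI; elim conjE)
  show "L (\<lambda>f. X p f + Y p f) = L (X p) + L (Y p)"
    if "vector_field_near A p X" "vector_field_near A p Y" for X Y
    using that assms by (intro tangent_linear_add) (auto intro: near_tangent)
  show "L (\<lambda>f. h p * X p f) = h p * L (X p)" if "vector_field_near A p X" for h X
    using that assms by (intro tangent_linear_mult) (auto intro: near_tangent)
  show "L (X p) = L (Y p)" if "\<forall>\<^sub>F q in nhds p. X q = Y q" for X Y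
    using eventually_nhds_x_imp_x[OF that] by simp
qed

text \<open>The germ at p of a smooth 1-form. Filling all but one slot of the metric or of the
  3-form with vector fields produces such germs.\<close>

definition covector_near :: "'m \<Rightarrow> ('m \<Rightarrow> 'm tvec \<Rightarrow> real) \<Rightarrow> bool" where
  "covector_near p L \<longleftrightarrow> (\<forall>\<^sub>F q in nhds p. tangent_linear A q (L q)) \<and>
     (\<forall>X. vector_field_near A p X \<longrightarrow> smooth_near A p (\<lambda>q. L q (X q)))"

lemma covector_deriv_add:
  assumes L: "covector_near p L" and v: "v \<in> tangent_space A p"
    and X: "vector_field_near A p X" and Y: "vector_field_near A p Y"
  shows "v (\<lambda>q. L q (\<lambda>f. X q f + Y q f)) = v (\<lambda>q. L q (X q)) + v (\<lambda>q. L q (Y q))"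
proof -
  have s: "smooth_near A p (\<lambda>q. L q (X q))" "smooth_near A p (\<lambda>q. L q (Y q))"
    using L X Y by (auto simp: covector_near_def)
  have "\<forall>\<^sub>F q in nhds p. tangent_linear A q (L q)" using L by (simp add: covector_near_def)
  then have "\<forall>\<^sub>F q in nhds p. L q (X q) + L q (Y q) = L q (\<lambda>f. X q f + Y q f)"
    using near_eventually[OF X] near_eventually[OF Y]
    by eventually_elim (simp add: tangent_linear_add near_tangent)
  then have "v (\<lambda>q. L q (X q) + L q (Y q)) = v (\<lambda>q. L q (\<lambda>f. X q f + Y q f))"
    by (intro tangent_cong[OF v] smooth_near_add s)
  then show ?thesis by (simp add: tangent_add[OF v s])
qed

lemma covector_deriv_mult:
  assumes L: "covector_near p L" and v: "v \<in> tangent_space A p"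
    and X: "vector_field_near A p X" and h: "smooth_near A p h"
  shows "v (\<lambda>q. L q (\<lambda>f. h q * X q f)) = h p * v (\<lambda>q. L q (X q)) + v h * L p (X p)"
proof -
  have s: "smooth_near A p (\<lambda>q. L q (X q))"
    using L X by (auto simp: covector_near_def)
  have "\<forall>\<^sub>F q in nhds p. tangent_linear A q (L q)" using L by (simp add: covector_near_def)
  then have "\<forall>\<^sub>F q in nhds p. h q * L q (X q) = L q (\<lambda>f. h q * X q f)"
    using near_eventually[OF X]
    by eventually_elim (simp add: tangent_linear_mult near_tangent)
  then have "v (\<lambda>q. h q * L q (X q)) = v (\<lambda>q. L q (\<lambda>f. h q * X q f))"
    by (intro tangent_cong[OF v] smooth_near_mult s h)
  then show ?thesis by (simp add: tangent_mult[OF v h s] mult.commute)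
qed

lemma covector_deriv_cong:
  assumes L: "covector_near p L" and v: "v \<in> tangent_space A p"
    and X: "vector_field_near A p X" and Y: "\<forall>\<^sub>F q in nhds p. X q = Y q"
  shows "v (\<lambda>q. L q (X q)) = v (\<lambda>q. L q (Y q))"
proof (rule tangent_cong[OF v])
  show "smooth_near A p (\<lambda>q. L q (X q))" using L X by (auto simp: covector_near_def)
  show "\<forall>\<^sub>F q in nhds p. L q (X q) = L q (Y q)" using Y by eventually_elim simp
qed

text \<open>
  Pointwise, so that it applies to a connection before its smoothness is known.
\<close>

definition derivation_along :: "'m \<Rightarrow> 'm tvec \<Rightarrow> (('m \<Rightarrow> 'm tvec) \<Rightarrow> 'm tvec) \<Rightarrow> bool" where
  "derivation_along p v D \<longleftrightarrow>
     (\<forall>Y. vector_field_near A p Y \<longrightarrow> D Y \<in> tangent_space A p) \<and>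
     (\<forall>Y Z. vector_field_near A p Y \<and> vector_field_near A p Z \<longrightarrow>
        D (\<lambda>q f. Y q f + Z q f) = (\<lambda>f. D Y f + D Z f)) \<and>
     (\<forall>h Y. smooth_near A p h \<and> vector_field_near A p Y \<longrightarrow>
        D (\<lambda>q f. h q * Y q f) = (\<lambda>f. v h * Y p f + h p * D Y f)) \<and>
     (\<forall>Y Z. vector_field_near A p Y \<and> (\<forall>\<^sub>F q in nhds p. Y q = Z q) \<longrightarrow> D Y = D Z)"

lemma affine_connection_derivation:
  assumes "affine_connection A D" and v: "v \<in> tangent_space A p"
  shows "derivation_along p v (D p v)"
proof -
  note D = assms(1)[unfolded affine_connection_def]
  note D1 = D[THEN conjunct1]
    and D2 = D[THEN conjunct2, THEN conjunct1]
    and D3 = D[THEN conjunct2, THEN conjunct2, THEN conjunct1]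
    and D4 = D[THEN conjunct2, THEN conjunct2, THEN conjunct2, THEN conjunct1]
  show ?thesis
    unfolding derivation_along_def
  proof (intro conjI allI impI)
    fix Y Z h
    show "D p v Y \<in> tangent_space A p" if "vector_field_near A p Y"
      using D1[rule_format, OF that] v by blast
    show "D p v (\<lambda>q f. Y q f + Z q f) = (\<lambda>f. D p v Y f + D p v Z f)"
      if "vector_field_near A p Y \<and> vector_field_near A p Z"
      using D2 that v by blast
    show "D p v (\<lambda>q f. h q * Y q f) = (\<lambda>f. v h * Y p f + h p * D p v Y f)"
      if "smooth_near A p h \<and> vector_field_near A p Y"
      using D3 that v by blast
    show "D p v Y = D p v Z" if "vector_field_near A p Y \<and> (\<forall>\<^sub>F q in nhds p. Y q = Z q)"
      using D4 that v by blast
  qed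
qed

text \<open>Both terms produce the same Leibniz contribution \<open>v h * L p (X p)\<close>, which
  cancels in the difference. This is the reason why covariant derivatives of the metric and of the
  3-form can be tested on a frame.\<close>

lemma tensorial_defect:
  assumes D: "derivation_along p v D" and v: "v \<in> tangent_space A p" and L: "covector_near p L"
  shows "tensorial p (\<lambda>X. v (\<lambda>q. L q (X q)) - L p (D X))"
  unfolding tensorial_def
proof (intro conjI allI impI; elim conjE)
  have lin: "tangent_linear A p (L p)"
    using L eventually_nhds_x_imp_x by (auto simp: covector_near_def)
  have DT: "D Y \<in> tangent_space A p" if "vector_field_near A p Y" for Y
    using that D by (auto simp: derivation_along_def)
  fix X assume X: "vector_field_near A p X"
  show "v (\<lambda>q. L q (\<lambda>f. X q f + Y q f)) - L p (D (\<lambda>q f. X q f + Y q f))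
      = v (\<lambda>q. L q (X q)) - L p (D X) + (v (\<lambda>q. L q (Y q)) - L p (D Y))"
    if Y: "vector_field_near A p Y" for Y
  proof -
    have "D (\<lambda>q f. X q f + Y q f) = (\<lambda>f. D X f + D Y f)"
      using D X Y unfolding derivation_along_def by blast
    then show ?thesis
      by (simp add: covector_deriv_add[OF L v X Y] tangent_linear_add[OF lin] DT X Y)
  qed
  show "v (\<lambda>q. L q (\<lambda>f. h q * X q f)) - L p (D (\<lambda>q f. h q * X q f))
      = h p * (v (\<lambda>q. L q (X q)) - L p (D X))"
    if h: "smooth_near A p h" for h
  proof -
    have "D (\<lambda>q f. h q * X q f) = (\<lambda>f. v h * X p f + h p * D X f)"
      using D X h unfolding derivation_along_def by blast
    moreover have "L p (\<lambda>f. v h * X p f + h p * D X f) = v h * L p (X p) + h p * L p (D X)"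
      by (rule tangent_linearD[OF lin near_tangent[OF X] DT[OF X]])
    ultimately show ?thesis
      by (simp add: covector_deriv_mult[OF L v X h] algebra_simps)
  qed
  show "v (\<lambda>q. L q (X q)) - L p (D X) = v (\<lambda>q. L q (Y q)) - L p (D Y)"
    if Y: "\<forall>\<^sub>F q in nhds p. X q = Y q" for Y
  proof -
    have "D X = D Y" using D X Y unfolding derivation_along_def by blast
    then show ?thesis using covector_deriv_cong[OF L v X Y] by simp
  qed
qed

text \<open>The pointwise half of \<open>three_form\<close>. It is separated because the candidate
  for the torsion is shown to be alternating, and used, before it is known to be smooth.\<close>

definition alternating_at :: "'m \<Rightarrow> ('m tvec \<Rightarrow> 'm tvec \<Rightarrow> 'm tvec \<Rightarrow> real) \<Rightarrow> bool" where
  "alternating_at p t \<longleftrightarrow> (\<forall>u \<in> tangent_space A p. \<forall>v \<in> tangent_space A p.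
     tangent_linear A p (t u v) \<and>
     (\<forall>w \<in> tangent_space A p. t u v w = - t v u w \<and> t u v w = - t u w v))"

lemma alternating_skew:
  assumes "alternating_at p t" "u \<in> tangent_space A p" "v \<in> tangent_space A p" "w \<in> tangent_space A p"
  shows "t u v w = - t v u w" "t u v w = - t u w v"
  using assms unfolding alternating_at_def by blast+

lemma three_form_iff:
  "three_form A \<tau> \<longleftrightarrow> (\<forall>p. alternating_at p (\<tau> p)) \<and>
     (\<forall>U X Y Z. vector_field A U X \<and> vector_field A U Y \<and> vector_field A U Z \<longrightarrow>
        smooth_fun A U (\<lambda>p. \<tau> p (X p) (Y p) (Z p)))"
  by (simp add: three_form_def alternating_at_def)

lemma alternating_linear:
  assumes t: "alternating_at p t" and uv: "u \<in> tangent_space A p" "v \<in> tangent_space A p"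
  shows "tangent_linear A p (t u v)" "tangent_linear A p (\<lambda>w. t u w v)" "tangent_linear A p (\<lambda>w. t w u v)"
proof -
  have 1: "tangent_linear A p (t u v)"
    if "u \<in> tangent_space A p" "v \<in> tangent_space A p" for u v
    using that t unfolding alternating_at_def by blast
  note T = tangent_space_lincomb
  have a: "t x y z = - t y x z" "t x y z = - t x z y"
    if "x \<in> tangent_space A p" "y \<in> tangent_space A p" "z \<in> tangent_space A p" for x y z
    using that t unfolding alternating_at_def by blast+
  show "tangent_linear A p (t u v)" using uv by (rule 1)
  have cyc: "t u w v = - t u v w" "t w u v = t u v w" if "w \<in> tangent_space A p" for w
    using a(2)[OF uv that] a(1)[OF that uv] by linarith+
  show "tangent_linear A p (\<lambda>w. t u w v)" "tangent_linear A p (\<lambda>w. t w u v)"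
    using 1[OF uv] unfolding tangent_linear_def by (simp_all add: cyc T del: minus_add_distrib)
qed

end

section \<open>Metric connections with prescribed skew torsion\<close>

definition orthonormal_section ::
    "('m::topological_space) chart set \<Rightarrow> ('m \<Rightarrow> 'm tvec \<Rightarrow> 'm tvec \<Rightarrow> real) \<Rightarrow>
     'm set \<Rightarrow> ('m \<Rightarrow> 7 \<Rightarrow> 'm tvec) \<Rightarrow> bool" where
  "orthonormal_section A g U e \<longleftrightarrow> (\<forall>i. vector_field A U (\<lambda>p. e p i)) \<and>
     (\<forall>p\<in>U. tangent_basis A p (e p) \<and> (\<forall>i j. g p (e p i) (e p j) = (if i = j then 1 else 0)))"

text \<open>The local orthonormal frames required here are supplied later by the adapted sections of
  the G2-structure.\<close>

locale riemannian = charted A for A :: "('m::topological_space) chart set" +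
  fixes g :: "'m \<Rightarrow> 'm tvec \<Rightarrow> 'm tvec \<Rightarrow> real"
  assumes metric: "riemannian_metric A g"
    and frames: "\<And>p. \<exists>U e. p \<in> U \<and> orthonormal_section A g U e"
begin

abbreviation "T \<equiv> tangent_space A"
abbreviation "near \<equiv> vector_field_near A"

lemma g_linear: "v \<in> T p \<Longrightarrow> tangent_linear A p (g p v)"
  using metric unfolding riemannian_metric_def by blast

lemma g_sym: "v \<in> T p \<Longrightarrow> w \<in> T p \<Longrightarrow> g p v w = g p w v"
  using metric unfolding riemannian_metric_def by blast

lemma g_smooth: "vector_field A U X \<Longrightarrow> vector_field A U Y \<Longrightarrow> smooth_fun A U (\<lambda>p. g p (X p) (Y p))"
  using metric unfolding riemannian_metric_def by blast

lemma g_linear2: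
  assumes v: "v \<in> T p"
  shows "tangent_linear A p (\<lambda>w. g p w v)"
  unfolding tangent_linear_def
proof (intro ballI allI)
  fix x y a b assume x: "x \<in> T p" and y: "y \<in> T p"
  show "g p (\<lambda>f. a * x f + b * y f) v = a * g p x v + b * g p y v"
    using tangent_linearD[OF g_linear[OF v] x y, of a b]
    by (simp add: g_sym[OF _ v] x y tangent_space_lincomb)
qed

lemma g_smooth_near: "near p X \<Longrightarrow> near p Y \<Longrightarrow> smooth_near A p (\<lambda>p. g p (X p) (Y p))"
  by (metis g_smooth near_common smooth_near_def)

lemma g_covector: "near p X \<Longrightarrow> covector_near p (\<lambda>q. g q (X q))"
  unfolding covector_near_def
proof (intro conjI allI impI g_smooth_near)
  assume "near p X"
  from near_eventually[OF this] show "\<forall>\<^sub>F q in nhds p. tangent_linear A q (g q (X q))"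
    by eventually_elim (simp add: g_linear near_tangent)
qed

lemma g_deriv_sym:
  assumes "near p X" "near p Y" "v \<in> T p"
  shows "v (\<lambda>q. g q (X q) (Y q)) = v (\<lambda>q. g q (Y q) (X q))"
proof (rule tangent_cong[OF assms(3) g_smooth_near[OF assms(1,2)]])
  show "\<forall>\<^sub>F q in nhds p. g q (X q) (Y q) = g q (Y q) (X q)"
    using near_eventually[OF assms(1)] near_eventually[OF assms(2)]
    by eventually_elim (simp add: g_sym near_tangent)
qed

section \<open>Expansions in a local orthonormal frame\<close>

lemma section_near: "orthonormal_section A g U e \<Longrightarrow> p \<in> U \<Longrightarrow> near p (\<lambda>q. e q i)"
  by (auto simp: orthonormal_section_def intro: vector_field_nearI)

lemma section_tangent: "orthonormal_section A g U e \<Longrightarrow> p \<in> U \<Longrightarrow> e p i \<in> T p"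
  using section_near near_tangent by blast

lemma section_orthonormal:
  "orthonormal_section A g U e \<Longrightarrow> p \<in> U \<Longrightarrow> g p (e p i) (e p j) = (if i = j then 1 else 0)"
  by (auto simp: orthonormal_section_def)

lemma section_open: "orthonormal_section A g U e \<Longrightarrow> open U"
  unfolding orthonormal_section_def by (meson vector_field_open)

lemma section_expand:
  assumes e: "orthonormal_section A g U e" "p \<in> U" and v: "v \<in> T p"
  shows "v = (\<lambda>f. \<Sum>i\<in>UNIV. g p v (e p i) * e p i f)"
proof -
  obtain c :: "real^7" where c: "v = (\<lambda>f. \<Sum>i\<in>UNIV. c $ i * e p i f)"
    using e v unfolding orthonormal_section_def tangent_basis_def by metis
  have "g p v (e p k) = c $ k" for k
  proof -
    have "g p v (e p k) = g p (e p k) (\<lambda>f. \<Sum>i\<in>UNIV. c $ i * e p i f)"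
      using g_sym[OF v section_tangent[OF e]] c by simp
    also have "\<dots> = (\<Sum>i\<in>UNIV. c $ i * g p (e p k) (e p i))"
      by (rule tangent_linear_sum[OF g_linear[OF section_tangent[OF e]]])
        (simp_all add: section_tangent[OF e])
    also have "\<dots> = c $ k"
      by (simp add: section_orthonormal[OF e] if_distrib[of "\<lambda>x. _ * x"] cong: if_cong)
    finally show ?thesis .
  qed
  then show ?thesis by (subst c) simp
qed

lemma section_eqI:
  assumes e: "orthonormal_section A g U e" "p \<in> U" and v: "v \<in> T p" "w \<in> T p"
    and "\<And>i. g p v (e p i) = g p w (e p i)"
  shows "v = w"
  by (rule trans[OF section_expand[OF e v(1)]], subst assms(5))
    (rule section_expand[OF e v(2), symmetric])

lemma linear_expand:
  assumes e: "orthonormal_section A g U e" "p \<in> U" and L: "tangent_linear A p L" and v: "v \<in> T p"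
  shows "L v = (\<Sum>i\<in>UNIV. g p v (e p i) * L (e p i))"
  by (rule trans[OF arg_cong[OF section_expand[OF e v], of L]], rule tangent_linear_sum[OF L])
    (simp_all add: section_tangent[OF e])

text \<open>Near p the field X equals its expansion in the frame, whose coefficients are smooth.
  Tensoriality then takes the coefficients out, evaluated at p.\<close>

lemma tensorial_expand:
  assumes Q: "tensorial p Q" and e: "orthonormal_section A g U e" "p \<in> U" and X: "near p X"
  shows "Q X = (\<Sum>i\<in>UNIV. g p (X p) (e p i) * Q (\<lambda>q. e q i))"
proof -
  have "\<forall>\<^sub>F q in nhds p. q \<in> U"
    using section_open[OF e(1)] e(2) eventually_nhds by blast
  then have "\<forall>\<^sub>F q in nhds p. X q = (\<lambda>f. \<Sum>i\<in>UNIV. g q (X q) (e q i) * e q i f)"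
    using near_eventually[OF X]
    by eventually_elim (rule section_expand[OF e(1)], auto intro: near_tangent)
  then have "Q X = Q (\<lambda>q f. \<Sum>i\<in>UNIV. g q (X q) (e q i) * e q i f)"
    by (rule tensorial_cong[OF Q X])
  also have "\<dots> = (\<Sum>i\<in>UNIV. g p (X p) (e p i) * Q (\<lambda>q. e q i))"
    using X section_near[OF e] by (intro tensorial_sum[OF Q]) (auto intro: g_smooth_near)
  finally show ?thesis .
qed

lemma tensorial_pointwise:
  assumes "tensorial p Q" "near p X" "near p Y" "X p = Y p"
  shows "Q X = Q Y"
proof -
  obtain U e where "p \<in> U" "orthonormal_section A g U e" using frames by blast
  then show ?thesis using tensorial_expand[OF assms(1)] assms(2-) by simp
qed

lemma tensorial_zero:
  assumes "tensorial p Q" "orthonormal_section A g U e" "p \<in> U" "near p X"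
    and "\<And>i. Q (\<lambda>q. e q i) = 0"
  shows "Q X = 0"
  using tensorial_expand[OF assms(1-4)] assms(5) by simp

lemma extension:
  assumes "v \<in> T p"
  obtains X where "near p X" "X p = v"
proof -
  obtain U e where e: "orthonormal_section A g U e" "p \<in> U" using frames by blast
  let ?X = "\<lambda>q f. \<Sum>i\<in>UNIV. g p v (e p i) * e q i f"
  have "near p ?X"
    by (intro near_sum smooth_near_const section_near[OF e])
  moreover have "?X p = v" using section_expand[OF e assms] by simp
  ultimately show thesis by (rule that)
qed

section \<open>The Koszul expression, twice the inner product of the Levi-Civita derivative of Y
  along X with Z\<close>

definition koszul :: "('m \<Rightarrow> 'm tvec) \<Rightarrow> ('m \<Rightarrow> 'm tvec) \<Rightarrow> ('m \<Rightarrow> 'm tvec) \<Rightarrow> 'm \<Rightarrow> real" where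
  "koszul X Y Z p = X p (\<lambda>q. g q (Y q) (Z q)) + Y p (\<lambda>q. g q (Z q) (X q))
     - Z p (\<lambda>q. g q (X q) (Y q)) + g p (lie_bracket A X Y p) (Z p)
     - g p (lie_bracket A Y Z p) (X p) + g p (lie_bracket A Z X p) (Y p)"

lemma g_uminus:
  assumes "v \<in> T p" "w \<in> T p"
  shows "g p (\<lambda>f. - v f) w = - g p v w"
  using tangent_linear_mult[OF g_linear2[OF assms(2)] assms(1), of "- 1"] by simp

text \<open>If \<open>koszul X Y Z p\<close> is read as twice the inner product of the derivative of
  Y along X with Z, this identity says that the derivative is compatible with the metric.\<close>

lemma koszul_swap23:
  assumes "near p X" "near p Y" "near p Z"
  shows "koszul X Y Z p + koszul X Z Y p = 2 * X p (\<lambda>q. g q (Y q) (Z q))"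
proof -
  note t = near_tangent[OF assms(1)] near_tangent[OF assms(2)] near_tangent[OF assms(3)]
  show ?thesis
    unfolding koszul_def lie_bracket_skew[of X Y] lie_bracket_skew[of Y Z] lie_bracket_skew[of X Z]
      g_deriv_sym[OF assms(3,1) t(2)] g_deriv_sym[OF assms(3,2) t(1)] g_deriv_sym[OF assms(2,1) t(3)]
    by (simp add: t g_uminus lie_bracket_tangent assms)
qed

text \<open>In the same reading, this identity says that the torsion vanishes.\<close>

lemma koszul_swap12:
  assumes "near p X" "near p Y" "near p Z"
  shows "koszul X Y Z p - koszul Y X Z p = 2 * g p (lie_bracket A X Y p) (Z p)"
proof -
  note t = near_tangent[OF assms(1)] near_tangent[OF assms(2)] near_tangent[OF assms(3)]
  show ?thesis
    unfolding koszul_def lie_bracket_skew[of X Y] lie_bracket_skew[of Y Z] lie_bracket_skew[of X Z]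
      g_deriv_sym[OF assms(3,1) t(2)] g_deriv_sym[OF assms(3,2) t(1)] g_deriv_sym[OF assms(2,1) t(3)]
    by (simp add: t g_uminus lie_bracket_tangent assms)
qed

text \<open>Replacing Z by h Z, the derivatives of h from the first two terms cancel against those
  from the brackets of Z with X and with Y.\<close>

lemma koszul_tensorial3:
  assumes X: "near p X" and Y: "near p Y"
  shows "tensorial p (\<lambda>Z. koszul X Y Z p)"
  unfolding tensorial_def
proof (intro conjI allI impI; elim conjE)
  note t = near_tangent[OF X] near_tangent[OF Y]
  fix Z assume Z: "near p Z"
  have e: "koszul X Y Z p = X p (\<lambda>q. g q (Y q) (Z q)) + Y p (\<lambda>q. g q (X q) (Z q))
     - Z p (\<lambda>q. g q (X q) (Y q)) + g p (lie_bracket A X Y p) (Z p)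
     - g p (lie_bracket A Y Z p) (X p) - g p (lie_bracket A X Z p) (Y p)"
    if Z: "near p Z" for Z
    unfolding koszul_def lie_bracket_skew[of Z X] g_deriv_sym[OF Z X t(2)]
    by (simp add: g_uminus lie_bracket_tangent X Z t)
  show "koszul X Y (\<lambda>q f. Z q f + W q f) p = koszul X Y Z p + koszul X Y W p"
    if W: "near p W" for W
    unfolding e[OF Z] e[OF W] e[OF near_add[OF Z W]] lie_bracket_add[OF Z W X] lie_bracket_add[OF Z W Y]
    by (simp add: covector_deriv_add[OF g_covector t(1)] covector_deriv_add[OF g_covector t(2)]
        tangent_linear_add[OF g_linear] tangent_linear_add[OF g_linear2] X Y Z W t near_tangent
        lie_bracket_tangent)
  show "koszul X Y (\<lambda>q f. h q * Z q f) p = h p * koszul X Y Z p"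
    if h: "smooth_near A p h" for h
  proof -
    have b: "g p (\<lambda>f. h p * lie_bracket A W Z p f + W p h * Z p f) (V p)
        = h p * g p (lie_bracket A W Z p) (V p) + W p h * g p (Z p) (V p)"
      if "near p W" "near p V" for W V
      using that Z by (intro tangent_linearD[OF g_linear2]) (auto intro: near_tangent lie_bracket_tangent)
    show ?thesis
      unfolding e[OF Z] e[OF near_mult[OF h Z]] lie_bracket_mult[OF Z X h] lie_bracket_mult[OF Z Y h]
      using g_sym[OF t(1) near_tangent[OF Z]] g_sym[OF t(2) near_tangent[OF Z]]
      by (simp add: covector_deriv_mult[OF g_covector t(1)] covector_deriv_mult[OF g_covector t(2)]
          tangent_linear_mult[OF g_linear] b X Y Z h t near_tangent lie_bracket_tangent)
        (simp add: algebra_simps)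
  qed
  show "koszul X Y Z p = koszul X Y W p" if W: "\<forall>\<^sub>F q in nhds p. Z q = W q" for W
    unfolding e[OF Z] e[OF near_cong[OF Z W]]
    using covector_deriv_cong[OF g_covector[OF X] t(2) Z W] eventually_nhds_x_imp_x[OF W]
      covector_deriv_cong[OF g_covector[OF Y] t(1) Z W]
      lie_bracket_cong[OF Z X W] lie_bracket_cong[OF Z Y W] by simp
qed

text \<open>Instead of expanding six terms, \<open>koszul_swap23\<close> moves Y to the third slot,
  where the expression is tensorial. The extra summand arises from differentiating the metric term
  of that identity.\<close>

lemma koszul_leibniz:
  assumes X: "near p X" and Z: "near p Z" and Y: "near p Y" and h: "smooth_near A p h"
  shows "koszul X (\<lambda>q f. h q * Y q f) Z p = h p * koszul X Y Z p + 2 * X p h * g p (Y p) (Z p)"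
proof -
  note t = near_tangent[OF X] near_tangent[OF Y] near_tangent[OF Z]
  have "koszul X Z (\<lambda>q f. h q * Y q f) p = h p * koszul X Z Y p"
    using koszul_tensorial3[OF X Z] Y h unfolding tensorial_def by blast
  then have "koszul X (\<lambda>q f. h q * Y q f) Z p
      = 2 * X p (\<lambda>q. g q (Z q) (\<lambda>f. h q * Y q f)) - h p * koszul X Z Y p"
    using koszul_swap23[OF X Z near_mult[OF h Y]] by simp
  also have "X p (\<lambda>q. g q (Z q) (\<lambda>f. h q * Y q f))
      = h p * X p (\<lambda>q. g q (Z q) (Y q)) + X p h * g p (Y p) (Z p)"
    by (simp add: covector_deriv_mult[OF g_covector[OF Z] t(1) Y h] g_sym[OF t(2,3)])
  finally have *: "koszul X (\<lambda>q f. h q * Y q f) Z p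
      = 2 * (h p * X p (\<lambda>q. g q (Z q) (Y q)) + X p h * g p (Y p) (Z p)) - h p * koszul X Z Y p" .
  have **: "koszul X Y Z p = 2 * X p (\<lambda>q. g q (Z q) (Y q)) - koszul X Z Y p"
    using koszul_swap23[OF X Z Y] by simp
  show ?thesis unfolding * ** by (simp add: algebra_simps)
qed

lemma koszul_add:
  assumes X: "near p X" and Z: "near p Z" and Y: "near p Y" and W: "near p W"
  shows "koszul X (\<lambda>q f. Y q f + W q f) Z p = koszul X Y Z p + koszul X W Z p"
proof -
  have "koszul X Z (\<lambda>q f. Y q f + W q f) p = koszul X Z Y p + koszul X Z W p"
    using koszul_tensorial3[OF X Z] Y W unfolding tensorial_def by blast
  then show ?thesis
    using koszul_swap23[OF X Z Y] koszul_swap23[OF X Z W] koszul_swap23[OF X Z near_add[OF Y W]]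
      covector_deriv_add[OF g_covector[OF Z] near_tangent[OF X] Y W] by simp
qed

lemma koszul_cong:
  assumes X: "near p X" and Z: "near p Z" and Y: "near p Y" and W: "\<forall>\<^sub>F q in nhds p. Y q = W q"
  shows "koszul X Y Z p = koszul X W Z p"
proof -
  have "koszul X Z Y p = koszul X Z W p"
    by (rule tensorial_cong[OF koszul_tensorial3[OF X Z] Y W])
  then show ?thesis
    using koszul_swap23[OF X Z Y] koszul_swap23[OF X Z near_cong[OF Y W]]
      covector_deriv_cong[OF g_covector[OF Z] near_tangent[OF X] Y W] by simp
qed

text \<open>By \<open>koszul_swap12\<close> the slot of X is exchanged with the second one. The
  Leibniz term that appears there cancels against the one of the bracket.\<close>

lemma koszul_tensorial1:
  assumes Y: "near p Y" and Z: "near p Z"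
  shows "tensorial p (\<lambda>X. koszul X Y Z p)"
proof -
  have e: "koszul X Y Z p = koszul Y X Z p + 2 * g p (lie_bracket A X Y p) (Z p)"
    if "near p X" for X
    using koszul_swap12[OF that Y Z] by simp
  have b: "g p (lie_bracket A X Y p) (Z p) = - g p (lie_bracket A Y X p) (Z p)" if "near p X" for X
    using that Y Z by (simp add: lie_bracket_skew[of X Y] g_uminus lie_bracket_tangent near_tangent)
  note t = near_tangent[OF Y] near_tangent[OF Z]
  show ?thesis
    unfolding tensorial_def
  proof (intro conjI allI impI; elim conjE)
    fix X assume X: "near p X"
    show "koszul (\<lambda>q f. X q f + W q f) Y Z p = koszul X Y Z p + koszul W Y Z p"
      if W: "near p W" for W
      unfolding e[OF X] e[OF W] e[OF near_add[OF X W]] b[OF X] b[OF W] b[OF near_add[OF X W]]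
        lie_bracket_add[OF X W Y] koszul_add[OF Y Z X W]
      by (simp add: tangent_linear_add[OF g_linear2] X Y W t lie_bracket_tangent)
    show "koszul (\<lambda>q f. h q * X q f) Y Z p = h p * koszul X Y Z p"
      if h: "smooth_near A p h" for h
    proof -
      have "g p (\<lambda>f. h p * lie_bracket A Y X p f + Y p h * X p f) (Z p)
        = h p * g p (lie_bracket A Y X p) (Z p) + Y p h * g p (X p) (Z p)"
        using X Y Z by (intro tangent_linearD[OF g_linear2]) (auto intro: near_tangent lie_bracket_tangent)
      then show ?thesis
        unfolding e[OF X] e[OF near_mult[OF h X]] b[OF X] b[OF near_mult[OF h X]]
          lie_bracket_mult[OF X Y h] koszul_leibniz[OF Y Z X h] by (simp add: algebra_simps)
    qed
    show "koszul X Y Z p = koszul W Y Z p" if W: "\<forall>\<^sub>F q in nhds p. X q = W q" for W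
      unfolding e[OF X] e[OF near_cong[OF X W]] b[OF X] b[OF near_cong[OF X W]]
        koszul_cong[OF Y Z X W] lie_bracket_cong[OF X Y W] ..
  qed
qed

lemma koszul_smooth:
  assumes "vector_field A U X" "vector_field A U Y" "vector_field A U Z"
  shows "smooth_fun A U (\<lambda>p. koszul X Y Z p)"
proof -
  have d: "smooth_fun A U (\<lambda>p. V p (\<lambda>q. g q (W q) (Z q)))"
    if "vector_field A U V" "vector_field A U W" "vector_field A U Z" for V W Z
    by (rule vector_field_smooth[OF that(1) g_smooth[OF that(2,3)] subset_refl])
  show ?thesis
    unfolding koszul_def
    by (intro smooth_fun_add smooth_fun_minus d g_smooth vector_field_lie_bracket assms)
qed

text \<open>The metric connection with torsion \<tau>. Since \<open>koszul\<close> takes fields, the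
  condition ranges over all extensions X of v. The value zero outside the domain is the one required
  by \<open>affine_connection\<close>, so that uniqueness can be an equality of functions.\<close>

definition skew_conn :: "('m \<Rightarrow> 'm tvec \<Rightarrow> 'm tvec \<Rightarrow> 'm tvec \<Rightarrow> real) \<Rightarrow> 'm connection" where
  "skew_conn \<tau> p v Y = (if v \<in> T p \<and> near p Y
     then THE u. u \<in> T p \<and> (\<forall>X Z. near p X \<and> near p Z \<and> X p = v \<longrightarrow>
       2 * g p u (Z p) = koszul X Y Z p + \<tau> p v (Y p) (Z p))
     else (\<lambda>f. 0))"

text \<open>A single extension X of the direction is enough, because \<open>koszul\<close> is
  tensorial in X. The vector is pinned down by its inner products with a frame.\<close>

lemma skew_conn_eqI:
  assumes Y: "near p Y" and u: "u \<in> T p" and X: "near p X"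
    and eq: "\<And>Z. near p Z \<Longrightarrow> 2 * g p u (Z p) = koszul X Y Z p + \<tau> p (X p) (Y p) (Z p)"
  shows "skew_conn \<tau> p (X p) Y = u"
proof -
  have v: "X p \<in> T p" using X by (rule near_tangent)
  have "(THE u. u \<in> T p \<and> (\<forall>X' Z. near p X' \<and> near p Z \<and> X' p = X p \<longrightarrow>
       2 * g p u (Z p) = koszul X' Y Z p + \<tau> p (X p) (Y p) (Z p))) = u"
  proof (rule the_equality)
    show "u \<in> T p \<and> (\<forall>X' Z. near p X' \<and> near p Z \<and> X' p = X p \<longrightarrow>
       2 * g p u (Z p) = koszul X' Y Z p + \<tau> p (X p) (Y p) (Z p))"
    proof (intro conjI allI impI u; elim conjE)
      fix X' Z assume *: "near p X'" "near p Z" "X' p = X p"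
      then have "koszul X' Y Z p = koszul X Y Z p"
        by (intro tensorial_pointwise[OF koszul_tensorial1[OF Y *(2)] *(1) X])
      then show "2 * g p u (Z p) = koszul X' Y Z p + \<tau> p (X p) (Y p) (Z p)"
        using eq[OF *(2)] by simp
    qed
    fix u' assume u': "u' \<in> T p \<and> (\<forall>X' Z. near p X' \<and> near p Z \<and> X' p = X p \<longrightarrow>
       2 * g p u' (Z p) = koszul X' Y Z p + \<tau> p (X p) (Y p) (Z p))"
    obtain U e where e: "orthonormal_section A g U e" "p \<in> U" using frames by blast
    show "u' = u"
    proof (rule section_eqI[OF e _ u])
      show "u' \<in> T p" using u' by blast
      show "g p u' (e p i) = g p u (e p i)" for i
      proof -
        have "2 * g p u' (e p i) = koszul X Y (\<lambda>q. e q i) p + \<tau> p (X p) (Y p) (e p i)"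
          using u'[THEN conjunct2, rule_format, of X "\<lambda>q. e q i"] X section_near[OF e] by blast
        then show ?thesis using eq[OF section_near[OF e, of i]] by simp
      qed
    qed
  qed
  then show ?thesis using v Y by (simp add: skew_conn_def)
qed

lemma skew_conn_exists:
  assumes \<tau>: "alternating_at p (\<tau> p)" and X: "near p X" and Y: "near p Y"
  obtains u where "u \<in> T p" "skew_conn \<tau> p (X p) Y = u"
    "\<And>Z. near p Z \<Longrightarrow> 2 * g p u (Z p) = koszul X Y Z p + \<tau> p (X p) (Y p) (Z p)"
proof -
  obtain U e where e: "orthonormal_section A g U e" "p \<in> U" using frames by blast
  define Q where "Q Z = koszul X Y Z p + \<tau> p (X p) (Y p) (Z p)" for Z
  have Q: "tensorial p Q"
    unfolding Q_def[abs_def]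
    by (rule tensorial_add[OF koszul_tensorial3[OF X Y]
        tensorial_linear[OF alternating_linear(1)[OF \<tau> near_tangent[OF X] near_tangent[OF Y]]]])
  \<comment> \<open>The vector representing half of the functional Q, with its components read off
    in the orthonormal frame.\<close>
  define u where "u = (\<lambda>f. \<Sum>i\<in>UNIV. (Q (\<lambda>q. e q i) / 2) * e p i f)"
  have u: "u \<in> T p"
    unfolding u_def using section_tangent[OF e] by (intro tangent_space_sum)
  have *: "2 * g p u (Z p) = Q Z" if Z: "near p Z" for Z
  proof -
    have "g p u (Z p) = (\<Sum>i\<in>UNIV. (Q (\<lambda>q. e q i) / 2) * g p (e p i) (Z p))"
      unfolding u_def
      by (rule tangent_linear_sum[OF g_linear2[OF near_tangent[OF Z]]])
        (simp_all add: section_tangent[OF e])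
    also have "\<dots> = (\<Sum>i\<in>UNIV. (g p (Z p) (e p i) * Q (\<lambda>q. e q i)) / 2)"
      by (simp add: g_sym[OF section_tangent[OF e] near_tangent[OF Z]] mult.commute)
    finally show ?thesis
      using tensorial_expand[OF Q e Z] by (simp add: sum_divide_distrib[symmetric])
  qed
  have "skew_conn \<tau> p (X p) Y = u"
    using * by (intro skew_conn_eqI[OF Y u X]) (simp add: Q_def)
  then show thesis using that[OF u] * by (simp add: Q_def)
qed

lemma skew_conn_tangent:
  assumes "alternating_at p (\<tau> p)" "v \<in> T p" "near p Y"
  shows "skew_conn \<tau> p v Y \<in> T p"
  using assms by (metis extension skew_conn_exists)

lemma skew_conn_inner:
  assumes "alternating_at p (\<tau> p)" "near p X" "near p Y" "near p Z"
  shows "2 * g p (skew_conn \<tau> p (X p) Y) (Z p) = koszul X Y Z p + \<tau> p (X p) (Y p) (Z p)"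
  using assms by (metis skew_conn_exists)

lemma skew_conn_derivation:
  assumes \<tau>: "alternating_at p (\<tau> p)" and v: "v \<in> T p"
  shows "derivation_along p v (skew_conn \<tau> p v)"
proof -
  obtain X where X: "near p X" and v_eq: "v = X p" using extension[OF v] by metis
  note xt = near_tangent[OF X]
  note D = skew_conn_tangent[where \<tau> = \<tau>, OF \<tau> xt]
  note inner = skew_conn_inner[where \<tau> = \<tau>, OF \<tau> X]
  show ?thesis
    unfolding derivation_along_def v_eq
  proof (intro conjI allI impI; (elim conjE)?)
    fix Y assume Y: "near p Y"
    show "skew_conn \<tau> p (X p) Y \<in> T p" by (rule D[OF Y])
    show "skew_conn \<tau> p (X p) (\<lambda>q f. Y q f + Z q f)
        = (\<lambda>f. skew_conn \<tau> p (X p) Y f + skew_conn \<tau> p (X p) Z f)" if Z: "near p Z" for Z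
    proof (rule skew_conn_eqI[OF near_add[OF Y Z] tangent_space_add[OF D[OF Y] D[OF Z]] X])
      fix W assume W: "near p W"
      note wt = near_tangent[OF W]
      show "2 * g p (\<lambda>f. skew_conn \<tau> p (X p) Y f + skew_conn \<tau> p (X p) Z f) (W p)
          = koszul X (\<lambda>q f. Y q f + Z q f) W p + \<tau> p (X p) (\<lambda>f. Y p f + Z p f) (W p)"
        unfolding koszul_add[OF X W Y Z]
          tangent_linear_add[OF g_linear2[OF wt] D[OF Y] D[OF Z]]
          tangent_linear_add[OF alternating_linear(2)[OF \<tau> xt wt] near_tangent[OF Y] near_tangent[OF Z]]
          distrib_left inner[OF Y W] inner[OF Z W] by simp
    qed
    show "skew_conn \<tau> p (X p) (\<lambda>q f. h q * Y q f)
        = (\<lambda>f. X p h * Y p f + h p * skew_conn \<tau> p (X p) Y f)" if h: "smooth_near A p h" for h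
    proof (rule skew_conn_eqI[OF near_mult[OF h Y]
          tangent_space_lincomb[OF near_tangent[OF Y] D[OF Y]] X])
      fix W assume W: "near p W"
      note wt = near_tangent[OF W]
      have "2 * (X p h * g p (Y p) (W p) + h p * g p (skew_conn \<tau> p (X p) Y) (W p))
          = 2 * X p h * g p (Y p) (W p) + h p * (2 * g p (skew_conn \<tau> p (X p) Y) (W p))"
        by simp
      then show "2 * g p (\<lambda>f. X p h * Y p f + h p * skew_conn \<tau> p (X p) Y f) (W p)
          = koszul X (\<lambda>q f. h q * Y q f) W p + \<tau> p (X p) (\<lambda>f. h p * Y p f) (W p)"
        unfolding koszul_leibniz[OF X W Y h]
          tangent_linearD[OF g_linear2[OF wt] near_tangent[OF Y] D[OF Y]]
          tangent_linear_mult[OF alternating_linear(2)[OF \<tau> xt wt] near_tangent[OF Y]]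
          inner[OF Y W] by (simp add: distrib_left)
    qed
    show "skew_conn \<tau> p (X p) Y = skew_conn \<tau> p (X p) Z"
      if Z: "\<forall>\<^sub>F q in nhds p. Y q = Z q" for Z
    proof (rule skew_conn_eqI[OF Y D[OF near_cong[OF Y Z]] X])
      fix W assume W: "near p W"
      show "2 * g p (skew_conn \<tau> p (X p) Z) (W p) = koszul X Y W p + \<tau> p (X p) (Y p) (W p)"
        unfolding inner[OF near_cong[OF Y Z] W] koszul_cong[OF X W Y Z]
          eventually_nhds_x_imp_x[OF Z] ..
    qed
  qed
qed

lemma skew_conn_linear:
  assumes \<tau>: "alternating_at p (\<tau> p)" and Y: "near p Y" and v: "v \<in> T p" and w: "w \<in> T p"
  shows "skew_conn \<tau> p (\<lambda>f. a * v f + b * w f) Y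
    = (\<lambda>f. a * skew_conn \<tau> p v Y f + b * skew_conn \<tau> p w Y f)"
proof -
  obtain V where V: "near p V" and v_eq: "v = V p" using extension[OF v] by metis
  obtain W where W: "near p W" and w_eq: "w = W p" using extension[OF w] by metis
  note aV = near_mult[OF smooth_near_const V, of a] and bW = near_mult[OF smooth_near_const W, of b]
  note D = skew_conn_tangent[where \<tau> = \<tau>, OF \<tau> _ Y]
  have "skew_conn \<tau> p ((\<lambda>q f. a * V q f + b * W q f) p) Y
    = (\<lambda>f. a * skew_conn \<tau> p v Y f + b * skew_conn \<tau> p w Y f)"
  proof (rule skew_conn_eqI[OF Y tangent_space_lincomb[OF D[OF v] D[OF w]] near_add[OF aV bW]])
    fix Z assume Z: "near p Z"
    note zt = near_tangent[OF Z]
    have k: "koszul (\<lambda>q f. a * V q f + b * W q f) Y Z p = a * koszul V Y Z p + b * koszul W Y Z p"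
    proof -
      have "koszul (\<lambda>q f. a * V q f + b * W q f) Y Z p
          = koszul (\<lambda>q f. a * V q f) Y Z p + koszul (\<lambda>q f. b * W q f) Y Z p"
        using koszul_tensorial1[OF Y Z] aV bW unfolding tensorial_def by blast
      moreover have "koszul (\<lambda>q f. a * V q f) Y Z p = a * koszul V Y Z p"
        using koszul_tensorial1[OF Y Z] V smooth_near_const[of p a] unfolding tensorial_def by blast
      moreover have "koszul (\<lambda>q f. b * W q f) Y Z p = b * koszul W Y Z p"
        using koszul_tensorial1[OF Y Z] W smooth_near_const[of p b] unfolding tensorial_def by blast
      ultimately show ?thesis by simp
    qed
    have l: "g p (\<lambda>f. a * skew_conn \<tau> p v Y f + b * skew_conn \<tau> p w Y f) (Z p)
        = a * g p (skew_conn \<tau> p v Y) (Z p) + b * g p (skew_conn \<tau> p w Y) (Z p)"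
      by (rule tangent_linearD[OF g_linear2[OF zt] D[OF v] D[OF w]])
    have r: "\<tau> p (\<lambda>f. a * V p f + b * W p f) (Y p) (Z p)
        = a * \<tau> p (V p) (Y p) (Z p) + b * \<tau> p (W p) (Y p) (Z p)"
      by (rule tangent_linearD[OF alternating_linear(3)[OF \<tau> near_tangent[OF Y] zt]
          near_tangent[OF V] near_tangent[OF W]])
    have "2 * (a * g p (skew_conn \<tau> p v Y) (Z p) + b * g p (skew_conn \<tau> p w Y) (Z p))
        = a * (2 * g p (skew_conn \<tau> p (V p) Y) (Z p)) + b * (2 * g p (skew_conn \<tau> p (W p) Y) (Z p))"
      by (simp add: v_eq w_eq)
    also have "\<dots> = a * (koszul V Y Z p + \<tau> p (V p) (Y p) (Z p))
        + b * (koszul W Y Z p + \<tau> p (W p) (Y p) (Z p))"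
      by (simp only: skew_conn_inner[where \<tau> = \<tau>, OF \<tau>] V W Y Z)
    finally show "2 * g p (\<lambda>f. a * skew_conn \<tau> p v Y f + b * skew_conn \<tau> p w Y f) (Z p)
        = koszul (\<lambda>q f. a * V q f + b * W q f) Y Z p
          + \<tau> p (\<lambda>f. a * V p f + b * W p f) (Y p) (Z p)"
      unfolding k l r by (simp add: distrib_left)
  qed
  then show ?thesis by (simp add: v_eq w_eq)
qed

text \<open>Adding the defining equations for (Y, Z) and (Z, Y) cancels \<tau>, which is skew in the
  last two slots, and leaves \<open>koszul_swap23\<close>.\<close>

lemma skew_conn_metric:
  assumes \<tau>: "alternating_at p (\<tau> p)" and v: "v \<in> T p" and Y: "near p Y" and Z: "near p Z"
  shows "v (\<lambda>q. g q (Y q) (Z q)) = g p (skew_conn \<tau> p v Y) (Z p) + g p (Y p) (skew_conn \<tau> p v Z)"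
proof -
  obtain X where X: "near p X" and v_eq: "v = X p" using extension[OF v] by metis
  note t = near_tangent[OF X] near_tangent[OF Y] near_tangent[OF Z]
  have "\<tau> p (X p) (Z p) (Y p) = - \<tau> p (X p) (Y p) (Z p)"
    using \<tau> t unfolding alternating_at_def by blast
  moreover have "g p (Y p) (skew_conn \<tau> p (X p) Z) = g p (skew_conn \<tau> p (X p) Z) (Y p)"
    by (rule g_sym[OF t(2) skew_conn_tangent[where \<tau> = \<tau>, OF \<tau> t(1) Z]])
  ultimately show ?thesis
    using skew_conn_inner[where \<tau> = \<tau>, OF \<tau> X Y Z] skew_conn_inner[where \<tau> = \<tau>, OF \<tau> X Z Y] koszul_swap23[OF X Y Z]
    unfolding v_eq by linarith
qed

lemma g_minus:
  assumes "v \<in> T p" "w \<in> T p" "z \<in> T p"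
  shows "g p (\<lambda>f. v f - w f) z = g p v z - g p w z"
  using tangent_linearD[OF g_linear2[OF assms(3)] assms(1,2), of 1 "- 1"] by simp

lemma inner_torsion:
  assumes D: "\<And>v Y. v \<in> T p \<Longrightarrow> near p Y \<Longrightarrow> D p v Y \<in> T p"
    and X: "near p X" and Y: "near p Y" and Z: "near p Z"
  shows "torsion A D X Y p \<in> T p"
    "g p (torsion A D X Y p) (Z p)
      = g p (D p (X p) Y) (Z p) - g p (D p (Y p) X) (Z p) - g p (lie_bracket A X Y p) (Z p)"
  unfolding torsion_def
  by (simp_all add: g_minus tangent_space_minus D X Y Z near_tangent lie_bracket_tangent)

text \<open>Subtracting the defining equations for (X, Y) and (Y, X) doubles \<tau>, which is skew
  in the first two slots, and \<open>koszul_swap12\<close> accounts for the bracket.\<close>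

lemma skew_conn_torsion:
  assumes \<tau>: "alternating_at p (\<tau> p)" and X: "near p X" and Y: "near p Y" and Z: "near p Z"
  shows "g p (torsion A (skew_conn \<tau>) X Y p) (Z p) = \<tau> p (X p) (Y p) (Z p)"
proof -
  have "\<tau> p (Y p) (X p) (Z p) = - \<tau> p (X p) (Y p) (Z p)"
    using \<tau> near_tangent[OF X] near_tangent[OF Y] near_tangent[OF Z]
    unfolding alternating_at_def by blast
  then show ?thesis
    using skew_conn_inner[where \<tau> = \<tau>, OF \<tau> X Y Z] skew_conn_inner[where \<tau> = \<tau>, OF \<tau> Y X Z] koszul_swap12[OF X Y Z]
      inner_torsion(2)[where D = "skew_conn \<tau>", OF skew_conn_tangent[where \<tau> = \<tau>, OF \<tau>] X Y Z]
    by linarith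
qed

lemma skew_conn_affine:
  assumes "three_form A \<tau>"
  shows "affine_connection A (skew_conn \<tau>)"
proof -
  have \<tau>: "alternating_at p (\<tau> p)" for p using assms by (simp add: three_form_iff)
  have der: "derivation_along p v (skew_conn \<tau> p v)" if "v \<in> T p" for p v
    using \<tau> that by (rule skew_conn_derivation)
  show ?thesis
    unfolding affine_connection_def
  proof (intro conjI allI ballI impI)
    show "skew_conn \<tau> p v Y \<in> T p" if "near p Y" "v \<in> T p" for p v Y
      using that \<tau> by (simp add: skew_conn_tangent)
    show "skew_conn \<tau> p (\<lambda>f. a * v f + b * w f) Y
        = (\<lambda>f. a * skew_conn \<tau> p v Y f + b * skew_conn \<tau> p w Y f)"
      if "near p Y" "v \<in> T p" "w \<in> T p" for p v w a b Y
      using that \<tau> by (simp add: skew_conn_linear)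
    show "skew_conn \<tau> p v (\<lambda>q f. Y q f + Z q f) = (\<lambda>f. skew_conn \<tau> p v Y f + skew_conn \<tau> p v Z f)"
      if "v \<in> T p" "near p Y \<and> near p Z" for p v Y Z
      using der[OF that(1)] that(2) unfolding derivation_along_def by blast
    show "skew_conn \<tau> p v (\<lambda>q f. h q * Y q f) = (\<lambda>f. v h * Y p f + h p * skew_conn \<tau> p v Y f)"
      if "v \<in> T p" "smooth_near A p h \<and> near p Y" for p v h Y
      using der[OF that(1)] that(2) unfolding derivation_along_def by blast
    show "skew_conn \<tau> p v Y = skew_conn \<tau> p v Z"
      if "v \<in> T p" "near p Y \<and> (\<forall>\<^sub>F q in nhds p. Y q = Z q)" for p v Y Z
      using der[OF that(1)] that(2) unfolding derivation_along_def by blast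
    show "skew_conn \<tau> p v Y = (\<lambda>f. 0)" if "v \<notin> T p \<or> \<not> near p Y" for p v Y
      using that by (auto simp: skew_conn_def)
    fix U X Y assume XY: "vector_field A U X \<and> vector_field A U Y"
    show "vector_field A U (\<lambda>p. skew_conn \<tau> p (X p) Y)"
    proof (rule vector_field_local)
      show "open U" using XY vector_field_open by blast
      fix p assume "p \<in> U"
      obtain V e where e: "orthonormal_section A g V e" "p \<in> V" using frames by blast
      let ?W = "U \<inter> V"
      have W: "open ?W" using \<open>open U\<close> section_open[OF e(1)] by blast
      have X: "vector_field A ?W X" and Y: "vector_field A ?W Y"
        using XY vector_field_subset[OF _ W] by auto
      have E: "vector_field A ?W (\<lambda>q. e q i)" for i
        using e(1) vector_field_subset[OF _ W] unfolding orthonormal_section_def by blast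
      \<comment> \<open>The components of the derivative in the frame, taken from the defining
        equation. This form displays their smoothness.\<close>
      let ?c = "\<lambda>i q. (1/2) * (koszul X Y (\<lambda>q. e q i) q + \<tau> q (X q) (Y q) (e q i))"
      have c: "smooth_fun A ?W (?c i)" for i
        using assms X Y E W unfolding three_form_iff
        by (intro smooth_fun_mult smooth_fun_const smooth_fun_add koszul_smooth) auto
      have "vector_field A ?W (\<lambda>q f. \<Sum>i\<in>UNIV. ?c i q * e q i f)"
        by (intro vector_field_sum W c E)
      moreover have "(\<lambda>f. \<Sum>i\<in>UNIV. ?c i q * e q i f) = skew_conn \<tau> q (X q) Y" if q: "q \<in> ?W" for q
      proof -
        have n: "near q X" "near q Y" using X Y q by (auto intro: vector_field_nearI)
        have "?c i q = g q (skew_conn \<tau> q (X q) Y) (e q i)" for i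
          using skew_conn_inner[where \<tau> = \<tau>, OF \<tau> n section_near[OF e(1), of q i]] q by simp
        then show ?thesis
          using section_expand[OF e(1) _ skew_conn_tangent[where \<tau> = \<tau>, OF \<tau> near_tangent[OF n(1)] n(2)]] q
          by simp
      qed
      ultimately have "vector_field A ?W (\<lambda>p. skew_conn \<tau> p (X p) Y)"
        by (rule vector_field_cong)
      then show "\<exists>W. p \<in> W \<and> vector_field A W (\<lambda>p. skew_conn \<tau> p (X p) Y)"
        using \<open>p \<in> U\<close> e(2) by blast
    qed
  qed
qed

text \<open>The classical Koszul argument: compatibility with the metric replaces the three
  derivatives in \<open>koszul\<close>, and the torsion equation replaces the three brackets. What
  is left is the derivative of Y along X and torsion terms.\<close>

lemma skew_conn_unique:
  assumes D: "affine_connection A D" "metric_connection A g D"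
    and \<tau>: "\<And>p. alternating_at p (\<tau> p)"
    and tor: "\<And>p X Y Z. near p X \<Longrightarrow> near p Y \<Longrightarrow> near p Z \<Longrightarrow>
      g p (torsion A D X Y p) (Z p) = \<tau> p (X p) (Y p) (Z p)"
  shows "D = skew_conn \<tau>"
proof (intro ext)
  fix p v Y f
  show "D p v Y f = skew_conn \<tau> p v Y f"
  proof (cases "v \<in> T p \<and> near p Y")
    case True
    then have Y: "near p Y" by blast
    obtain X where X: "near p X" and v_eq: "v = X p" using extension True by metis
    have DT: "D p w W \<in> T p" if "w \<in> T p" "near p W" for w W
      using affine_connection_derivation[OF D(1) that(1)] that(2)
      unfolding derivation_along_def by blast
    have "skew_conn \<tau> p (X p) Y = D p (X p) Y"
    proof (rule skew_conn_eqI[OF Y DT[OF near_tangent[OF X] Y] X])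
      fix Z assume Z: "near p Z"
      note t = near_tangent[OF X] near_tangent[OF Y] near_tangent[OF Z]
      have m: "x p (\<lambda>q. g q (y q) (z q)) = g p (D p (x p) y) (z p) + g p (D p (x p) z) (y p)"
        if "near p x" "near p y" "near p z" for x y z
      proof -
        have "x p (\<lambda>q. g q (y q) (z q)) = g p (D p (x p) y) (z p) + g p (y p) (D p (x p) z)"
          using D(2) that near_tangent[OF that(1)] unfolding metric_connection_def by blast
        then show ?thesis
          using g_sym[OF near_tangent[OF that(2)] DT[OF near_tangent[OF that(1)] that(3)]] by simp
      qed
      have s: "g p (D p (x p) y) (z p) - g p (D p (y p) x) (z p) - g p (lie_bracket A x y p) (z p)
          = \<tau> p (x p) (y p) (z p)" if "near p x" "near p y" "near p z" for x y z
        using tor[OF that] inner_torsion(2)[where D = D, OF DT that] by simp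
      have a: "\<tau> p x y z = - \<tau> p y x z" "\<tau> p x y z = - \<tau> p x z y"
        if "x \<in> T p" "y \<in> T p" "z \<in> T p" for x y z
        using \<tau>[of p] that unfolding alternating_at_def by blast+
      \<comment> \<open>The torsion enters \<open>koszul\<close> in the three cyclic orders with
        signs -, +, -. As these values coincide, -\<tau> remains.\<close>
      have "\<tau> p (Y p) (Z p) (X p) = \<tau> p (X p) (Y p) (Z p)"
        "\<tau> p (Z p) (X p) (Y p) = \<tau> p (X p) (Y p) (Z p)"
        using a(2)[OF t(2,3,1)] a(1)[OF t(1,2,3)] a(1)[OF t(3,1,2)] a(2)[OF t(1,2,3)] by linarith+
      then show "2 * g p (D p (X p) Y) (Z p) = koszul X Y Z p + \<tau> p (X p) (Y p) (Z p)"
        unfolding koszul_def m[OF X Y Z] m[OF Y Z X] m[OF Z X Y]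
        using s[OF X Y Z] s[OF Y Z X] s[OF Z X Y] by linarith
    qed
    then show ?thesis by (simp add: v_eq)
  next
    case False
    then have "D p v Y = (\<lambda>f. 0)"
      using D(1)[unfolded affine_connection_def, THEN conjunct2, THEN conjunct2, THEN conjunct2,
        THEN conjunct2, THEN conjunct2] by blast
    then show ?thesis using False by (auto simp: skew_conn_def)
  qed
qed

lemma skew_conn_cong:
  assumes "\<And>u v w. u \<in> T p \<Longrightarrow> v \<in> T p \<Longrightarrow> w \<in> T p \<Longrightarrow> \<tau> p u v w = \<sigma> p u v w"
    and \<sigma>: "alternating_at p (\<sigma> p)"
  shows "skew_conn \<tau> p v Y = skew_conn \<sigma> p v Y"
proof (cases "v \<in> T p \<and> near p Y")
  case True
  then have Y: "near p Y" by blast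
  obtain X where X: "near p X" and v_eq: "v = X p" using extension True by metis
  show ?thesis
    unfolding v_eq
    by (rule skew_conn_eqI[OF Y skew_conn_tangent[where \<tau> = \<sigma>, OF \<sigma> near_tangent[OF X] Y] X])
      (simp add: skew_conn_inner[where \<tau> = \<sigma>, OF \<sigma> X Y] assms(1) near_tangent X Y)
qed (auto simp: skew_conn_def)

lemma three_form_zero: "three_form A (\<lambda>p u v w. 0)"
  by (auto simp: three_form_iff alternating_at_def tangent_linear_def
      intro: smooth_fun_const vector_field_open)

text \<open>The definite description asks for existence and uniqueness, and both are the case of
  zero torsion form.\<close>

lemma levi_civita_eq: "levi_civita A g = skew_conn (\<lambda>p u v w. 0)"
  unfolding levi_civita_def
proof (rule the_equality)
  let ?D = "skew_conn (\<lambda>p u v w. 0)"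
  have alt: "alternating_at p (\<lambda>u v w. 0)" for p
    using three_form_zero by (simp add: three_form_iff)
  have z: "g p (\<lambda>f. 0) w = 0" if "w \<in> T p" for p w
    using g_uminus[OF tangent_space_zero that] by simp
  show "affine_connection A ?D \<and> metric_connection A g ?D \<and>
     (\<forall>p X Y. near p X \<and> near p Y \<longrightarrow> torsion A ?D X Y p = (\<lambda>f. 0))"
  proof (intro conjI allI impI)
    show "affine_connection A ?D" by (rule skew_conn_affine[OF three_form_zero])
    show "metric_connection A g ?D"
      unfolding metric_connection_def
      by (intro allI ballI impI skew_conn_metric) (auto simp: alt)
    fix p X Y assume XY: "near p X \<and> near p Y"
    obtain U e where e: "orthonormal_section A g U e" "p \<in> U" using frames by blast
    have DT: "?D p v W \<in> T p" if "v \<in> T p" "near p W" for v W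
      using that by (intro skew_conn_tangent) (auto simp: alt)
    show "torsion A ?D X Y p = (\<lambda>f. 0)"
    proof (rule section_eqI[OF e _ tangent_space_zero])
      show "torsion A ?D X Y p \<in> T p"
        using XY by (intro inner_torsion(1)[where Z = X] DT) auto
      show "g p (torsion A ?D X Y p) (e p i) = g p (\<lambda>f. 0) (e p i)" for i
        using skew_conn_torsion[of p "\<lambda>p u v w. 0" X Y "\<lambda>q. e q i"] XY section_near[OF e]
        by (simp add: alt z section_tangent[OF e])
    qed
  qed
  fix D assume D: "affine_connection A D \<and> metric_connection A g D \<and>
     (\<forall>p X Y. near p X \<and> near p Y \<longrightarrow> torsion A D X Y p = (\<lambda>f. 0))"
  show "D = ?D"
    by (rule skew_conn_unique) (use D z near_tangent alt in auto)
qed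

end

section \<open>Connections preserving the structure\<close>

locale G2_manifold = charted A for A :: "('m::topological_space) chart set" +
  fixes g :: "'m \<Rightarrow> 'm tvec \<Rightarrow> 'm tvec \<Rightarrow> real"
    and \<omega> :: "'m \<Rightarrow> 'm tvec \<Rightarrow> 'm tvec \<Rightarrow> 'm tvec \<Rightarrow> real"
  assumes riemannian: "riemannian_metric A g"
    and G2: "G2_structure A g \<omega>"
begin

lemma adapted_orthonormal: "adapted_section A g \<omega> U e \<Longrightarrow> orthonormal_section A g U e"
  by (auto simp: adapted_section_def orthonormal_section_def adapted_frame_def oriented_frame_def)

lemma adapted_exists: "\<exists>U e. p \<in> U \<and> adapted_section A g \<omega> U e"
  using G2 by (simp add: G2_structure_def)

end

sublocale G2_manifold \<subseteq> riemannian A g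
  using riemannian adapted_exists adapted_orthonormal by unfold_locales blast+

context G2_manifold
begin

lemma omega_form: "three_form A \<omega>"
  using G2 by (simp add: G2_structure_def)

lemma omega_alternating: "alternating_at p (\<omega> p)"
  using omega_form by (simp add: three_form_iff)

lemma omega_adapted:
  "adapted_section A g \<omega> U e \<Longrightarrow> p \<in> U \<Longrightarrow>
    \<omega> p (e p i) (e p j) (e p k) = omega0 (axis i 1) (axis j 1) (axis k 1)"
  by (simp add: adapted_section_def adapted_frame_def)

lemma omega_smooth_near:
  assumes X: "near p X" and Y: "near p Y" and Z: "near p Z"
  shows "smooth_near A p (\<lambda>q. \<omega> q (X q) (Y q) (Z q))"
proof -
  obtain U where U: "p \<in> U" "vector_field A U X" "vector_field A U Y" using near_common[OF X Y] .
  obtain V where V: "p \<in> V" "vector_field A V Z" using Z by (auto simp: vector_field_near_def)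
  have "open (U \<inter> V)" using U V vector_field_open by blast
  then have "smooth_fun A (U \<inter> V) (\<lambda>q. \<omega> q (X q) (Y q) (Z q))"
    using omega_form U V vector_field_subset unfolding three_form_iff by (meson inf_le1 inf_le2)
  then show ?thesis using U V by (auto simp: smooth_near_def)
qed

lemma omega_covector:
  assumes X: "near p X" and Y: "near p Y"
  shows "covector_near p (\<lambda>q. \<omega> q (X q) (Y q))"
    "covector_near p (\<lambda>q z. \<omega> q (X q) z (Y q))"
    "covector_near p (\<lambda>q z. \<omega> q z (X q) (Y q))"
proof -
  have ev: "\<forall>\<^sub>F q in nhds p. X q \<in> T q \<and> Y q \<in> T q"
    using near_eventually[OF X] near_eventually[OF Y]
    by eventually_elim (simp add: near_tangent)
  show "covector_near p (\<lambda>q. \<omega> q (X q) (Y q))"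
    unfolding covector_near_def using ev X Y
    by (auto elim!: eventually_mono intro: alternating_linear[OF omega_alternating] omega_smooth_near)
  show "covector_near p (\<lambda>q z. \<omega> q (X q) z (Y q))"
    unfolding covector_near_def using ev X Y
    by (auto elim!: eventually_mono intro: alternating_linear[OF omega_alternating] omega_smooth_near)
  show "covector_near p (\<lambda>q z. \<omega> q z (X q) (Y q))"
    unfolding covector_near_def using ev X Y
    by (auto elim!: eventually_mono intro: alternating_linear[OF omega_alternating] omega_smooth_near)
qed

text \<open>A single point and a single direction, so that a connection can be tested before its
  torsion form is known to be smooth.\<close>

definition parallel_along :: "'m \<Rightarrow> 'm tvec \<Rightarrow> (('m \<Rightarrow> 'm tvec) \<Rightarrow> 'm tvec) \<Rightarrow> bool" where
  "parallel_along p v D \<longleftrightarrow> (\<forall>X Y Z. near p X \<and> near p Y \<and> near p Z \<longrightarrow>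
     v (\<lambda>q. \<omega> q (X q) (Y q) (Z q)) =
       \<omega> p (D X) (Y p) (Z p) + \<omega> p (X p) (D Y) (Z p) + \<omega> p (X p) (Y p) (D Z))"

definition conn_matrix :: "('m \<Rightarrow> 7 \<Rightarrow> 'm tvec) \<Rightarrow> 'm \<Rightarrow> (('m \<Rightarrow> 'm tvec) \<Rightarrow> 'm tvec) \<Rightarrow> real^7^7" where
  "conn_matrix e p D = (\<chi> i j. g p (D (\<lambda>q. e q j)) (e p i))"

lemma derivation_tangent:
  "derivation_along p v D \<Longrightarrow> near p Y \<Longrightarrow> D Y \<in> T p"
  by (simp add: derivation_along_def)

lemma omega0_expand: "omega0 x y z = (\<Sum>l\<in>UNIV. x $ l * omega0 (axis l 1) y z)"
proof -
  have "omega0 x y z = omega0 (\<Sum>l\<in>UNIV. x $ l *\<^sub>R axis l 1) y z"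
    by (simp add: basis_expansion[of x, unfolded scalar_mult_eq_scaleR])
  then show ?thesis
    by (simp add: linear_sum[OF linear_omega0(1)] linear_cmul[OF linear_omega0(1)])
qed

text \<open>The 3-form has constant components in an adapted frame, so its derivative on frame
  fields is zero. Of the covariant derivative only the algebraic action of the connection matrix is
  left.\<close>

lemma parallel_defect_frame:
  assumes e: "adapted_section A g \<omega> U e" "p \<in> U" and v: "v \<in> T p"
    and D: "derivation_along p v D"
  shows "v (\<lambda>q. \<omega> q (e q i) (e q j) (e q k)) = 0"
    "\<omega> p (D (\<lambda>q. e q i)) (e p j) (e p k) + \<omega> p (e p i) (D (\<lambda>q. e q j)) (e p k)
       + \<omega> p (e p i) (e p j) (D (\<lambda>q. e q k)) = act (conn_matrix e p D) i j k"
proof -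
  note s = adapted_orthonormal[OF e(1)] e(2)
  note t = section_tangent[OF s]
  have "\<forall>\<^sub>F q in nhds p. q \<in> U"
    using section_open[OF s(1)] e(2) eventually_nhds by blast
  then have "\<forall>\<^sub>F q in nhds p. omega0 (axis i 1) (axis j 1) (axis k 1) = \<omega> q (e q i) (e q j) (e q k)"
    by eventually_elim (simp add: omega_adapted[OF e(1)])
  from tangent_cong[OF v smooth_near_const this]
  show "v (\<lambda>q. \<omega> q (e q i) (e q j) (e q k)) = 0" by (simp add: tangent_const[OF v])
  have DT: "D (\<lambda>q. e q i) \<in> T p" for i
    using derivation_tangent[OF D section_near[OF s]] .
  have 1: "\<omega> p (D (\<lambda>q. e q i)) (e p j) (e p k)
      = cross_matrix (column i (conn_matrix e p D)) $ j $ k" for i j k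
  proof -
    have "\<omega> p (D (\<lambda>q. e q i)) (e p j) (e p k)
        = (\<Sum>l\<in>UNIV. g p (D (\<lambda>q. e q i)) (e p l) * \<omega> p (e p l) (e p j) (e p k))"
      by (rule linear_expand[OF s alternating_linear(3)[OF omega_alternating t t] DT])
    then show ?thesis
      unfolding cross_matrix_entry omega0_expand[of "column i (conn_matrix e p D)"]
      by (simp add: column_def conn_matrix_def omega_adapted[OF e])
  qed
  have a: "\<omega> p x y z = - \<omega> p y x z" "\<omega> p x y z = - \<omega> p x z y"
    if "x \<in> T p" "y \<in> T p" "z \<in> T p" for x y z
    using omega_alternating[of p] that unfolding alternating_at_def by blast+
  have cyc: "\<omega> p x y z = \<omega> p y z x" if "x \<in> T p" "y \<in> T p" "z \<in> T p" for x y z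
    using a(1)[OF that] a(2)[OF that(2,1,3)] by simp
  show "\<omega> p (D (\<lambda>q. e q i)) (e p j) (e p k) + \<omega> p (e p i) (D (\<lambda>q. e q j)) (e p k)
       + \<omega> p (e p i) (e p j) (D (\<lambda>q. e q k)) = act (conn_matrix e p D) i j k"
    using cyc[OF t[of i] DT[of j] t[of k]] cyc[OF DT[of k] t[of i] t[of j]]
      cyc[OF t[of i] t[of j] DT[of k]]
    by (simp add: act_def 1)
qed

text \<open>The covariant derivative of the 3-form is tensorial in all three slots, hence it
  vanishes as soon as it vanishes on the frame; there it is \<open>act\<close> of the connection
  matrix up to sign.\<close>

lemma parallel_along_iff:
  assumes e: "adapted_section A g \<omega> U e" "p \<in> U" and v: "v \<in> T p"
    and D: "derivation_along p v D"
  shows "parallel_along p v D \<longleftrightarrow> conn_matrix e p D \<in> g2"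
proof
  note s = adapted_orthonormal[OF e(1)] e(2)
  note frame = parallel_defect_frame[OF assms]
  {
    assume "parallel_along p v D"
    then have "v (\<lambda>q. \<omega> q (e q i) (e q j) (e q k)) = act (conn_matrix e p D) i j k" for i j k
      unfolding frame(2)[symmetric] using section_near[OF s] unfolding parallel_along_def by blast
    then show "conn_matrix e p D \<in> g2"
      by (simp add: frame(1) g2_iff_act)
  }
  assume M: "conn_matrix e p D \<in> g2"
  define Q where "Q X Y Z = v (\<lambda>q. \<omega> q (X q) (Y q) (Z q)) - \<omega> p (D X) (Y p) (Z p)
    - \<omega> p (X p) (D Y) (Z p) - \<omega> p (X p) (Y p) (D Z)" for X Y Z
  note alt = alternating_linear[OF omega_alternating]
  note DT = derivation_tangent[OF D]
  \<comment> \<open>Two of the correction terms are tensorial in Z on their own. The remaining one,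
    where D acts on Z, has to be paired with the derivative term as in
    \<open>tensorial_defect\<close>; the other slots are alike.\<close>
  have t3: "tensorial p (\<lambda>Z. Q X Y Z)" if X: "near p X" and Y: "near p Y" for X Y
  proof -
    have "tensorial p (\<lambda>Z. (v (\<lambda>q. \<omega> q (X q) (Y q) (Z q)) - \<omega> p (X p) (Y p) (D Z))
        - \<omega> p (D X) (Y p) (Z p) - \<omega> p (X p) (D Y) (Z p))"
      by (rule tensorial_minus[OF tensorial_minus[OF tensorial_defect[OF D v omega_covector(1)[OF X Y]]
          tensorial_linear[OF alt(1)[OF DT[OF X] near_tangent[OF Y]]]]
          tensorial_linear[OF alt(1)[OF near_tangent[OF X] DT[OF Y]]]])
    then show ?thesis by (simp add: Q_def algebra_simps)
  qed
  have t2: "tensorial p (\<lambda>Y. Q X Y Z)" if X: "near p X" and Z: "near p Z" for X Z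
  proof -
    have "tensorial p (\<lambda>Y. (v (\<lambda>q. \<omega> q (X q) (Y q) (Z q)) - \<omega> p (X p) (D Y) (Z p))
        - \<omega> p (D X) (Y p) (Z p) - \<omega> p (X p) (Y p) (D Z))"
      by (rule tensorial_minus[OF tensorial_minus[OF tensorial_defect[OF D v omega_covector(2)[OF X Z]]
          tensorial_linear[OF alt(2)[OF DT[OF X] near_tangent[OF Z]]]]
          tensorial_linear[OF alt(2)[OF near_tangent[OF X] DT[OF Z]]]])
    then show ?thesis by (simp add: Q_def algebra_simps)
  qed
  have t1: "tensorial p (\<lambda>X. Q X Y Z)" if Y: "near p Y" and Z: "near p Z" for Y Z
  proof -
    have "tensorial p (\<lambda>X. (v (\<lambda>q. \<omega> q (X q) (Y q) (Z q)) - \<omega> p (D X) (Y p) (Z p))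
        - \<omega> p (X p) (D Y) (Z p) - \<omega> p (X p) (Y p) (D Z))"
      by (rule tensorial_minus[OF tensorial_minus[OF tensorial_defect[OF D v omega_covector(3)[OF Y Z]]
          tensorial_linear[OF alt(3)[OF DT[OF Y] near_tangent[OF Z]]]]
          tensorial_linear[OF alt(3)[OF near_tangent[OF Y] DT[OF Z]]]])
    then show ?thesis by (simp add: Q_def algebra_simps)
  qed
  note n = section_near[OF s]
  have "Q (\<lambda>q. e q i) (\<lambda>q. e q j) (\<lambda>q. e q k) = 0" for i j k
    using frame[of i j k] M[unfolded g2_iff_act, rule_format, of i j k] by (simp add: Q_def)
  then have "Q (\<lambda>q. e q i) (\<lambda>q. e q j) Z = 0" if "near p Z" for i j Z
    using tensorial_zero[OF t3[OF n n] s that] by blast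
  then have "Q (\<lambda>q. e q i) Y Z = 0" if "near p Y" "near p Z" for i Y Z
    using tensorial_zero[OF t2[OF n that(2)] s that(1)] that(2) by blast
  then have "Q X Y Z = 0" if "near p X" "near p Y" "near p Z" for X Y Z
    using tensorial_zero[OF t1[OF that(2,3)] s that(1)] that(2,3) by blast
  then show "parallel_along p v D"
    unfolding parallel_along_def Q_def by fastforce
qed

lemma section_g_deriv:
  assumes e: "orthonormal_section A g U e" "p \<in> U" and v: "v \<in> T p"
  shows "v (\<lambda>q. g q (e q i) (e q j)) = 0"
proof -
  have "\<forall>\<^sub>F q in nhds p. q \<in> U"
    using section_open[OF e(1)] e(2) eventually_nhds by blast
  then have "\<forall>\<^sub>F q in nhds p. (if i = j then 1 else 0) = g q (e q i) (e q j)"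
    by eventually_elim (simp add: section_orthonormal[OF e(1)])
  from tangent_cong[OF v smooth_near_const this] show ?thesis by (simp add: tangent_const[OF v])
qed

text \<open>The same method for the metric: the components in the frame are constant, so skewness of
  the connection matrix kills the defect on the frame. Symmetry of the defect spares a second
  tensoriality argument.\<close>

lemma metric_along:
  assumes e: "orthonormal_section A g U e" "p \<in> U" and v: "v \<in> T p"
    and D: "derivation_along p v D" and M: "conn_matrix e p D \<in> so7"
    and X: "near p X" and Y: "near p Y"
  shows "v (\<lambda>q. g q (X q) (Y q)) = g p (D X) (Y p) + g p (X p) (D Y)"
proof -
  define Q where "Q X Y = v (\<lambda>q. g q (X q) (Y q)) - g p (D X) (Y p) - g p (X p) (D Y)" for X Y
  note DT = derivation_tangent[OF D] and n = section_near[OF e]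
  have t2: "tensorial p (\<lambda>Y. Q X Y)" if X: "near p X" for X
  proof -
    have "tensorial p (\<lambda>Y. (v (\<lambda>q. g q (X q) (Y q)) - g p (X p) (D Y)) - g p (D X) (Y p))"
      by (rule tensorial_minus[OF tensorial_defect[OF D v g_covector[OF X]]
          tensorial_linear[OF g_linear[OF DT[OF X]]]])
    then show ?thesis by (simp add: Q_def algebra_simps)
  qed
  have sym: "Q X Y = Q Y X" if X: "near p X" and Y: "near p Y" for X Y
    using g_deriv_sym[OF X Y v] g_sym[OF DT[OF X] near_tangent[OF Y]]
      g_sym[OF DT[OF Y] near_tangent[OF X]] by (simp add: Q_def)
  have "Q (\<lambda>q. e q i) (\<lambda>q. e q j) = 0" for i j
  proof -
    have "g p (D (\<lambda>q. e q i)) (e p j) = - g p (D (\<lambda>q. e q j)) (e p i)"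
      using M[unfolded so7_iff, rule_format, of j i] by (simp add: conn_matrix_def)
    then show ?thesis
      using section_g_deriv[OF e v] g_sym[OF DT[OF n] near_tangent[OF n], of j i] by (simp add: Q_def)
  qed
  then have "Q (\<lambda>q. e q i) Z = 0" if "near p Z" for i Z
    using tensorial_zero[OF t2[OF n] e that] by blast
  then have "Q Z (\<lambda>q. e q i) = 0" if "near p Z" for i Z
    using sym[OF that n] that by simp
  then have "Q X Y = 0"
    using tensorial_zero[OF t2[OF X] e Y] X by blast
  then show ?thesis by (simp add: Q_def)
qed

section \<open>Torsion and connection coefficients as arrays\<close>

definition frame_tensor :: "('m \<Rightarrow> 7 \<Rightarrow> 'm tvec) \<Rightarrow> 'm \<Rightarrow> ('m tvec \<Rightarrow> 'm tvec \<Rightarrow> 'm tvec \<Rightarrow> real) \<Rightarrow> real^7^7^7" where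
  "frame_tensor e p t = (\<chi> k i j. t (e p k) (e p i) (e p j))"

definition conn_tensor :: "('m \<Rightarrow> 7 \<Rightarrow> 'm tvec) \<Rightarrow> 'm \<Rightarrow> real^7^7^7" where
  "conn_tensor e p = (\<chi> k. connection_form A g e p (e p k))"

lemma frame_tensor_alt7:
  assumes e: "orthonormal_section A g U e" "p \<in> U" and t: "alternating_at p t"
  shows "frame_tensor e p t \<in> alt7"
  unfolding alt7_def mem_Collect_eq
proof (intro allI)
  fix i j k
  show "frame_tensor e p t $ i $ j $ k = - frame_tensor e p t $ j $ i $ k \<and>
      frame_tensor e p t $ i $ j $ k = - frame_tensor e p t $ i $ k $ j"
    unfolding frame_tensor_def vec_lambda_beta
    by (intro conjI alternating_skew[OF t] section_tangent[OF e])
qed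

lemma alternating_expand:
  assumes e: "orthonormal_section A g U e" "p \<in> U" and t: "alternating_at p t"
    and T: "u \<in> T p" "v \<in> T p" "w \<in> T p"
  shows "t u v w = (\<Sum>k\<in>UNIV. \<Sum>i\<in>UNIV. \<Sum>j\<in>UNIV.
    g p u (e p k) * (g p v (e p i) * (g p w (e p j) * frame_tensor e p t $ k $ i $ j)))"
proof -
  note s = section_tangent[OF e]
  have 3: "t x y w = (\<Sum>j\<in>UNIV. g p w (e p j) * t x y (e p j))" if "x \<in> T p" "y \<in> T p" for x y
    by (rule linear_expand[OF e alternating_linear(1)[OF t that] T(3)])
  have 2: "t x v w = (\<Sum>i\<in>UNIV. g p v (e p i) * t x (e p i) w)" if "x \<in> T p" for x
    by (rule linear_expand[OF e alternating_linear(2)[OF t that T(3)] T(2)])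
  have 1: "t u v w = (\<Sum>k\<in>UNIV. g p u (e p k) * t (e p k) v w)"
    by (rule linear_expand[OF e alternating_linear(3)[OF t T(2,3)] T(1)])
  show ?thesis
    unfolding 1 2[OF s] 3[OF s s] frame_tensor_def by (simp add: sum_distrib_left)
qed

text \<open>The sign is minus because the entry i, j pairs the derivative of \<open>e_j\<close> with
  \<open>e_i\<close>, so that \<tau> takes \<open>e_j\<close> before \<open>e_i\<close>, opposite to
  the order in \<open>frame_tensor\<close>.\<close>

lemma conn_matrix_skew_conn:
  assumes e: "orthonormal_section A g U e" "p \<in> U" and \<tau>: "alternating_at p (\<tau> p)"
  shows "conn_matrix e p (skew_conn \<tau> p (e p k))
    = conn_tensor e p $ k - (1/2) *\<^sub>R frame_tensor e p (\<tau> p) $ k"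
proof -
  note n = section_near[OF e]
  have 0: "alternating_at p (\<lambda>u v w. 0)"
    using three_form_zero by (simp add: three_form_iff)
  have sk: "\<tau> p (e p k) (e p j) (e p i) = - \<tau> p (e p k) (e p i) (e p j)" for i j
    by (rule alternating_skew(2)[OF \<tau>]) (rule section_tangent[OF e])+
  have "g p (skew_conn \<tau> p (e p k) (\<lambda>q. e q j)) (e p i)
    = g p (levi_civita A g p (e p k) (\<lambda>q. e q j)) (e p i) - (1/2) * \<tau> p (e p k) (e p i) (e p j)" for i j
    using skew_conn_inner[where \<tau> = \<tau>, OF \<tau> n[of k] n[of j] n[of i]]
      skew_conn_inner[where \<tau> = "\<lambda>p u v w. 0", OF 0 n[of k] n[of j] n[of i]]
      sk[of j i]
    unfolding levi_civita_eq by linarith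
  then show ?thesis
    by (simp add: vec_eq_iff conn_matrix_def conn_tensor_def connection_form_def frame_tensor_def)
qed

lemma skew_conn_matrix_so7:
  assumes e: "orthonormal_section A g U e" "p \<in> U" and \<tau>: "alternating_at p (\<tau> p)" and v: "v \<in> T p"
  shows "conn_matrix e p (skew_conn \<tau> p v) \<in> so7"
  unfolding so7_iff
proof (intro allI)
  fix i j
  note n = section_near[OF e]
  have "g p (e p j) (skew_conn \<tau> p v (\<lambda>q. e q i)) = g p (skew_conn \<tau> p v (\<lambda>q. e q i)) (e p j)"
    by (rule g_sym[OF section_tangent[OF e] skew_conn_tangent[where \<tau> = \<tau>, OF \<tau> v n]])
  then show "conn_matrix e p (skew_conn \<tau> p v) $ i $ j = - conn_matrix e p (skew_conn \<tau> p v) $ j $ i"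
    using skew_conn_metric[where \<tau> = \<tau>, OF \<tau> v n[of j] n[of i]] section_g_deriv[OF e v, of j i]
    by (simp add: conn_matrix_def)
qed

text \<open>The connection matrices are skew because the connection is metric, so they lie in g2 iff
  their contractions vanish. Linearity in the direction reduces this to the seven frame vectors, and
  clearing the half in \<open>conn_matrix_skew_conn\<close> produces the factor 2.\<close>

lemma skew_conn_parallel_iff:
  assumes e: "adapted_section A g \<omega> U e" "p \<in> U" and \<tau>: "alternating_at p (\<tau> p)"
  shows "(\<forall>v\<in>T p. parallel_along p v (skew_conn \<tau> p v)) \<longleftrightarrow>
    tensor_contraction (frame_tensor e p (\<tau> p)) = 2 *\<^sub>R tensor_contraction (conn_tensor e p)"
proof -
  note s = adapted_orthonormal[OF e(1)] e(2)
  note st = section_tangent[OF s]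
  define M where "M v = conn_matrix e p (skew_conn \<tau> p v)" for v
  have M_sum: "M v = (\<Sum>k\<in>UNIV. g p v (e p k) *\<^sub>R M (e p k))" if v: "v \<in> T p" for v
  proof -
    have "tangent_linear A p (\<lambda>w. M w $ i $ j)" for i j
      unfolding tangent_linear_def
    proof (intro ballI allI)
      fix x y a b assume x: "x \<in> T p" and y: "y \<in> T p"
      note n = section_near[OF s, of j]
      show "M (\<lambda>f. a * x f + b * y f) $ i $ j = a * M x $ i $ j + b * M y $ i $ j"
        using tangent_linearD[OF g_linear2[OF st[of i]]
            skew_conn_tangent[where \<tau> = \<tau>, OF \<tau> x n] skew_conn_tangent[where \<tau> = \<tau>, OF \<tau> y n]]
        by (simp add: M_def conn_matrix_def skew_conn_linear[where \<tau> = \<tau>, OF \<tau> n x y])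
    qed
    from linear_expand[OF s this v] show ?thesis
      by (simp add: vec_eq_iff sum_component)
  qed
  have "(\<forall>v\<in>T p. parallel_along p v (skew_conn \<tau> p v)) \<longleftrightarrow> (\<forall>v\<in>T p. M v \<in> g2)"
    using parallel_along_iff[OF e _ skew_conn_derivation[where \<tau> = \<tau>, OF \<tau>]] by (simp add: M_def)
  also have "\<dots> \<longleftrightarrow> (\<forall>k. M (e p k) \<in> g2)"
  proof
    assume *: "\<forall>k. M (e p k) \<in> g2"
    show "\<forall>v\<in>T p. M v \<in> g2"
    proof
      fix v assume "v \<in> T p"
      then show "M v \<in> g2"
        unfolding M_sum[OF \<open>v \<in> T p\<close>] using *
        by (intro subspace_sum[OF subspace_g2] subspace_scale[OF subspace_g2]) auto
    qed
  qed (simp add: st)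
  also have "\<dots> \<longleftrightarrow> (\<forall>k. contraction (M (e p k)) = 0)"
    unfolding M_def g2_iff_contraction
    using skew_conn_matrix_so7[where \<tau> = \<tau>, OF s \<tau> st] by blast
  also have "\<dots> \<longleftrightarrow> (\<forall>k. contraction (frame_tensor e p (\<tau> p) $ k)
      = 2 *\<^sub>R contraction (conn_tensor e p $ k))"
  proof -
    have "x - (1/2) *\<^sub>R y = 0 \<longleftrightarrow> y = 2 *\<^sub>R x" for x y :: "real^7"
      by (auto simp: vec_eq_iff field_simps)
    then show ?thesis
      unfolding M_def conn_matrix_skew_conn[where \<tau> = \<tau>, OF s \<tau>] linear_diff[OF linear_contraction]
        linear_cmul[OF linear_contraction] by simp
  qed
  also have "\<dots> \<longleftrightarrow> tensor_contraction (frame_tensor e p (\<tau> p))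
      = 2 *\<^sub>R tensor_contraction (conn_tensor e p)"
    unfolding vec_eq_iff[of "tensor_contraction _"] by (simp add: tensor_contraction_def)
  finally show ?thesis .
qed

text \<open>The factor 1/6 stems from the projection to m7, the factor 2 from
  \<open>skew_conn_parallel_iff\<close>. Since \<open>alt7\<close> is a subspace, scaling by 12 or
  1/12 passes between the two equations.\<close>

lemma Gamma_component_iff:
  "Lambda14_component (Gamma_rep A g e p) = 0 \<longleftrightarrow>
    (\<exists>S\<in>alt7. tensor_contraction S = 2 *\<^sub>R tensor_contraction (conn_tensor e p))"
proof -
  let ?C = "tensor_contraction (conn_tensor e p)"
  have "Gamma_rep A g e p = cross_tensor ((1/6) *\<^sub>R ?C)"
    by (simp add: Gamma_rep_def cross_tensor_def ortho_proj_m7 tensor_contraction_def conn_tensor_def)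
  then have "Lambda14_component (Gamma_rep A g e p) = 0
      \<longleftrightarrow> (\<exists>S\<in>alt7. tensor_contraction S = (1/6) *\<^sub>R ?C)"
    by (simp add: Lambda14_component_eq_0_iff)
  also have "\<dots> \<longleftrightarrow> (\<exists>S\<in>alt7. tensor_contraction S = 2 *\<^sub>R ?C)"
  proof
    assume "\<exists>S\<in>alt7. tensor_contraction S = (1/6) *\<^sub>R ?C"
    then obtain S where "S \<in> alt7" "tensor_contraction S = (1/6) *\<^sub>R ?C" by blast
    then show "\<exists>S\<in>alt7. tensor_contraction S = 2 *\<^sub>R ?C"
      by (intro bexI[of _ "12 *\<^sub>R S"])
        (simp_all add: linear_cmul[OF linear_tensor_contraction] subspace_scale[OF subspace_alt7])
  next
    assume "\<exists>S\<in>alt7. tensor_contraction S = 2 *\<^sub>R ?C"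
    then obtain S where "S \<in> alt7" "tensor_contraction S = 2 *\<^sub>R ?C" by blast
    then show "\<exists>S\<in>alt7. tensor_contraction S = (1/6) *\<^sub>R ?C"
      by (intro bexI[of _ "(1/12) *\<^sub>R S"])
        (simp_all add: linear_cmul[OF linear_tensor_contraction] subspace_scale[OF subspace_alt7])
  qed
  finally show ?thesis .
qed

lemma parallel_three_form_iff:
  "parallel_three_form A \<omega> D \<longleftrightarrow> (\<forall>p. \<forall>v\<in>T p. parallel_along p v (D p v))"
  unfolding parallel_three_form_def parallel_along_def by blast

lemma parallel_connection_eq:
  assumes D: "affine_connection A D" "parallel_three_form A \<omega> D" and \<tau>: "three_form A \<tau>"
    and tor: "\<And>p X Y Z. near p X \<Longrightarrow> near p Y \<Longrightarrow> near p Z \<Longrightarrow>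
      g p (torsion A D X Y p) (Z p) = \<tau> p (X p) (Y p) (Z p)"
  shows "D = skew_conn \<tau>"
proof (rule skew_conn_unique[OF D(1)])
  show "metric_connection A g D"
    unfolding metric_connection_def
  proof (intro allI ballI impI)
    fix p X Y v assume v: "v \<in> T p" and XY: "near p X \<and> near p Y"
    obtain U e where e: "p \<in> U" "adapted_section A g \<omega> U e" using adapted_exists by blast
    have der: "derivation_along p v (D p v)"
      by (rule affine_connection_derivation[OF D(1) v])
    have "conn_matrix e p (D p v) \<in> g2"
      using D(2) v parallel_along_iff[OF e(2,1) v der] by (simp add: parallel_three_form_iff)
    then show "v (\<lambda>q. g q (X q) (Y q)) = g p (D p v X) (Y p) + g p (X p) (D p v Y)"
      using XY by (intro metric_along[OF adapted_orthonormal[OF e(2)] e(1) v der])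
        (auto simp: g2_def)
  qed
qed (use \<tau> tor in \<open>auto simp: three_form_iff\<close>)

section \<open>Existence and smoothness of the torsion form\<close>

lemma linear_array_expand:
  fixes l :: "real^7^7^7 \<Rightarrow> real"
  assumes "linear l"
  shows "l M = (\<Sum>a\<in>UNIV. \<Sum>b\<in>UNIV. \<Sum>c\<in>UNIV. M $ a $ b $ c * l (axis a (axis b (axis c 1))))"
proof -
  have ax: "linear (axis a :: 'b::real_vector \<Rightarrow> 'b^7)" for a :: 7
    by (rule linearI) (simp_all add: axis_def vec_eq_iff)
  have ex: "(\<Sum>a\<in>UNIV. axis a (x $ a)) = x" for x :: "'b::real_vector^7"
    by (simp add: vec_eq_iff axis_def)
  have 1: "l M = (\<Sum>a\<in>UNIV. l (axis a (M $ a)))"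
    unfolding linear_sum[OF assms, symmetric] ex ..
  have 2: "l (axis a N) = (\<Sum>b\<in>UNIV. l (axis a (axis b (N $ b))))" for a N
    unfolding linear_sum[OF assms, symmetric] linear_sum[OF ax, symmetric] ex ..
  have 3: "l (axis a (axis b v)) = (\<Sum>c\<in>UNIV. v $ c * l (axis a (axis b (axis c 1))))" for a b v
  proof -
    have "(\<Sum>c\<in>UNIV. v $ c *\<^sub>R axis c 1) = v"
      using basis_expansion[of v] by (simp add: scalar_mult_eq_scaleR)
    then have "l (axis a (axis b v)) = l (axis a (axis b (\<Sum>c\<in>UNIV. v $ c *\<^sub>R axis c 1)))"
      by simp
    then show ?thesis
      by (simp add: linear_sum[OF assms] linear_sum[OF ax] linear_cmul[OF ax] linear_cmul[OF assms])
  qed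
  show ?thesis
    unfolding 1
  proof (rule sum.cong[OF refl])
    fix a :: 7
    show "l (axis a (M $ a))
        = (\<Sum>b\<in>UNIV. \<Sum>c\<in>UNIV. M $ a $ b $ c * l (axis a (axis b (axis c 1))))"
      unfolding 2[of a "M $ a"] by (rule sum.cong[OF refl 3])
  qed
qed

lemma conn_tensor_smooth:
  assumes e: "orthonormal_section A g U e"
  shows "smooth_fun A U (\<lambda>q. conn_tensor e q $ a $ b $ c)"
proof -
  have E: "vector_field A U (\<lambda>q. e q i)" for i
    using e by (simp add: orthonormal_section_def)
  have "affine_connection A (levi_civita A g)"
    unfolding levi_civita_eq by (rule skew_conn_affine[OF three_form_zero])
  from this[unfolded affine_connection_def, THEN conjunct2, THEN conjunct2, THEN conjunct2,
        THEN conjunct2, THEN conjunct1]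
  have "vector_field A U (\<lambda>q. levi_civita A g q (e q a) (\<lambda>q. e q c))"
    using E by blast
  from g_smooth[OF this E] show ?thesis
    by (simp add: conn_tensor_def connection_form_def)
qed

text \<open>
  The torsion form is determined pointwise by the connection matrix in any adapted frame; this
  makes it independent of the frames chosen at the individual points and hence smooth.
\<close>

lemma torsion_form_exists:
  assumes \<Gamma>: "Gamma_Lambda14_zero A g \<omega>"
  obtains \<tau> where "three_form A \<tau>" "\<And>p. \<forall>v\<in>T p. parallel_along p v (skew_conn \<tau> p v)"
proof -
  obtain L where L: "linear L" "\<And>C. L C \<in> alt7" "\<And>S. S \<in> alt7 \<Longrightarrow> L (tensor_contraction S) = S"
    using tensor_contraction_left_inverse by blast
  \<comment> \<open>The only alternating array that can solve the equation of
    \<open>skew_conn_parallel_iff\<close> in the frame e. Its entries are fixed linear combinations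
    of the connection coefficients.\<close>
  define F where "F e p = L (2 *\<^sub>R tensor_contraction (conn_tensor e p))" for e p
  have tcF: "tensor_contraction (F e p) = 2 *\<^sub>R tensor_contraction (conn_tensor e p)"
    if "adapted_section A g \<omega> U e" "p \<in> U" for U e p
  proof -
    have "Lambda14_component (Gamma_rep A g e p) = 0"
      using \<Gamma> that unfolding Gamma_Lambda14_zero_def by blast
    then obtain S where S: "S \<in> alt7" "tensor_contraction S = 2 *\<^sub>R tensor_contraction (conn_tensor e p)"
      unfolding Gamma_component_iff by blast
    then show ?thesis using L(3)[OF S(1)] by (simp add: F_def)
  qed
  \<comment> \<open>Around every point some frame is chosen, with no regularity of the choice as the
    point varies. Smoothness of \<tau> therefore cannot be read off from its definition and has to
    wait for \<open>FT\<close>.\<close>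
  obtain U E where E: "\<And>p. p \<in> U p" "\<And>p. adapted_section A g \<omega> (U p) (E p)"
    using adapted_exists by metis
  note s = adapted_orthonormal[OF E(2)] E(1)
  define \<tau> where "\<tau> p u v w = (\<Sum>k\<in>UNIV. \<Sum>i\<in>UNIV. \<Sum>j\<in>UNIV.
    F (E p) p $ k $ i $ j * (g p u (E p p k) * g p v (E p p i) * g p w (E p p j)))" for p u v w
  have F: "F e p $ i $ j $ k = - F e p $ j $ i $ k" "F e p $ i $ j $ k = - F e p $ i $ k $ j"
    for e p i j k
    using L(2) unfolding F_def alt7_def by blast+
  have alt: "alternating_at p (\<tau> p)" for p
    unfolding alternating_at_def
  proof (intro ballI conjI)
    fix u v assume u: "u \<in> T p" and v: "v \<in> T p"
    show "tangent_linear A p (\<tau> p u v)"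
      unfolding tangent_linear_def
    proof (intro ballI allI)
      fix x y a b assume "x \<in> T p" "y \<in> T p"
      then have "g p (\<lambda>f. a * x f + b * y f) (E p p j) = a * g p x (E p p j) + b * g p y (E p p j)" for j
        by (intro tangent_linearD[OF g_linear2[OF section_tangent[OF s]]])
      then show "\<tau> p u v (\<lambda>f. a * x f + b * y f) = a * \<tau> p u v x + b * \<tau> p u v y"
        by (simp add: \<tau>_def sum_distrib_left sum.distrib[symmetric] algebra_simps)
    qed
    fix w assume "w \<in> T p"
    show "\<tau> p u v w = - \<tau> p v u w"
    proof -
      have "\<tau> p v u w = (\<Sum>i\<in>UNIV. \<Sum>k\<in>UNIV. \<Sum>j\<in>UNIV.
          F (E p) p $ k $ i $ j * (g p v (E p p k) * g p u (E p p i) * g p w (E p p j)))"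
        unfolding \<tau>_def by (rule sum.swap)
      also have "\<dots> = (\<Sum>i\<in>UNIV. \<Sum>k\<in>UNIV. \<Sum>j\<in>UNIV.
          - (F (E p) p $ i $ k $ j * (g p u (E p p i) * g p v (E p p k) * g p w (E p p j))))"
        by (intro sum.cong refl) (subst F(1), simp)
      finally show ?thesis by (simp add: \<tau>_def sum_negf)
    qed
    show "\<tau> p u v w = - \<tau> p u w v"
    proof -
      have "\<tau> p u w v = (\<Sum>k\<in>UNIV. \<Sum>j\<in>UNIV. \<Sum>i\<in>UNIV.
          F (E p) p $ k $ i $ j * (g p u (E p p k) * g p w (E p p i) * g p v (E p p j)))"
        unfolding \<tau>_def by (rule sum.cong[OF refl], rule sum.swap)
      also have "\<dots> = (\<Sum>k\<in>UNIV. \<Sum>j\<in>UNIV. \<Sum>i\<in>UNIV.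
          - (F (E p) p $ k $ j $ i * (g p u (E p p k) * g p v (E p p j) * g p w (E p p i))))"
        by (intro sum.cong refl) (subst F(2), simp)
      finally show ?thesis by (simp add: \<tau>_def sum_negf)
    qed
  qed
  have "frame_tensor (E p) p (\<tau> p) = F (E p) p" for p
    by (simp add: frame_tensor_def \<tau>_def section_orthonormal[OF s] vec_eq_iff
        if_distrib[of "\<lambda>x. _ * x"] if_distrib[of "\<lambda>x. x * _"] cong: if_cong)
  then have par: "\<forall>v\<in>T p. parallel_along p v (skew_conn \<tau> p v)" for p
    using skew_conn_parallel_iff[where \<tau> = \<tau>, OF E(2,1) alt] tcF[OF E(2,1)] by simp
  \<comment> \<open>Being parallel refers to no frame. Reading \<open>par\<close> in an arbitrary
    adapted frame e and applying L shows that the components of \<tau> in e are again given by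
    F.\<close>
  have FT: "frame_tensor e p (\<tau> p) = F e p" if "adapted_section A g \<omega> V e" "p \<in> V" for V e p
    using skew_conn_parallel_iff[where \<tau> = \<tau>, OF that alt] par
      L(3)[OF frame_tensor_alt7[OF adapted_orthonormal[OF that(1)] that(2) alt]] by (simp add: F_def)
  have "three_form A \<tau>"
    unfolding three_form_iff
  proof (intro conjI allI impI alt)
    fix V X Y Z assume V: "vector_field A V X \<and> vector_field A V Y \<and> vector_field A V Z"
    show "smooth_fun A V (\<lambda>p. \<tau> p (X p) (Y p) (Z p))"
    proof (rule smooth_fun_local)
      show "open V" using V vector_field_open by blast
      fix p assume "p \<in> V"
      obtain W e where e: "p \<in> W" "adapted_section A g \<omega> W e" using adapted_exists by blast
      note s = adapted_orthonormal[OF e(2)]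
      have o: "open (V \<inter> W)" using \<open>open V\<close> section_open[OF s] by blast
      have vf: "vector_field A (V \<inter> W) X" "vector_field A (V \<inter> W) Y" "vector_field A (V \<inter> W) Z"
        "vector_field A (V \<inter> W) (\<lambda>q. e q i)" for i
        using V s vector_field_subset[OF _ o] unfolding orthonormal_section_def by auto
      have F_smooth: "smooth_fun A (V \<inter> W) (\<lambda>q. F e q $ k $ i $ j)" for k i j
      proof -
        define l where "l M = L (2 *\<^sub>R tensor_contraction M) $ k $ i $ j" for M
        have "linear l"
          by (rule linearI) (simp_all add: l_def linear_add[OF linear_tensor_contraction]
              linear_cmul[OF linear_tensor_contraction] linear_add[OF L(1)] linear_cmul[OF L(1)]
              scaleR_add_right)
        then have "F e q $ k $ i $ j = (\<Sum>a\<in>UNIV. \<Sum>b\<in>UNIV. \<Sum>c\<in>UNIV.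
            conn_tensor e q $ a $ b $ c * l (axis a (axis b (axis c 1))))" for q
          using linear_array_expand[of l "conn_tensor e q"] by (simp add: F_def l_def)
        moreover have "smooth_fun A (V \<inter> W) (\<lambda>q. \<Sum>a\<in>UNIV. \<Sum>b\<in>UNIV. \<Sum>c\<in>UNIV.
            conn_tensor e q $ a $ b $ c * l (axis a (axis b (axis c 1))))"
          by (intro smooth_fun_sum smooth_fun_mult smooth_fun_const o
              smooth_fun_subset[OF conn_tensor_smooth[OF s]]) auto
        ultimately show ?thesis by simp
      qed
      \<comment> \<open>One frame e now serves all points of a neighbourhood of p, in place of the
        frames \<open>E q\<close> that define \<tau>.\<close>
      have "smooth_fun A (V \<inter> W) (\<lambda>q. \<Sum>k\<in>UNIV. \<Sum>i\<in>UNIV. \<Sum>j\<in>UNIV.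
          g q (X q) (e q k) * (g q (Y q) (e q i) * (g q (Z q) (e q j) * F e q $ k $ i $ j)))"
        by (intro smooth_fun_sum smooth_fun_mult g_smooth vf F_smooth o)
      then have "smooth_fun A (V \<inter> W) (\<lambda>q. \<tau> q (X q) (Y q) (Z q))"
      proof (rule smooth_fun_cong)
        fix q assume q: "q \<in> V \<inter> W"
        then have "X q \<in> T q" "Y q \<in> T q" "Z q \<in> T q"
          using vf vector_field_tangent by blast+
        then show "(\<Sum>k\<in>UNIV. \<Sum>i\<in>UNIV. \<Sum>j\<in>UNIV.
            g q (X q) (e q k) * (g q (Y q) (e q i) * (g q (Z q) (e q j) * F e q $ k $ i $ j)))
            = \<tau> q (X q) (Y q) (Z q)"
          using alternating_expand[OF s _ alt, of q "X q" "Y q" "Z q"] FT[OF e(2)] q by simp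
      qed
      then show "\<exists>W. p \<in> W \<and> smooth_fun A W (\<lambda>p. \<tau> p (X p) (Y p) (Z p))"
        using \<open>p \<in> V\<close> e(1) by blast
    qed
  qed
  then show thesis using that par by blast
qed

section \<open>The converse, uniqueness and reduction to torsion forms\<close>

lemma Gamma_zero_if_parallel:
  assumes \<tau>: "three_form A \<tau>" and par: "parallel_three_form A \<omega> (skew_conn \<tau>)"
  shows "Gamma_Lambda14_zero A g \<omega>"
  unfolding Gamma_Lambda14_zero_def
proof (intro allI impI; elim conjE)
  fix U e p assume e: "adapted_section A g \<omega> U e" "p \<in> U"
  have alt: "alternating_at p (\<tau> p)" using \<tau> by (simp add: three_form_iff)
  show "Lambda14_component (Gamma_rep A g e p) = 0"
    unfolding Gamma_component_iff
    using skew_conn_parallel_iff[where \<tau> = \<tau>, OF e alt] par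
      frame_tensor_alt7[OF adapted_orthonormal[OF e(1)] e(2) alt]
    by (auto simp: parallel_three_form_iff)
qed

text \<open>In an adapted frame both torsion arrays solve the same contraction equation, whose
  right-hand side is a Levi-Civita term, and contraction is injective on
  \<open>alt7\<close>.\<close>

lemma parallel_skew_conn_unique:
  assumes \<tau>: "three_form A \<tau>" "parallel_three_form A \<omega> (skew_conn \<tau>)"
    and \<sigma>: "three_form A \<sigma>" "parallel_three_form A \<omega> (skew_conn \<sigma>)"
  shows "skew_conn \<tau> = skew_conn \<sigma>"
proof (intro ext)
  fix p v Y f
  obtain U e where e: "p \<in> U" "adapted_section A g \<omega> U e" using adapted_exists by blast
  note s = adapted_orthonormal[OF e(2)] e(1)
  have alt: "alternating_at p (\<tau> p)" "alternating_at p (\<sigma> p)"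
    using \<tau>(1) \<sigma>(1) by (simp_all add: three_form_iff)
  have "tensor_contraction (frame_tensor e p (\<tau> p)) = tensor_contraction (frame_tensor e p (\<sigma> p))"
    using skew_conn_parallel_iff[where \<tau> = \<tau>, OF e(2,1) alt(1)]
      skew_conn_parallel_iff[where \<tau> = \<sigma>, OF e(2,1) alt(2)] \<tau>(2) \<sigma>(2)
    by (simp add: parallel_three_form_iff)
  then have "frame_tensor e p (\<tau> p) = frame_tensor e p (\<sigma> p)"
    using tensor_contraction_left_inverse frame_tensor_alt7[OF s alt(1)]
      frame_tensor_alt7[OF s alt(2)] by metis
  then have "\<tau> p u v w = \<sigma> p u v w" if "u \<in> T p" "v \<in> T p" "w \<in> T p" for u v w
    using alternating_expand[OF s alt(1) that] alternating_expand[OF s alt(2) that] by simp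
  then show "skew_conn \<tau> p v Y f = skew_conn \<sigma> p v Y f"
    using skew_conn_cong[where \<tau> = \<tau> and \<sigma> = \<sigma>, OF _ alt(2)] by simp
qed

text \<open>This turns existence and uniqueness of the connection into statements about 3-forms: a
  connection of the required kind is metric and thus recovered from its torsion.\<close>

lemma skew_parallel_connection_iff:
  "affine_connection A D \<and> skew_symmetric_torsion A g D \<and> parallel_three_form A \<omega> D \<longleftrightarrow>
    (\<exists>\<tau>. three_form A \<tau> \<and> D = skew_conn \<tau> \<and> parallel_three_form A \<omega> (skew_conn \<tau>))"
proof
  assume D: "affine_connection A D \<and> skew_symmetric_torsion A g D \<and> parallel_three_form A \<omega> D"
  then obtain \<tau> where \<tau>: "three_form A \<tau>" "\<And>p X Y Z. near p X \<Longrightarrow> near p Y \<Longrightarrow> near p Z \<Longrightarrow>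
      g p (torsion A D X Y p) (Z p) = \<tau> p (X p) (Y p) (Z p)"
    unfolding skew_symmetric_torsion_def by blast
  then have "D = skew_conn \<tau>" using D by (intro parallel_connection_eq) auto
  then show "\<exists>\<tau>. three_form A \<tau> \<and> D = skew_conn \<tau> \<and> parallel_three_form A \<omega> (skew_conn \<tau>)"
    using \<tau>(1) D by blast
next
  assume "\<exists>\<tau>. three_form A \<tau> \<and> D = skew_conn \<tau> \<and> parallel_three_form A \<omega> (skew_conn \<tau>)"
  then obtain \<tau> where \<tau>: "three_form A \<tau>" "D = skew_conn \<tau>" "parallel_three_form A \<omega> (skew_conn \<tau>)"
    by blast
  have alt: "alternating_at p (\<tau> p)" for p using \<tau>(1) by (simp add: three_form_iff)
  have "skew_symmetric_torsion A g (skew_conn \<tau>)"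
    unfolding skew_symmetric_torsion_def
    using \<tau>(1) skew_conn_torsion[where \<tau> = \<tau>, OF alt] by blast
  then show "affine_connection A D \<and> skew_symmetric_torsion A g D \<and> parallel_three_form A \<omega> D"
    using \<tau> skew_conn_affine by simp
qed

end

theorem theorem4p7:
  fixes A :: "('m::{t2_space, second_countable_topology}) chart set"
    and g :: "'m \<Rightarrow> 'm tvec \<Rightarrow> 'm tvec \<Rightarrow> real"
    and \<omega> :: "'m \<Rightarrow> 'm tvec \<Rightarrow> 'm tvec \<Rightarrow> 'm tvec \<Rightarrow> real"
  assumes "oriented_smooth_atlas A"
    and "riemannian_metric A g"
    and "G2_structure A g \<omega>"
  shows "(Gamma_Lambda14_zero A g \<omega> \<longleftrightarrow>
            (\<exists>D. affine_connection A D \<and> skew_symmetric_torsion A g D \<and> parallel_three_form A \<omega> D)) \<and>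
         (Gamma_Lambda14_zero A g \<omega> \<longrightarrow>
            (\<exists>!D. affine_connection A D \<and> skew_symmetric_torsion A g D \<and> parallel_three_form A \<omega> D))"
proof -
  interpret G2_manifold A g \<omega>
    using assms by unfold_locales (auto simp: oriented_smooth_atlas_def)
  have ex: "\<exists>\<tau>. three_form A \<tau> \<and> parallel_three_form A \<omega> (skew_conn \<tau>)"
    if "Gamma_Lambda14_zero A g \<omega>"
    using torsion_form_exists[OF that] parallel_three_form_iff by metis
  show ?thesis
    unfolding skew_parallel_connection_iff
    using ex Gamma_zero_if_parallel parallel_skew_conn_unique by blast
qed

end
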